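(* Let $\bar A=(A_0,A_1)$ be a compatible couple of (quasi-)Banach spaces with $A_0\cap A_1\neq\{0\}$. Let $0<q_1,r_1\le\infty$ and $a_1,b_1\in SV$ be such that $\|s^{-1/r_1}b_1(s)\|_{r_1,(1,\infty)}<\infty$ and $\left\|s^{-1/r_1}b_1(s)\|u^{-1/q_1}a_1(u)\|_{q_1,(0,s)}\right\|_{r_1,(0,1)}<\infty$, and put $$\chi_1(t)=\left\|s^{-1/r_1}b_1(s)\|u^{-1/q_1}a_1(u)\|_{q_1,(0,s)}\right\|_{r_1,(0,t)}+\|s^{-1/r_1}b_1(s)\|_{r_1,(t,\infty)}\|u^{-1/q_1}a_1(u)\|_{q_1,(0,t)}.$$ Let $0<\theta_0<1$, $0<r,r_0,q_0\le\infty$, $a,a_0,b_0\in SV$, and $\|s^{-1/r_0}b_0(s)\|_{r_0,(0,1)}<\infty$. Put $\chi_0(t)=a_0(t)\|s^{-1/r_0}b_0(s)\|_{r_0,(0,t)}$ and $\rho(t)=t^{1-\theta_0}\frac{\chi_0(t)}{\chi_1(t)}$. For given $0\le\theta\le1$ denote $a^{\#}=\chi_0^{1-\theta}\chi_1^{\theta}\,(a\circ\rho)$ and $\eta=(1-\theta)\theta_0+\theta$. (i) If $0<\theta<1$, then $\left(\bar A^{\mathcal R}_{\theta_0,r_0,b_0,q_0,a_0},\bar A^{\mathcal L}_{1,r_1,b_1,q_1,a_1}\right)_{\theta,r,a}=\bar A_{\eta,r,a^{\#}}$. (ii) If $\|s^{-1/r}a(s)\|_{r,(1,\infty)}<\infty$,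 then $\left(\bar A^{\mathcal R}_{\theta_0,r_0,b_0,q_0,a_0},\bar A^{\mathcal L}_{1,r_1,b_1,q_1,a_1}\right)_{0,r,a}=\bar A^{\mathcal R,\mathcal L}_{\theta_0,r,a\circ\rho,r_0,b_0,q_0,a_0}$. (iii) If $\|s^{-1/r}a(s)\|_{r,(0,1)}<\infty$, then, with $\theta=1$ (i.e. $a^{\#}=\chi_1\,(a\circ\rho)$), $\left(\bar A^{\mathcal R}_{\theta_0,r_0,b_0,q_0,a_0},\bar A^{\mathcal L}_{1,r_1,b_1,q_1,a_1}\right)_{1,r,a}=\bar A_{1,r,a^{\#}}\cap\bar A^{\mathcal L,\mathcal R}_{1,r,a\circ\rho,r_1,b_1,q_1,a_1}$.
   Context: Conventions: $1/\infty=0$; $\|\cdot\|_{q,(a,b)}$ is the usual (quasi-)norm of $L_q$ on the interval $(a,b)$, $0<q\le\infty$. Two positive functions satisfy $f\approx g$ (are equivalent) if $C^{-1}g\le f\le Cg$ for some constant $C>0$ independent of all significant quantities. $b\in SV$ (slowly varying) means that $b$ is a positive Lebesgue measurable function on $(0,\infty)$ such that for each $\varepsilon>0$ the function $t^{\varepsilon}b(t)$ is equivalent to an increasing function and $t^{-\varepsilon}b(t)$ is equivalent to a decreasing function. For a compatible couple $(X_0,X_1)$ of (quasi-)normed spaces, $K(t,f;X_0,X_1)=\inf\{\|f_0\|_{X_0}+t\|f_1\|_{X_1}: f=f_0+f_1,\ f_i\in X_i\}$ for $f\in X_0+X_1$, $t>0$; $K(t,f):=K(t,f;A_0,A_1)$.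 For $0\le\theta\le1$, $0<q\le\infty$, $b\in SV$, $(X_0,X_1)_{\theta,q,b}$ is the space of all $f\in X_0+X_1$ with finite (quasi-)norm $\|u^{-\theta-1/q}b(u)K(u,f;X_0,X_1)\|_{q,(0,\infty)}$, and $\bar A_{\theta,q,b}:=(A_0,A_1)_{\theta,q,b}$. For $0<p,r,q\le\infty$ and $a,b,c\in SV$, the following are the spaces of all $f\in A_0+A_1$ with finite (quasi-)norm: - $\bar A^{\mathcal L}_{\theta,r,b,q,a}$: $\left\|t^{-1/r}b(t)\|u^{-\theta-1/q}a(u)K(u,f)\|_{q,(0,t)}\right\|_{r,(0,\infty)}$; - $\bar A^{\mathcal R}_{\theta,r,b,q,a}$: $\left\|t^{-1/r}b(t)\|u^{-\theta-1/q}a(u)K(u,f)\|_{q,(t,\infty)}\right\|_{r,(0,\infty)}$; - $\bar A^{\mathcal R,\mathcal L}_{\theta,p,c,r,b,q,a}$: $\left\|t^{-1/p}c(t)\left\|u^{-1/r}b(u)\|v^{-\theta-1/q}a(v)K(v,f)\|_{q,(u,t)}\right\|_{r,(0,t)}\right\|_{p,(0,\infty)}$; - $\bar A^{\mathcal L,\mathcal R}_{\theta,p,c,r,b,q,a}$: $\left\|t^{-1/p}c(t)\left\|u^{-1/r}b(u)\|v^{-\theta-1/q}a(v)K(v,f)\|_{q,(t,u)}\right\|_{r,(t,\infty)}\right\|_{p,(0,\infty)}$. Equality of (quasi-)normed spaces means that each is continuously embedded in the other; intersections carry the maximum (equivalently, the sum) of the (quasi-)norms. Standing assumption: none of the spaces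 under consideration is $\{0\}$. *)

theory Defs
  imports "HOL-Analysis.Analysis"
begin

text \<open>
  An exponent \<open>q\<close> with \<open>0 < q \<le> \<infinity>\<close> is an \<open>ennreal\<close> with \<open>0 < q\<close>.  As \<open>inverse \<infinity> = 0\<close> in
  \<open>ennreal\<close>, the function below implements the convention \<open>1/\<infinity> = 0\<close>.
\<close>

definition recip :: "ennreal \<Rightarrow> real" where
  "recip q = enn2real (inverse q)"

text \<open>Power with real exponent on \<open>[0,\<infinity>]\<close>, meant for \<open>p > 0\<close>.\<close>

definition epow :: "ennreal \<Rightarrow> real \<Rightarrow> ennreal" where
  "epow x p = (if x = \<infinity> then \<infinity> else ennreal (enn2real x powr p))"

text \<open>
  The usual quasi-norm of \<open>L\<^sub>q\<close> on \<open>S\<close>, for \<open>[0,\<infinity>]\<close>-valued functions.  For \<open>q = \<infinity>\<close> it is the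
  essential supremum; \<open>esssup\<close> of \<open>HOL-Probability\<close> is not used because it is \<open>\<infinity>\<close> by fiat on
  non-measurable functions, and a composition of Lebesgue measurable functions, such as a
  slowly varying \<open>a\<close> with a \<open>\<rho>\<close> built from slowly varying functions, may fail to be measurable.
\<close>

definition Lq_norm :: "ennreal \<Rightarrow> real set \<Rightarrow> (real \<Rightarrow> ennreal) \<Rightarrow> ennreal" where
  "Lq_norm q S f =
     (if q = \<infinity> then Inf {z. AE u in lebesgue_on S. f u \<le> z}
      else epow (\<integral>\<^sup>+ u. epow (f u) (enn2real q) \<partial>lebesgue_on S) (recip q))"

definition equivalent_pos :: "(real \<Rightarrow> real) \<Rightarrow> (real \<Rightarrow> real) \<Rightarrow> bool" where
  "equivalent_pos f g \<longleftrightarrow> (\<exists>C>0. \<forall>t>0. inverse C * g t \<le> f t \<and> f t \<le> C * g t)"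

text \<open>Only the values on \<open>(0,\<infinity>)\<close> matter.\<close>

definition SV :: "(real \<Rightarrow> real) set" where
  "SV = {b. b \<in> borel_measurable (lebesgue_on {0<..}) \<and> (\<forall>t>0. 0 < b t) \<and>
     (\<forall>\<epsilon>>0.
        (\<exists>g. (\<forall>t>0. 0 < g t) \<and> mono_on {0<..} g \<and> equivalent_pos (\<lambda>t. t powr \<epsilon> * b t) g) \<and>
        (\<exists>g. (\<forall>t>0. 0 < g t) \<and> antimono_on {0<..} g \<and> equivalent_pos (\<lambda>t. t powr (-\<epsilon>) * b t) g))}"

text \<open>
  Quasi-normed spaces are subspaces of an ambient real vector space, with a quasi-norm whose
  values off the subspace are irrelevant.  (Complex spaces are covered, being real ones.)
\<close>

record 'a qspace =
  pts :: "'a set"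
  qnorm :: "'a \<Rightarrow> real"

definition quasi_normed :: "'a::real_vector qspace \<Rightarrow> bool" where
  "quasi_normed X \<longleftrightarrow>
     subspace (pts X) \<and>
     (\<forall>x\<in>pts X. 0 \<le> qnorm X x) \<and>
     (\<forall>x\<in>pts X. qnorm X x = 0 \<longleftrightarrow> x = 0) \<and>
     (\<forall>c. \<forall>x\<in>pts X. qnorm X (c *\<^sub>R x) = \<bar>c\<bar> * qnorm X x) \<and>
     (\<exists>C\<ge>1. \<forall>x\<in>pts X. \<forall>y\<in>pts X. qnorm X (x + y) \<le> C * (qnorm X x + qnorm X y))"

definition quasi_banach :: "'a::real_vector qspace \<Rightarrow> bool" where
  "quasi_banach X \<longleftrightarrow>
     quasi_normed X \<and>
     (\<forall>s::nat \<Rightarrow> 'a. (\<forall>n. s n \<in> pts X) \<and> (\<forall>e>0. \<exists>N. \<forall>m\<ge>N. \<forall>n\<ge>N. qnorm X (s m - s n) < e)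
        \<longrightarrow> (\<exists>x\<in>pts X. (\<lambda>n. qnorm X (s n - x)) \<longlonglongrightarrow> 0))"

definition hausdorff_tvs :: "'a::real_vector topology \<Rightarrow> bool" where
  "hausdorff_tvs T \<longleftrightarrow>
     topspace T = UNIV \<and> Hausdorff_space T \<and>
     continuous_map (prod_topology T T) T (\<lambda>(x, y). x + y) \<and>
     continuous_map (prod_topology euclideanreal T) T (\<lambda>(c, x). c *\<^sub>R x)"

text \<open>Continuity at \<open>0\<close> of the (linear) inclusion.\<close>

definition embedded_in_tvs :: "'a::real_vector qspace \<Rightarrow> 'a topology \<Rightarrow> bool" where
  "embedded_in_tvs X T \<longleftrightarrow>
     (\<forall>U. openin T U \<and> 0 \<in> U \<longrightarrow> (\<exists>\<delta>>0. \<forall>x\<in>pts X. qnorm X x < \<delta> \<longrightarrow> x \<in> U))"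

definition compatible_couple :: "'a::real_vector qspace \<Rightarrow> 'a qspace \<Rightarrow> bool" where
  "compatible_couple X0 X1 \<longleftrightarrow>
     (\<exists>T. hausdorff_tvs T \<and> embedded_in_tvs X0 T \<and> embedded_in_tvs X1 T)"

definition sum_pts :: "'a::real_vector qspace \<Rightarrow> 'a qspace \<Rightarrow> 'a set" where
  "sum_pts X0 X1 = {f0 + f1 | f0 f1. f0 \<in> pts X0 \<and> f1 \<in> pts X1}"

text \<open>Meant for \<open>t > 0\<close> and \<open>f \<in> sum_pts X0 X1\<close>, where the infimum is over a nonempty set.\<close>

definition K_functional ::
  "real \<Rightarrow> 'a::real_vector \<Rightarrow> 'a qspace \<Rightarrow> 'a qspace \<Rightarrow> real" where
  "K_functional t f X0 X1 =
     Inf {qnorm X0 f0 + t * qnorm X1 f1 | f0 f1. f0 \<in> pts X0 \<and> f1 \<in> pts X1 \<and> f = f0 + f1}"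

text \<open>The weight \<open>u\<^bsup>-\<theta>-1/q\<^esup> b(u)\<close>.\<close>

definition wt :: "real \<Rightarrow> ennreal \<Rightarrow> (real \<Rightarrow> real) \<Rightarrow> real \<Rightarrow> ennreal" where
  "wt \<theta> q b u = ennreal (u powr (-\<theta> - recip q) * b u)"

definition wK :: "'a::real_vector qspace \<Rightarrow> 'a qspace \<Rightarrow> real \<Rightarrow> ennreal \<Rightarrow> (real \<Rightarrow> real)
    \<Rightarrow> 'a \<Rightarrow> real \<Rightarrow> ennreal" where
  "wK X0 X1 \<theta> q b f u = wt \<theta> q b u * ennreal (K_functional u f X0 X1)"

definition space_of :: "'a::real_vector qspace \<Rightarrow> 'a qspace \<Rightarrow> ('a \<Rightarrow> ennreal) \<Rightarrow> 'a qspace" where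
  "space_of X0 X1 N = \<lparr>pts = {f \<in> sum_pts X0 X1. N f < \<infinity>}, qnorm = (\<lambda>f. enn2real (N f))\<rparr>"

definition interp_space :: "'a::real_vector qspace \<Rightarrow> 'a qspace \<Rightarrow> real \<Rightarrow> ennreal
    \<Rightarrow> (real \<Rightarrow> real) \<Rightarrow> 'a qspace" where
  "interp_space X0 X1 \<theta> q b = space_of X0 X1 (\<lambda>f. Lq_norm q {0<..} (wK X0 X1 \<theta> q b f))"

definition L_space :: "'a::real_vector qspace \<Rightarrow> 'a qspace \<Rightarrow> real \<Rightarrow> ennreal \<Rightarrow> (real \<Rightarrow> real)
    \<Rightarrow> ennreal \<Rightarrow> (real \<Rightarrow> real) \<Rightarrow> 'a qspace" where
  "L_space A0 A1 \<theta> r b q a = space_of A0 A1 (\<lambda>f.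
     Lq_norm r {0<..} (\<lambda>t. wt 0 r b t * Lq_norm q {0<..<t} (wK A0 A1 \<theta> q a f)))"

definition R_space :: "'a::real_vector qspace \<Rightarrow> 'a qspace \<Rightarrow> real \<Rightarrow> ennreal \<Rightarrow> (real \<Rightarrow> real)
    \<Rightarrow> ennreal \<Rightarrow> (real \<Rightarrow> real) \<Rightarrow> 'a qspace" where
  "R_space A0 A1 \<theta> r b q a = space_of A0 A1 (\<lambda>f.
     Lq_norm r {0<..} (\<lambda>t. wt 0 r b t * Lq_norm q {t<..} (wK A0 A1 \<theta> q a f)))"

definition RL_space :: "'a::real_vector qspace \<Rightarrow> 'a qspace \<Rightarrow> real \<Rightarrow> ennreal \<Rightarrow> (real \<Rightarrow> real)
    \<Rightarrow> ennreal \<Rightarrow> (real \<Rightarrow> real) \<Rightarrow> ennreal \<Rightarrow> (real \<Rightarrow> real) \<Rightarrow> 'a qspace" where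
  "RL_space A0 A1 \<theta> p c r b q a = space_of A0 A1 (\<lambda>f.
     Lq_norm p {0<..} (\<lambda>t. wt 0 p c t *
       Lq_norm r {0<..<t} (\<lambda>u. wt 0 r b u * Lq_norm q {u<..<t} (wK A0 A1 \<theta> q a f))))"

definition LR_space :: "'a::real_vector qspace \<Rightarrow> 'a qspace \<Rightarrow> real \<Rightarrow> ennreal \<Rightarrow> (real \<Rightarrow> real)
    \<Rightarrow> ennreal \<Rightarrow> (real \<Rightarrow> real) \<Rightarrow> ennreal \<Rightarrow> (real \<Rightarrow> real) \<Rightarrow> 'a qspace" where
  "LR_space A0 A1 \<theta> p c r b q a = space_of A0 A1 (\<lambda>f.
     Lq_norm p {0<..} (\<lambda>t. wt 0 p c t *
       Lq_norm r {t<..} (\<lambda>u. wt 0 r b u * Lq_norm q {t<..<u} (wK A0 A1 \<theta> q a f))))"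

definition inter_space :: "'a qspace \<Rightarrow> 'a qspace \<Rightarrow> 'a qspace" where
  "inter_space X Y = \<lparr>pts = pts X \<inter> pts Y, qnorm = (\<lambda>f. max (qnorm X f) (qnorm Y f))\<rparr>"

definition cont_embedded :: "'a qspace \<Rightarrow> 'a qspace \<Rightarrow> bool" where
  "cont_embedded X Y \<longleftrightarrow> pts X \<subseteq> pts Y \<and> (\<exists>C. \<forall>f\<in>pts X. qnorm Y f \<le> C * qnorm X f)"

definition space_eq :: "'a qspace \<Rightarrow> 'a qspace \<Rightarrow> bool" where
  "space_eq X Y \<longleftrightarrow> cont_embedded X Y \<and> cont_embedded Y X"

end

theory Submission
  imports Defs
begin

text \<open>
  All weights are slowly varying up to powers and \<open>K(u, f)\<close> changes by a bounded factor on
  \<open>[x\<^sub>k, x\<^bsub>k+1\<^esub>]\<close>, \<open>x\<^sub>k = exp (L k)\<close>, so every (iterated) norm of the theorem is equivalent to the corresponding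
  (iterated) \<open>\<ell>\<^sub>q\<close> norm of the samples \<open>K(x\<^sub>k, f)\<close>, \<open>k \<in> \<int>\<close>.  In the discrete picture a
  near-optimal decomposition of \<open>f\<close> at \<open>x\<^sub>n\<close> and elementary geometric sums give the Holmstedt-type formula
  \<open>K(\<rho>(x\<^sub>n), f; X\<^sub>0, X\<^sub>1) \<approx> I\<^sub>0(n, f) + \<rho>(x\<^sub>n) I\<^sub>1(n, f)\<close> for the couple of the two extreme spaces, where \<open>I\<^sub>0\<close> and
  \<open>I\<^sub>1\<close> are the inner norms of the RL and LR spaces.  For \<open>L\<close> large the points \<open>\<rho>(x\<^sub>n)\<close> grow
  geometrically, hence they sample the outer norm as well; this replaces the change of variables
  \<open>u = \<rho>(t)\<close>, which would meet the possibly non-measurable \<open>a \<circ> \<rho>\<close>.  Finally Hardy-type inequalities bound \<open>I\<^sub>0\<close>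
  (if \<open>\<theta> > 0\<close>) and \<open>I\<^sub>1\<close> (if \<open>\<theta> < 1\<close>) by the term
  \<open>x\<^sub>n\<^bsup>-\<theta>\<^sub>0\<^esup> \<chi>\<^sub>0(x\<^sub>n) K(x\<^sub>n, f)\<close>.
\<close>

section \<open>Quasi-norms of sequences indexed by the integers\<close>

text \<open>Exponents may lie below 1 and the spaces are only quasi-normed, so Minkowski and Jensen
  are not at hand. Estimates are termwise dominations by geometric factors followed by
  quasi-triangle inequalities, and each constant is fixed before the function, the index and the
  range. Measurability is avoided as follows: the nonnegative integral is a supremum over simple
  functions below the integrand, hence monotone for arbitrary integrands, and integrals are
  exchanged with sums only for step functions on the cells. The function \<rho> is t^(1-\<theta>0)
  times a slowly varying factor and need not be monotone. On a coarse grid the power outweighs that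
  factor, and this is what forces L to be large. Holmstedt formulas usually carry a middle term at
  the splitting point. Here \<rho> is by definition the ratio of the contributions of index n to the
  two extreme norms, so the middle term of the second norm, multiplied by \<rho>, becomes that of
  the first and is swallowed by \<open>I0\<close>. The three cases of \<theta> differ only in which
  of the two Hardy inequalities has a strictly decaying or growing weight.\<close>

lemma epow_mono: "x \<le> y \<Longrightarrow> 0 \<le> p \<Longrightarrow> epow x p \<le> epow y p"
  unfolding epow_def
  by (auto simp: top_unique intro!: ennreal_leI powr_mono2 enn2real_mono simp: less_top)

lemma epow_ennreal: "0 \<le> x \<Longrightarrow> epow (ennreal x) p = ennreal (x powr p)"
  by (simp add: epow_def)

lemma epow_0 [simp]: "epow 0 p = 0"
  by (simp add: epow_def)

lemma epow_mult: "0 < p \<Longrightarrow> epow (x * y) p = epow x p * epow y p"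
proof (cases "x = top \<or> y = top")
  case True
  assume "0 < p"
  then show ?thesis using True
    by (cases x; cases y) (auto simp: epow_def ennreal_mult_eq_top_iff ennreal_top_mult ennreal_mult_top ennreal_eq_0_iff powr_def)
next
  case False
  assume "0 < p"
  from False obtain a b where "x = ennreal a" "y = ennreal b" "0 \<le> a" "0 \<le> b"
    by (cases x; cases y) auto
  then show ?thesis
    by (simp add: epow_ennreal powr_mult flip: ennreal_mult)
qed

lemma epow_epow_inverse:
  assumes "0 < p" shows "epow (epow x p) (1 / p) = x" "epow (epow x (1 / p)) p = x"
  using assms by (cases x; simp add: epow_ennreal powr_powr; simp add: epow_def)+

lemma epow_less_top: "x < top \<Longrightarrow> epow x p < top"
  by (auto simp: epow_def)

text \<open>The sum is at most twice the maximum, and the power of a maximum is one of the two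
  powers. This holds for every p > 0 and replaces convexity.\<close>

lemma epow_add_le:
  assumes "0 < p" shows "epow (x + y) p \<le> ennreal (2 powr p) * (epow x p + epow y p)"
proof -
  have "x + y \<le> ennreal 2 * max x y"
  proof -
    have "x + y \<le> max x y + max x y" by (intro add_mono) auto
    also have "\<dots> = ennreal 2 * max x y" by (simp add: mult_2)
    finally show ?thesis .
  qed
  then have "epow (x + y) p \<le> epow (ennreal 2 * max x y) p"
    using assms by (intro epow_mono) auto
  also have "\<dots> = ennreal (2 powr p) * epow (max x y) p"
    using assms by (simp only: epow_mult epow_ennreal)
  also have "epow (max x y) p \<le> epow x p + epow y p"
    by (auto simp: max_def)
  finally show ?thesis by (simp add: mult_left_mono)
qed

lemma recip_finite:
  assumes "0 < q" "q \<noteq> top"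
  shows "recip q = 1 / enn2real q" "0 < enn2real q"
proof -
  obtain p where p: "q = ennreal p" "0 < p" using assms
    by (cases q) (auto simp: ennreal_zero_less_mult_iff)
  then show "recip q = 1 / enn2real q" "0 < enn2real q"
    by (simp_all add: recip_def inverse_ennreal divide_inverse)
qed

text \<open>The counting measure has no null sets, so the case q = \<infinity> is a plain supremum
  where \<open>Lq_norm\<close> needs an essential one. Integrals over \<open>count_space\<close>
  make divergent sums and arbitrary index sets harmless.\<close>

definition lq :: "ennreal \<Rightarrow> int set \<Rightarrow> (int \<Rightarrow> ennreal) \<Rightarrow> ennreal" where
  "lq q S f = (if q = \<infinity> then (SUP k\<in>S. f k)
     else epow (\<integral>\<^sup>+ k. epow (f k) (enn2real q) \<partial>count_space S) (recip q))"

lemma lq_finite: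
  "q \<noteq> top \<Longrightarrow> 0 < q \<Longrightarrow> lq q S f = epow (\<integral>\<^sup>+ k. epow (f k) (enn2real q) \<partial>count_space S) (1 / enn2real q)"
  by (simp add: lq_def recip_finite)

lemma epow_lq:
  "q \<noteq> top \<Longrightarrow> 0 < q \<Longrightarrow> epow (lq q S f) (enn2real q) = (\<integral>\<^sup>+ k. epow (f k) (enn2real q) \<partial>count_space S)"
  by (simp add: lq_finite epow_epow_inverse recip_finite)

lemma lq_leI:
  assumes "0 < q" "q \<noteq> top" "(\<integral>\<^sup>+ k. epow (f k) (enn2real q) \<partial>count_space S) \<le> epow z (enn2real q)"
  shows "lq q S f \<le> z"
  using epow_mono[OF assms(3), of "1 / enn2real q"] recip_finite[OF assms(1,2)]
  by (simp add: lq_finite assms epow_epow_inverse)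

lemma lq_leI':
  assumes "0 < q" "q \<noteq> top" "(\<integral>\<^sup>+ k. epow (f k) (enn2real q) \<partial>count_space S) \<le> c * epow z (enn2real q)"
  shows "lq q S f \<le> epow c (1 / enn2real q) * z"
proof (rule lq_leI[OF assms(1,2)])
  show "(\<integral>\<^sup>+ k. epow (f k) (enn2real q) \<partial>count_space S) \<le> epow (epow c (1 / enn2real q) * z) (enn2real q)"
    using assms recip_finite[OF assms(1,2)] by (simp add: epow_mult epow_epow_inverse)
qed

lemma lq_mono:
  assumes "0 < q" "S \<subseteq> T" "\<And>k. k \<in> S \<Longrightarrow> f k \<le> g k"
  shows "lq q S f \<le> lq q T g"
proof (cases "q = top")
  case True
  then show ?thesis using assms unfolding lq_def by (auto intro: SUP_mono)
next
  case False
  have "(\<integral>\<^sup>+ k. epow (f k) (enn2real q) \<partial>count_space S) \<le> (\<integral>\<^sup>+ k. epow (g k) (enn2real q) \<partial>count_space T)"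
    unfolding nn_integral_count_space_indicator[of S, simplified] nn_integral_count_space_indicator[of T, simplified]
    using assms recip_finite(2)[OF assms(1) False]
    by (intro nn_integral_mono) (auto simp: indicator_def epow_mono)
  then show ?thesis
    using False assms recip_finite[OF assms(1) False] by (simp add: lq_finite epow_mono)
qed

lemma lq_cmult:
  assumes "0 < q" shows "lq q S (\<lambda>k. c * f k) = c * lq q S f"
proof (cases "q = top")
  case True
  then show ?thesis by (simp add: lq_def SUP_mult_left_ennreal)
next
  case False
  then show ?thesis using assms recip_finite[OF assms False]
    by (simp add: lq_finite epow_mult nn_integral_cmult epow_epow_inverse)
qed

lemma lq_multc: "0 < q \<Longrightarrow> lq q S (\<lambda>k. f k * c) = lq q S f * c"
  using lq_cmult[of q S c f] by (simp add: mult.commute)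

lemma lq_point:
  assumes "0 < q" "k \<in> S" shows "f k \<le> lq q S f"
proof (cases "q = top")
  case True
  then show ?thesis using assms by (auto simp: lq_def intro: SUP_upper)
next
  case False
  have "epow (f k) (enn2real q) \<le> epow (lq q S f) (enn2real q)"
    unfolding epow_lq[OF False assms(1)] by (rule nn_integral_ge_point[OF assms(2)])
  then show ?thesis
    using epow_mono[of "epow (f k) (enn2real q)" "epow (lq q S f) (enn2real q)" "1 / enn2real q"]
      recip_finite[OF assms(1) False] by (simp add: epow_epow_inverse)
qed

text \<open>One constant serves all index sets and sequences. For finite exponent p it is the p-th
  root of 2^p * 2, crude but valid also for p < 1, where Minkowski's inequality fails.\<close>

lemma lq_add_le:
  assumes "0 < q"
  shows "\<exists>C<top. \<forall>S f g. lq q S (\<lambda>k. f k + g k) \<le> C * (lq q S f + lq q S g)"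
proof (cases "q = top")
  case True
  have "lq q S (\<lambda>k. f k + g k) \<le> 1 * (lq q S f + lq q S g)" for S f g
    unfolding lq_def using True by (auto intro!: SUP_least add_mono SUP_upper)
  then show ?thesis by (intro exI[of _ 1]) auto
next
  case False
  define p where "p = enn2real q"
  have p: "0 < p" using recip_finite[OF assms False] by (simp add: p_def)
  define C where "C = epow (ennreal (2 powr p) * 2) (1 / p)"
  have "lq q S (\<lambda>k. f k + g k) \<le> C * (lq q S f + lq q S g)" for S f g
    unfolding C_def p_def
  proof (rule lq_leI'[OF assms False], fold p_def)
    have "(\<integral>\<^sup>+ k. epow (f k + g k) p \<partial>count_space S)
       \<le> (\<integral>\<^sup>+ k. ennreal (2 powr p) * (epow (f k) p + epow (g k) p) \<partial>count_space S)"
      by (intro nn_integral_mono epow_add_le p)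
    also have "\<dots> = ennreal (2 powr p) * (epow (lq q S f) p + epow (lq q S g) p)"
      unfolding p_def epow_lq[OF False assms] by (subst nn_integral_cmult) (auto simp: nn_integral_add)
    also have "\<dots> \<le> ennreal (2 powr p) * (epow (lq q S f + lq q S g) p + epow (lq q S f + lq q S g) p)"
      using p by (intro mult_left_mono add_mono epow_mono) auto
    also have "\<dots> = ennreal (2 powr p) * 2 * epow (lq q S f + lq q S g) p"
      by (simp add: mult_2[symmetric] mult.assoc)
    finally show "(\<integral>\<^sup>+ k. epow (f k + g k) p \<partial>count_space S) \<le> ennreal (2 powr p) * 2 * epow (lq q S f + lq q S g) p" .
  qed
  moreover have "C < top" unfolding C_def by (intro epow_less_top) (simp add: ennreal_mult_less_top)
  ultimately show ?thesis by blast
qed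

lemma lq_indicator:
  assumes "0 < q" "S \<subseteq> T"
  shows "lq q T (\<lambda>k. f k * indicator S k) = lq q S f"
proof (cases "q = top")
  case True
  have "(SUP k\<in>T. f k * indicator S k) = (SUP k\<in>S. f k)"
  proof (intro antisym SUP_least)
    show "f k * indicator S k \<le> (SUP k\<in>S. f k)" for k
      by (auto simp: indicator_def intro: SUP_upper)
    show "f k \<le> (SUP k\<in>T. f k * indicator S k)" if "k \<in> S" for k
      using that assms(2) by (intro SUP_upper2[of k]) auto
  qed
  then show ?thesis using True by (simp add: lq_def)
next
  case False
  have "(\<integral>\<^sup>+ k. epow (f k * indicator S k) (enn2real q) \<partial>count_space T)
     = (\<integral>\<^sup>+ k. epow (f k) (enn2real q) * indicator S k \<partial>count_space T)"
    by (intro nn_integral_cong) (auto simp: indicator_def)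
  also have "\<dots> = (\<integral>\<^sup>+ k. epow (f k) (enn2real q) \<partial>count_space S)"
    using assms(2) by (subst (1 2) nn_integral_count_space_indicator) (auto intro!: nn_integral_cong simp: indicator_def)
  finally show ?thesis using False assms by (simp add: lq_finite)
qed

lemma lq_Un_le:
  assumes "0 < q"
  shows "\<exists>C<top. \<forall>S T f. lq q (S \<union> T) f \<le> C * (lq q S f + lq q T f)"
proof -
  obtain C where C: "C < top" "\<And>S f g. lq q S (\<lambda>k. f k + g k) \<le> C * (lq q S f + lq q S g)"
    using lq_add_le[OF assms] by blast
  have "lq q (S \<union> T) f \<le> C * (lq q S f + lq q T f)" for S T f
  proof -
    have "lq q (S \<union> T) f \<le> lq q (S \<union> T) (\<lambda>k. f k * indicator S k + f k * indicator T k)"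
      by (intro lq_mono assms) (auto simp: indicator_def)
    also have "\<dots> \<le> C * (lq q S f + lq q T f)"
      using C(2)[of "S \<union> T" "\<lambda>k. f k * indicator S k" "\<lambda>k. f k * indicator T k"]
      by (simp add: lq_indicator assms)
    finally show ?thesis .
  qed
  then show ?thesis using C(1) by blast
qed

lemma lq_shift:
  assumes "0 < q" shows "lq q ((\<lambda>k. k + n) ` S) f = lq q S (\<lambda>k. f (k + n))"
proof (cases "q = top")
  case True
  then show ?thesis by (simp add: lq_def image_comp)
next
  case False
  have "(\<integral>\<^sup>+ k. epow (f k) (enn2real q) \<partial>count_space ((\<lambda>k. k + n) ` S))
     = (\<integral>\<^sup>+ k. epow (f (k + n)) (enn2real q) \<partial>count_space S)"
    by (subst nn_integral_bij_count_space[of "\<lambda>k. k + n" S, symmetric]) (auto simp: bij_betw_def inj_on_def)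
  then show ?thesis using False assms by (simp add: lq_finite)
qed

lemma lq_reflect:
  assumes "0 < q" shows "lq q S (\<lambda>k. f (- k)) = lq q (uminus ` S) f"
proof (cases "q = top")
  case True
  then show ?thesis by (simp add: lq_def image_comp)
next
  case False
  have "(\<integral>\<^sup>+ k. epow (f k) (enn2real q) \<partial>count_space (uminus ` S))
     = (\<integral>\<^sup>+ k. epow (f (- k)) (enn2real q) \<partial>count_space S)"
    by (subst nn_integral_bij_count_space[of uminus S, symmetric]) (auto simp: bij_betw_def)
  then show ?thesis using False assms by (simp add: lq_finite)
qed

text \<open>A discrete Young inequality for a geometric kernel, with the convolution sum weakened to
  a supremum. The p-th power of a supremum is at most the sum of the p-th powers, so Tonelli
  finishes for p < 1 as well as for p \<ge> 1.\<close>

lemma lq_geometric: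
  assumes "0 < q" "0 < \<epsilon>"
  shows "\<exists>C<top. \<forall>g. lq q UNIV (\<lambda>n. SUP j. ennreal (exp (- \<epsilon> * \<bar>real_of_int (n - j)\<bar>)) * g j) \<le> C * lq q UNIV g"
proof (cases "q = top")
  case True
  have "lq q UNIV (\<lambda>n. SUP j. ennreal (exp (- \<epsilon> * \<bar>real_of_int (n - j)\<bar>)) * g j) \<le> 1 * lq q UNIV g" for g
  proof -
    have "ennreal (exp (- \<epsilon> * \<bar>real_of_int (n - j)\<bar>)) * g j \<le> 1 * g j" for n j
      using assms(2) by (intro mult_right_mono) auto
    then show ?thesis using True
      by (auto simp: lq_def intro!: SUP_least intro: order_trans SUP_upper)
         (meson SUP_upper UNIV_I order_trans)
  qed
  then show ?thesis by (intro exI[of _ 1]) auto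
next
  case False
  define p where "p = enn2real q"
  have p: "0 < p" using recip_finite[OF assms(1) False] by (simp add: p_def)
  \<comment> \<open>Raising the kernel to the power p multiplies its rate by p.\<close>
  define \<delta> where "\<delta> = \<epsilon> * p"
  have \<delta>: "0 < \<delta>" using p assms by (simp add: \<delta>_def)
  define c where "c = (\<integral>\<^sup>+ n. ennreal (exp (- \<delta> * \<bar>real_of_int n\<bar>)) \<partial>count_space UNIV)"
  have c: "c < top"
  proof -
    have s: "summable (\<lambda>n::nat. exp (- \<delta>) ^ n)" using \<delta> by (intro summable_geometric) auto
    have eq: "exp (- \<delta>) ^ n = exp (- \<delta> * real n)" for n
      by (simp add: exp_of_nat_mult[symmetric] mult.commute)
    have fin: "(\<integral>\<^sup>+ n. ennreal (exp (- \<delta> * real n)) \<partial>count_space (UNIV::nat set)) < top"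
      using s unfolding eq
      by (subst nn_integral_count_space_nat, subst suminf_ennreal2) auto
    \<comment> \<open>The integers are covered by two rays; 0 is counted twice, which an upper bound
      tolerates.\<close>
    have "c \<le> (\<integral>\<^sup>+ n. ennreal (exp (- \<delta> * \<bar>real_of_int n\<bar>)) * indicator (range int) n
        + ennreal (exp (- \<delta> * \<bar>real_of_int n\<bar>)) * indicator (range (\<lambda>n. - int n)) n \<partial>count_space UNIV)"
      unfolding c_def
    proof (intro nn_integral_mono)
      fix x :: int
      have "x \<in> range int \<or> x \<in> range (\<lambda>n. - int n)"
        by (metis int_cases2 rangeI)
      then show "ennreal (exp (- \<delta> * \<bar>real_of_int x\<bar>)) \<le> ennreal (exp (- \<delta> * \<bar>real_of_int x\<bar>)) * indicator (range int) x
        + ennreal (exp (- \<delta> * \<bar>real_of_int x\<bar>)) * indicator (range (\<lambda>n. - int n)) x"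
        by (auto simp: indicator_def simp flip: ennreal_plus)
    qed
    also have "\<dots> = (\<integral>\<^sup>+ n. ennreal (exp (- \<delta> * \<bar>real_of_int n\<bar>)) \<partial>count_space (range int))
        + (\<integral>\<^sup>+ n. ennreal (exp (- \<delta> * \<bar>real_of_int n\<bar>)) \<partial>count_space (range (\<lambda>n. - int n)))"
      by (subst nn_integral_add) (auto simp: nn_integral_count_space_indicator)
    also have "(\<integral>\<^sup>+ n. ennreal (exp (- \<delta> * \<bar>real_of_int n\<bar>)) \<partial>count_space (range int))
       = (\<integral>\<^sup>+ n. ennreal (exp (- \<delta> * real n)) \<partial>count_space UNIV)"
      by (subst nn_integral_bij_count_space[of int UNIV, symmetric]) (auto simp: bij_betw_def)
    also have "(\<integral>\<^sup>+ n. ennreal (exp (- \<delta> * \<bar>real_of_int n\<bar>)) \<partial>count_space (range (\<lambda>n. - int n)))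
       = (\<integral>\<^sup>+ n. ennreal (exp (- \<delta> * real n)) \<partial>count_space UNIV)"
      by (subst nn_integral_bij_count_space[of "\<lambda>n. - int n" UNIV, symmetric]) (auto simp: bij_betw_def inj_on_def)
    finally show ?thesis using fin by (simp add: le_less_trans)
  qed
  have "lq q UNIV (\<lambda>n. SUP j. ennreal (exp (- \<epsilon> * \<bar>real_of_int (n - j)\<bar>)) * g j) \<le> epow c (1 / p) * lq q UNIV g" for g
    unfolding p_def
  proof (rule lq_leI'[OF assms(1) False], fold p_def)
    let ?e = "\<lambda>n j. ennreal (exp (- \<epsilon> * \<bar>real_of_int (n - j)\<bar>))"
    let ?d = "\<lambda>n j. ennreal (exp (- \<delta> * \<bar>real_of_int (n - j)\<bar>))"
    have ed: "epow (?e n j * g j) p = ?d n j * epow (g j) p" for n j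
      using p by (simp add: epow_mult epow_ennreal powr_def \<delta>_def mult_ac)
    have 1: "epow (SUP j. ?e n j * g j) p \<le> (\<integral>\<^sup>+ j. ?d n j * epow (g j) p \<partial>count_space UNIV)" (is "_ \<le> ?R") for n
    proof -
      have "?e n j * g j \<le> epow ?R (1 / p)" for j
      proof -
        have "epow (?e n j * g j) p \<le> ?R"
          unfolding ed by (rule nn_integral_ge_point) auto
        then have "epow (epow (?e n j * g j) p) (1 / p) \<le> epow ?R (1 / p)"
          using p by (intro epow_mono) auto
        then show ?thesis using p by (simp add: epow_epow_inverse)
      qed
      then have "(SUP j. ?e n j * g j) \<le> epow ?R (1 / p)" by (intro SUP_least)
      then have "epow (SUP j. ?e n j * g j) p \<le> epow (epow ?R (1 / p)) p" using p by (intro epow_mono) auto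
      then show ?thesis using p by (simp add: epow_epow_inverse)
    qed
    have "(\<integral>\<^sup>+ n. epow (SUP j. ?e n j * g j) p \<partial>count_space UNIV)
        \<le> (\<integral>\<^sup>+ n. \<integral>\<^sup>+ j. ?d n j * epow (g j) p \<partial>count_space UNIV \<partial>count_space UNIV)"
      by (intro nn_integral_mono 1)
    also have "\<dots> = (\<integral>\<^sup>+ j. \<integral>\<^sup>+ n. ?d n j * epow (g j) p \<partial>count_space UNIV \<partial>count_space UNIV)"
      by (intro nn_integral_count_space_nn_integral) auto
    also have "\<dots> = (\<integral>\<^sup>+ j. c * epow (g j) p \<partial>count_space UNIV)"
    proof (intro nn_integral_cong)
      fix j :: int
      have "(\<integral>\<^sup>+ n. ?d n j \<partial>count_space UNIV) = c"
        unfolding c_def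
        by (subst nn_integral_bij_count_space[of "\<lambda>n. n - j" UNIV UNIV, symmetric])
           (auto simp: bij_betw_def inj_on_def intro!: image_eqI[of _ _ "_ + j"])
      then show "(\<integral>\<^sup>+ n. ?d n j * epow (g j) p \<partial>count_space UNIV) = c * epow (g j) p"
        by (simp add: nn_integral_multc)
    qed
    also have "\<dots> = c * epow (lq q UNIV g) p"
      unfolding p_def epow_lq[OF False assms(1)] by (simp add: nn_integral_cmult)
    finally show "(\<integral>\<^sup>+ n. epow (SUP j. ?e n j * g j) p \<partial>count_space UNIV) \<le> c * epow (lq q UNIV g) p" .
  qed
  moreover have "epow c (1 / p) < top" using c by (rule epow_less_top)
  ultimately show ?thesis by blast
qed

section \<open>Discretisation of weighted norms\<close>

text \<open>The factor u^(-1/q) turns Lebesgue measure into du/u, for which the cells of a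
  logarithmic grid have mass bounded above and below.\<close>

lemma epow_weight:
  assumes "0 < u" "0 < p" "recip q = 1 / p"
  shows "epow (ennreal (u powr (- recip q)) * x) p = ennreal (1 / u) * epow x p"
proof -
  have "(u powr (- recip q)) powr p = 1 / u"
    using assms by (simp only: powr_powr) (simp add: powr_minus divide_inverse)
  then show ?thesis using assms(2) by (simp add: epow_mult epow_ennreal del: powr_powr)
qed

lemma measurable_indicator_lebesgue_on:
  assumes "A \<in> sets lebesgue"
  shows "(\<lambda>u. indicator A u :: ennreal) \<in> borel_measurable (lebesgue_on T)"
    and "(\<lambda>u. c * indicator A u :: ennreal) \<in> borel_measurable (lebesgue_on T)"
proof -
  show "(\<lambda>u. indicator A u :: ennreal) \<in> borel_measurable (lebesgue_on T)"
    by (rule measurable_restrict_space1) (rule borel_measurable_indicator[OF assms])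
  show "(\<lambda>u. c * indicator A u :: ennreal) \<in> borel_measurable (lebesgue_on T)"
    by (rule measurable_restrict_space1)
      (intro borel_measurable_times_ennreal borel_measurable_const borel_measurable_indicator assms)
qed

text \<open>The points \<open>exp (z k)\<close> are the sampling points.\<close>

locale grid =
  fixes z :: "int \<Rightarrow> real" and l1 l2 :: real
  assumes l1: "0 < l1" and step_ge: "l1 \<le> z (k + 1) - z k" and step_le: "z (k + 1) - z k \<le> l2"
begin

lemma z_strict_mono: "j < k \<Longrightarrow> z j < z k"
proof (induction k rule: int_gr_induct)
  case base
  then show ?case using l1 step_ge[of j] by simp
next
  case (step i)
  then show ?case using l1 step_ge[of i] by simp
qed

lemma z_less_iff: "z j < z k \<longleftrightarrow> j < k"
  by (metis linorder_neqE not_less_iff_gr_or_eq z_strict_mono)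

lemma z_le_iff: "z j \<le> z k \<longleftrightarrow> j \<le> k"
  by (simp add: linorder_not_less[symmetric] z_less_iff)

lemma z_lower: "j \<le> k \<Longrightarrow> z j + l1 * (k - j) \<le> z k"
proof (induction k rule: int_ge_induct)
  case (step i)
  then show ?case using step_ge[of i] by (simp add: algebra_simps)
qed simp

text \<open>Steps of length at least \<open>l1\<close> make the exponents unbounded in both
  directions. The cell starts at the last of finitely many candidate points not beyond ln u.\<close>

lemma grid_cover:
  assumes "0 < u"
  obtains k where "exp (z k) \<le> u" "u < exp (z (k + 1))"
proof -
  define v where "v = ln u"
  have ex: "\<exists>n::nat. y < l1 * n" for y
    using l1 by (metis mult.commute reals_Archimedean3)
  obtain n :: nat where "z 0 - v < l1 * n" using ex by blast
  then have low: "z (- int n) \<le> v" using z_lower[of "- int n" 0] by simp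
  obtain m :: nat where "v - z (- int n) < l1 * m" using ex by blast
  then have high: "v < z (- int n + int m)" using z_lower[of "- int n" "- int n + int m"] by simp
  define A where "A = {k::nat. z (- int n + int k) \<le> v}"
  have "k < m" if "k \<in> A" for k
    using that high z_less_iff[of "- int n + int k" "- int n + int m"] by (auto simp: A_def)
  then have fin: "finite A" by (meson bounded_nat_set_is_finite)
  have "0 \<in> A" using low by (simp add: A_def)
  then have "Max A \<in> A" using fin by (intro Max_in) auto
  moreover have "Suc (Max A) \<notin> A" using fin Max_ge by (metis Suc_n_not_le_n)
  ultimately have "z (- int n + int (Max A)) \<le> v" "v < z (- int n + int (Max A) + 1)"
    by (auto simp: A_def algebra_simps)
  then show ?thesis
    using that[of "- int n + int (Max A)"] assms
    by (metis exp_le_cancel_iff exp_less_cancel_iff exp_ln v_def)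
qed

lemma grid_inj:
  assumes "exp (z j) < u" "u < exp (z (j + 1))" "exp (z k) < u" "u < exp (z (k + 1))"
  shows "j = k"
proof -
  have "z j < z (k + 1)" "z k < z (j + 1)"
    using assms by (metis exp_less_cancel_iff order_less_trans)+
  then show ?thesis by (simp add: z_less_iff)
qed

text \<open>The constant is an argument, so that it is chosen before S, T, g and G. The function g
  is arbitrary: only its bounds on the cells enter, which lets non-measurable weights
  through.\<close>

definition Lq_upper :: "ennreal \<Rightarrow> ennreal \<Rightarrow> bool" where
  "Lq_upper q C \<longleftrightarrow> (\<forall>S T g G. T \<in> sets lebesgue \<longrightarrow> T \<subseteq> (\<Union>k\<in>S. {exp (z k)..<exp (z (k + 1))}) \<longrightarrow>
     (\<forall>k\<in>S. \<forall>u\<in>T. exp (z k) \<le> u \<longrightarrow> u < exp (z (k + 1)) \<longrightarrow> g u \<le> G k) \<longrightarrow>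
     Lq_norm q T (\<lambda>u. ennreal (u powr (- recip q)) * g u) \<le> C * lq q S G)"

text \<open>Open cells are used because T will be an open interval whose left end may be a grid
  point.\<close>

definition Lq_lower :: "ennreal \<Rightarrow> ennreal \<Rightarrow> bool" where
  "Lq_lower q C \<longleftrightarrow> (\<forall>S T g G. T \<in> sets lebesgue \<longrightarrow> (\<Union>k\<in>S. {exp (z k)<..<exp (z (k + 1))}) \<subseteq> T \<longrightarrow>
     (\<forall>k\<in>S. \<forall>u. exp (z k) < u \<longrightarrow> u < exp (z (k + 1)) \<longrightarrow> G k \<le> g u) \<longrightarrow>
     lq q S G \<le> C * Lq_norm q T (\<lambda>u. ennreal (u powr (- recip q)) * g u))"

lemma Lq_upperD:
  assumes "Lq_upper q C" "T \<in> sets lebesgue" "T \<subseteq> (\<Union>k\<in>S. {exp (z k)..<exp (z (k + 1))})"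
    and "\<And>k u. k \<in> S \<Longrightarrow> u \<in> T \<Longrightarrow> exp (z k) \<le> u \<Longrightarrow> u < exp (z (k + 1)) \<Longrightarrow> g u \<le> G k"
  shows "Lq_norm q T (\<lambda>u. ennreal (u powr (- recip q)) * g u) \<le> C * lq q S G"
  by (rule assms(1)[unfolded Lq_upper_def, rule_format]) (use assms in auto)

lemma Lq_lowerD:
  assumes "Lq_lower q C" "T \<in> sets lebesgue" "(\<Union>k\<in>S. {exp (z k)<..<exp (z (k + 1))}) \<subseteq> T"
    and "\<And>k u. k \<in> S \<Longrightarrow> exp (z k) < u \<Longrightarrow> u < exp (z (k + 1)) \<Longrightarrow> G k \<le> g u"
  shows "lq q S G \<le> C * Lq_norm q T (\<lambda>u. ennreal (u powr (- recip q)) * g u)"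
  by (rule assms(1)[unfolded Lq_lower_def, rule_format]) (use assms in auto)

text \<open>On cell k the density 1/u is at most exp(- z k) and the length of the cell is below
  exp(z (k + 1)), so the cell contributes at most exp l2 times the power of its bound.\<close>

lemma Lq_norm_le_lq:
  assumes q: "0 < q"
  shows "\<exists>C<top. Lq_upper q C"
proof (cases "q = top")
  case True
  have "Lq_norm q T (\<lambda>u. ennreal (u powr (- recip q)) * g u) \<le> 1 * lq q S G"
    if T: "T \<in> sets lebesgue" "T \<subseteq> (\<Union>k\<in>S. {exp (z k)..<exp (z (k + 1))})"
    and g: "\<forall>k\<in>S. \<forall>u\<in>T. exp (z k) \<le> u \<longrightarrow> u < exp (z (k + 1)) \<longrightarrow> g u \<le> G k" for S T g G
  proof -
    have "ennreal (u powr (- recip q)) * g u \<le> (SUP k\<in>S. G k)" if u: "u \<in> T" for u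
    proof -
      obtain k where k: "k \<in> S" "exp (z k) \<le> u" "u < exp (z (k + 1))" using T u by auto
      have "u > 0" using k(2) by (meson exp_gt_zero less_le_trans)
      moreover have "g u \<le> G k" using g k u by auto
      ultimately show ?thesis using True k(1) by (auto simp: recip_def intro: order_trans SUP_upper)
    qed
    then show ?thesis using True by (auto simp: Lq_norm_def lq_def intro!: Inf_lower AE_I2)
  qed
  then show ?thesis unfolding Lq_upper_def by (intro exI[of _ 1]) auto
next
  case False
  define p where "p = enn2real q"
  have p: "0 < p" "recip q = 1 / p" using recip_finite[OF q False] by (simp_all add: p_def)
  have "Lq_norm q T (\<lambda>u. ennreal (u powr (- recip q)) * g u) \<le> epow (ennreal (exp l2)) (1 / p) * lq q S G"
    if T: "T \<in> sets lebesgue" "T \<subseteq> (\<Union>k\<in>S. {exp (z k)..<exp (z (k + 1))})"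
    and g: "\<forall>k\<in>S. \<forall>u\<in>T. exp (z k) \<le> u \<longrightarrow> u < exp (z (k + 1)) \<longrightarrow> g u \<le> G k" for S T g G
  proof -
    let ?J = "\<lambda>k. {exp (z k)..<exp (z (k + 1))}"
    \<comment> \<open>Here g is replaced by its cell bounds, by monotonicity alone; afterwards only
      multiples of cell indicators are integrated.\<close>
    have "(\<integral>\<^sup>+ u. epow (ennreal (u powr (- recip q)) * g u) p \<partial>lebesgue_on T)
      \<le> (\<integral>\<^sup>+ u. \<integral>\<^sup>+ k. epow (G k) p * ennreal (exp (- z k)) * indicator (?J k) u \<partial>count_space S \<partial>lebesgue_on T)"
    proof (intro nn_integral_mono)
      fix u assume "u \<in> space (lebesgue_on T)"
      then have u: "u \<in> T" by simp
      obtain k where k: "k \<in> S" "exp (z k) \<le> u" "u < exp (z (k + 1))" using T u by auto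
      have u0: "u > 0" using k(2) by (meson exp_gt_zero less_le_trans)
      have "epow (ennreal (u powr (- recip q)) * g u) p = ennreal (1 / u) * epow (g u) p"
        using p u0 by (rule epow_weight[rotated])
      also have "\<dots> \<le> ennreal (exp (- z k)) * epow (G k) p"
        using g k u p u0 by (intro mult_mono epow_mono ennreal_leI) (auto simp: exp_minus divide_simps)
      also have "\<dots> = epow (G k) p * ennreal (exp (- z k)) * indicator (?J k) u"
        using k by (simp add: mult.commute)
      also have "\<dots> \<le> (\<integral>\<^sup>+ k. epow (G k) p * ennreal (exp (- z k)) * indicator (?J k) u \<partial>count_space S)"
        by (rule nn_integral_ge_point[OF k(1)])
      finally show "epow (ennreal (u powr (- recip q)) * g u) p \<le> \<dots>" .
    qed
    also have "\<dots> = (\<integral>\<^sup>+ k. \<integral>\<^sup>+ u. epow (G k) p * ennreal (exp (- z k)) * indicator (?J k) u \<partial>lebesgue_on T \<partial>count_space S)"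
      by (rule nn_integral_count_space_nn_integral) (simp_all add: measurable_indicator_lebesgue_on)
    also have "\<dots> \<le> (\<integral>\<^sup>+ k. ennreal (exp l2) * epow (G k) p \<partial>count_space S)"
    proof (intro nn_integral_mono)
      fix k :: int
      have "(\<integral>\<^sup>+ u. indicator (?J k) u \<partial>lebesgue_on T) \<le> (\<integral>\<^sup>+ u. indicator (?J k) u \<partial>lebesgue)"
      proof (subst nn_integral_restrict_space)
        show "(\<integral>\<^sup>+ u. indicator (?J k) u * indicator T u \<partial>lebesgue) \<le> (\<integral>\<^sup>+ u. indicator (?J k) u \<partial>lebesgue)"
          by (intro nn_integral_mono) (simp add: indicator_def)
      qed (use T(1) in simp)
      also have "\<dots> = ennreal (exp (z (k + 1)) - exp (z k))"
        using z_strict_mono[of k "k + 1"] by (subst nn_integral_indicator) auto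
      finally have 1: "(\<integral>\<^sup>+ u. indicator (?J k) u \<partial>lebesgue_on T) \<le> ennreal (exp (z (k + 1)) - exp (z k))" .
      have "exp (- z k) * (exp (z (k + 1)) - exp (z k)) \<le> exp (z (k + 1) - z k)"
        by (simp add: algebra_simps exp_diff exp_minus divide_simps)
      also have "\<dots> \<le> exp l2" using step_le[of k] by simp
      finally have 2: "exp (- z k) * (exp (z (k + 1)) - exp (z k)) \<le> exp l2" .
      have "(\<integral>\<^sup>+ u. epow (G k) p * ennreal (exp (- z k)) * indicator (?J k) u \<partial>lebesgue_on T)
        = epow (G k) p * ennreal (exp (- z k)) * (\<integral>\<^sup>+ u. indicator (?J k) u \<partial>lebesgue_on T)"
        by (rule nn_integral_cmult) (simp_all add: measurable_indicator_lebesgue_on)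
      also have "\<dots> \<le> epow (G k) p * (ennreal (exp (- z k)) * ennreal (exp (z (k + 1)) - exp (z k)))"
        unfolding mult.assoc by (intro mult_left_mono 1) auto
      also have "\<dots> \<le> epow (G k) p * ennreal (exp l2)"
        using 2 z_strict_mono[of k "k + 1"] by (intro mult_left_mono) (simp_all flip: ennreal_mult add: ennreal_leI)
      finally show "(\<integral>\<^sup>+ u. epow (G k) p * ennreal (exp (- z k)) * indicator (?J k) u \<partial>lebesgue_on T) \<le> ennreal (exp l2) * epow (G k) p"
        by (simp only: mult.commute)
    qed
    also have "\<dots> = ennreal (exp l2) * epow (lq q S G) p"
      unfolding p_def epow_lq[OF False q] by (simp add: nn_integral_cmult)
    finally have "epow (\<integral>\<^sup>+ u. epow (ennreal (u powr (- recip q)) * g u) p \<partial>lebesgue_on T) (1 / p)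
       \<le> epow (ennreal (exp l2) * epow (lq q S G) p) (1 / p)"
      using p by (intro epow_mono) auto
    also have "\<dots> = epow (ennreal (exp l2)) (1 / p) * lq q S G"
      using p by (simp add: epow_mult epow_epow_inverse)
    finally show ?thesis using False p by (simp add: Lq_norm_def p_def)
  qed
  moreover have "epow (ennreal (exp l2)) (1 / p) < top" by (rule epow_less_top) simp
  ultimately show ?thesis unfolding Lq_upper_def by blast
qed

text \<open>On cell k the density 1/u is at least exp(- z (k + 1)); times the length this is 1 -
  exp(-(z (k + 1) - z k)), hence at least 1 - exp(- l1). For q = \<infinity> an essential bound
  cannot miss a cell of positive measure.\<close>

lemma lq_le_Lq_norm:
  assumes q: "0 < q"
  shows "\<exists>C<top. Lq_lower q C"
proof (cases "q = top")
  case True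
  have "lq q S G \<le> 1 * Lq_norm q T (\<lambda>u. ennreal (u powr (- recip q)) * g u)"
    if T: "T \<in> sets lebesgue" "(\<Union>k\<in>S. {exp (z k)<..<exp (z (k + 1))}) \<subseteq> T"
    and g: "\<forall>k\<in>S. \<forall>u. exp (z k) < u \<longrightarrow> u < exp (z (k + 1)) \<longrightarrow> G k \<le> g u" for S T g G
  proof -
    have "G k \<le> y" if k: "k \<in> S" and y: "AE u in lebesgue_on T. ennreal (u powr (- recip q)) * g u \<le> y" for k y
    proof (rule ccontr)
      let ?J = "{exp (z k)<..<exp (z (k + 1))}"
      assume n: "\<not> G k \<le> y"
      have "AE u in lebesgue. u \<in> T \<longrightarrow> ennreal (u powr (- recip q)) * g u \<le> y"
        using y T(1) by (simp add: AE_restrict_space_iff)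
      moreover have "\<not> (u \<in> T \<longrightarrow> ennreal (u powr (- recip q)) * g u \<le> y)" if "u \<in> ?J" for u
      proof -
        have "0 < u" using that by (auto intro: less_trans[of 0 "exp (z k)"])
        then show ?thesis using that True g k n T(2) by (fastforce simp: recip_def)
      qed
      ultimately have "AE u in lebesgue. u \<notin> ?J" by (auto elim!: eventually_mono)
      then have "emeasure lebesgue ?J = 0"
        by (subst (asm) AE_iff_measurable[where N = ?J]) auto
      then show False using z_strict_mono[of k "k + 1"] by simp
    qed
    then show ?thesis using True by (auto simp: Lq_norm_def lq_def intro!: Inf_greatest SUP_least)
  qed
  then show ?thesis unfolding Lq_lower_def by (intro exI[of _ 1]) auto
next
  case False
  define p where "p = enn2real q"
  have p: "0 < p" "recip q = 1 / p" using recip_finite[OF q False] by (simp_all add: p_def)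
  define c where "c = 1 - exp (- l1)"
  have c: "0 < c" using l1 by (simp add: c_def)
  have main: "lq q S G \<le> epow (ennreal (1 / c)) (1 / p) * Lq_norm q T (\<lambda>u. ennreal (u powr (- recip q)) * g u)"
    if T: "T \<in> sets lebesgue" "(\<Union>k\<in>S. {exp (z k)<..<exp (z (k + 1))}) \<subseteq> T"
    and g: "\<forall>k\<in>S. \<forall>u. exp (z k) < u \<longrightarrow> u < exp (z (k + 1)) \<longrightarrow> G k \<le> g u" for S T g G
    unfolding p_def
  proof (rule lq_leI'[OF q False], fold p_def)
    let ?J = "\<lambda>k. {exp (z k)<..<exp (z (k + 1))}"
    have "(\<integral>\<^sup>+ k. ennreal c * epow (G k) p \<partial>count_space S)
       \<le> (\<integral>\<^sup>+ k. \<integral>\<^sup>+ u. epow (G k) p * ennreal (exp (- z (k + 1))) * indicator (?J k) u \<partial>lebesgue_on T \<partial>count_space S)"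
    proof (intro nn_integral_mono)
      fix k :: int assume "k \<in> space (count_space S)"
      then have k: "k \<in> S" by simp
      have "(\<integral>\<^sup>+ u. indicator (?J k) u \<partial>lebesgue_on T) = (\<integral>\<^sup>+ u. indicator (?J k) u \<partial>lebesgue)"
      proof (subst nn_integral_restrict_space)
        have "indicator (?J k) u * indicator T u = (indicator (?J k) u :: ennreal)" for u
          using order_trans[OF UN_upper[OF k, of ?J] T(2)] by (cases "u \<in> ?J k") (auto simp del: greaterThanLessThan_iff)
        then show "(\<integral>\<^sup>+ u. indicator (?J k) u * indicator T u \<partial>lebesgue) = (\<integral>\<^sup>+ u. indicator (?J k) u \<partial>lebesgue)"
          by (simp only:)
      qed (use T(1) in simp)
      also have "\<dots> = ennreal (exp (z (k + 1)) - exp (z k))"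
        using z_strict_mono[of k "k + 1"] by (subst nn_integral_indicator) auto
      finally have 1: "(\<integral>\<^sup>+ u. indicator (?J k) u \<partial>lebesgue_on T) = ennreal (exp (z (k + 1)) - exp (z k))" .
      have "exp (- (z (k + 1) - z k)) \<le> exp (- l1)" using step_ge[of k] by simp
      then have "c \<le> exp (- z (k + 1)) * (exp (z (k + 1)) - exp (z k))"
        by (simp add: c_def algebra_simps exp_diff exp_minus divide_inverse)
      then have "ennreal c * epow (G k) p \<le> ennreal (exp (- z (k + 1)) * (exp (z (k + 1)) - exp (z k))) * epow (G k) p"
        by (intro mult_right_mono ennreal_leI) auto
      also have "\<dots> = epow (G k) p * ennreal (exp (- z (k + 1))) * (\<integral>\<^sup>+ u. indicator (?J k) u \<partial>lebesgue_on T)"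
        using z_strict_mono[of k "k + 1"] unfolding 1 by (subst ennreal_mult) (auto simp: mult_ac)
      also have "\<dots> = (\<integral>\<^sup>+ u. epow (G k) p * ennreal (exp (- z (k + 1))) * indicator (?J k) u \<partial>lebesgue_on T)"
        by (rule nn_integral_cmult[symmetric]) (simp_all add: measurable_indicator_lebesgue_on)
      finally show "ennreal c * epow (G k) p \<le> \<dots>" .
    qed
    also have "\<dots> = (\<integral>\<^sup>+ u. \<integral>\<^sup>+ k. epow (G k) p * ennreal (exp (- z (k + 1))) * indicator (?J k) u \<partial>count_space S \<partial>lebesgue_on T)"
      by (rule nn_integral_count_space_nn_integral[symmetric]) (simp_all add: measurable_indicator_lebesgue_on)
    also have "\<dots> \<le> (\<integral>\<^sup>+ u. epow (ennreal (u powr (- recip q)) * g u) p \<partial>lebesgue_on T)"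
    proof (intro nn_integral_mono)
      fix u
      show "(\<integral>\<^sup>+ k. epow (G k) p * ennreal (exp (- z (k + 1))) * indicator (?J k) u \<partial>count_space S)
        \<le> epow (ennreal (u powr (- recip q)) * g u) p"
      \<comment> \<open>The open cells are disjoint, so at most one summand is nonzero at u.\<close>
      proof (cases "\<exists>k\<in>S. u \<in> ?J k")
        case True
        then obtain k where k: "k \<in> S" "u \<in> ?J k" by blast
        have eq: "(\<integral>\<^sup>+ k. epow (G k) p * ennreal (exp (- z (k + 1))) * indicator (?J k) u \<partial>count_space S)
          = (\<integral>\<^sup>+ j. epow (G k) p * ennreal (exp (- z (k + 1))) * indicator {k} j \<partial>count_space S)"
          using k grid_inj by (intro nn_integral_cong) (fastforce simp: indicator_def)
        also have "\<dots> = epow (G k) p * ennreal (exp (- z (k + 1)))"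
          proof -
          have "(\<integral>\<^sup>+ j. indicator {k} j \<partial>count_space S) = (1 :: ennreal)"
            using k(1) by (subst nn_integral_indicator) auto
          then show ?thesis by (simp only: nn_integral_cmult[OF borel_measurable_count_space] mult_1_right)
        qed
        also have "\<dots> \<le> ennreal (1 / u) * epow (g u) p"
        proof -
          have "0 < u" using k by (auto intro: less_trans[of 0 "exp (z k)"])
          then have "exp (- z (k + 1)) \<le> 1 / u" using k by (auto simp: exp_minus divide_simps)
          then show ?thesis using g k p
            by (subst mult.commute, intro mult_mono epow_mono ennreal_leI) auto
        qed
        also have "\<dots> = epow (ennreal (u powr (- recip q)) * g u) p"
        proof -
          have u0: "0 < u" using k by (auto intro: less_trans[of 0 "exp (z k)"])
          from epow_weight[OF this p] show ?thesis by (rule sym)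
        qed
        finally show ?thesis .
      next
        case False
        then have "(\<integral>\<^sup>+ k. epow (G k) p * ennreal (exp (- z (k + 1))) * indicator (?J k) u \<partial>count_space S) = 0"
          by (auto simp: nn_integral_0_iff_AE AE_count_space)
        then show ?thesis by simp
      qed
    qed
    also have "\<dots> = epow (Lq_norm q T (\<lambda>u. ennreal (u powr (- recip q)) * g u)) p"
    proof -
      have "Lq_norm q T f = epow (\<integral>\<^sup>+ u. epow (f u) p \<partial>lebesgue_on T) (1 / p)" for f
        unfolding Lq_norm_def p_def using False p(2) by (simp add: p_def)
      then show ?thesis using epow_epow_inverse(2)[OF p(1)] by (simp only:)
    qed
    finally have *: "ennreal c * (\<integral>\<^sup>+ k. epow (G k) p \<partial>count_space S)
        \<le> epow (Lq_norm q T (\<lambda>u. ennreal (u powr (- recip q)) * g u)) p"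
      by (simp only: nn_integral_cmult[OF borel_measurable_count_space])
    have "(\<integral>\<^sup>+ k. epow (G k) p \<partial>count_space S) = ennreal (1 / c) * (ennreal c * (\<integral>\<^sup>+ k. epow (G k) p \<partial>count_space S))"
    proof -
      have "ennreal (1 / c) * ennreal c = 1" using c by (subst ennreal_mult[symmetric]) auto
      then show ?thesis by (simp only: mult.assoc[symmetric] mult_1_left)
    qed
    also have "\<dots> \<le> ennreal (1 / c) * epow (Lq_norm q T (\<lambda>u. ennreal (u powr (- recip q)) * g u)) p"
      by (intro mult_left_mono *) auto
    finally show "(\<integral>\<^sup>+ k. epow (G k) p \<partial>count_space S) \<le> \<dots>" .
  qed
  show ?thesis
    unfolding Lq_lower_def
    by (intro exI[of _ "epow (ennreal (1 / c)) (1 / p)"] conjI allI impI main) (simp_all add: epow_less_top)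
qed

end

section \<open>Slowly varying sequences\<close>

text \<open>Slow variation along a geometric grid: w n is at most a constant times exp(\<epsilon> |n
  - m|) w m. Taking logarithms makes the closure properties additive.\<close>

definition sv_seq :: "(int \<Rightarrow> real) \<Rightarrow> bool" where
  "sv_seq w \<longleftrightarrow> (\<forall>k. 0 < w k) \<and>
     (\<forall>\<epsilon>>0. \<exists>C. \<forall>n m. ln (w n) \<le> ln (w m) + \<epsilon> * \<bar>real_of_int (n - m)\<bar> + C)"

text \<open>Not monotonicity, but growth at a fixed exponential rate up to a constant factor: the
  property that makes a sum over all j \<le> n comparable to its last term.\<close>

definition inc_seq :: "(int \<Rightarrow> real) \<Rightarrow> bool" where
  "inc_seq v \<longleftrightarrow> (\<forall>k. 0 < v k) \<and>
     (\<exists>\<epsilon>>0. \<exists>C. \<forall>j n. j \<le> n \<longrightarrow> ln (v j) \<le> ln (v n) - \<epsilon> * real_of_int (n - j) + C)"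

definition dec_seq :: "(int \<Rightarrow> real) \<Rightarrow> bool" where
  "dec_seq v \<longleftrightarrow> inc_seq (\<lambda>k. v (- k))"

lemma sv_seq_pos: "sv_seq w \<Longrightarrow> 0 < w k"
  by (simp add: sv_seq_def)

lemma sv_seqE:
  assumes "sv_seq w" "0 < \<epsilon>"
  obtains C where "\<And>n m. ln (w n) \<le> ln (w m) + \<epsilon> * \<bar>real_of_int (n - m)\<bar> + C"
  using assms unfolding sv_seq_def by blast

lemma sv_seq_reflect:
  assumes "sv_seq w" shows "sv_seq (\<lambda>k. w (- k))"
  unfolding sv_seq_def
proof (intro conjI allI impI sv_seq_pos[OF assms])
  fix \<epsilon> :: real assume "0 < \<epsilon>"
  then obtain C where C: "\<And>n m. ln (w n) \<le> ln (w m) + \<epsilon> * \<bar>real_of_int (n - m)\<bar> + C"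
    using sv_seqE[OF assms] by blast
  have "ln (w (- n)) \<le> ln (w (- m)) + \<epsilon> * \<bar>real_of_int (n - m)\<bar> + C" for n m
    using C[of "- n" "- m"] by (simp add: abs_minus_commute)
  then show "\<exists>C. \<forall>n m. ln (w (- n)) \<le> ln (w (- m)) + \<epsilon> * \<bar>real_of_int (n - m)\<bar> + C" by blast
qed

lemma sv_seq_mult:
  assumes "sv_seq v" "sv_seq w" shows "sv_seq (\<lambda>k. v k * w k)"
  unfolding sv_seq_def
proof (intro conjI allI impI)
  show "0 < v k * w k" for k using assms by (simp add: sv_seq_pos)
  fix \<epsilon> :: real assume e: "0 < \<epsilon>"
  obtain C where C: "\<And>n m. ln (v n) \<le> ln (v m) + \<epsilon> / 2 * \<bar>real_of_int (n - m)\<bar> + C"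
    using sv_seqE[OF assms(1), of "\<epsilon> / 2"] e by auto
  obtain D where D: "\<And>n m. ln (w n) \<le> ln (w m) + \<epsilon> / 2 * \<bar>real_of_int (n - m)\<bar> + D"
    using sv_seqE[OF assms(2), of "\<epsilon> / 2"] e by auto
  have "ln (v n * w n) \<le> ln (v m * w m) + \<epsilon> * \<bar>real_of_int (n - m)\<bar> + (C + D)" for n m
  proof -
    have "ln (v k * w k) = ln (v k) + ln (w k)" for k
      using assms[THEN sv_seq_pos, of k] by (simp add: ln_mult)
    then show ?thesis using C[of n m] D[of n m] by (simp add: field_simps)
  qed
  then show "\<exists>C. \<forall>n m. ln (v n * w n) \<le> ln (v m * w m) + \<epsilon> * \<bar>real_of_int (n - m)\<bar> + C" by blast
qed

lemma sv_seq_powr: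
  assumes "sv_seq w" shows "sv_seq (\<lambda>k. w k powr s)"
  unfolding sv_seq_def
proof (intro conjI allI impI)
  show "0 < w k powr s" for k using sv_seq_pos[OF assms, of k] by simp
  fix \<epsilon> :: real assume e: "0 < \<epsilon>"
  \<comment> \<open>A rate for w so small that |s| times it stays below \<epsilon>; the added 1
    covers s = 0.\<close>
  define d where "d = \<epsilon> / (\<bar>s\<bar> + 1)"
  have d: "0 < d" "\<bar>s\<bar> * d \<le> \<epsilon>" using e by (auto simp: d_def field_simps)
  obtain C where C: "\<And>n m. ln (w n) \<le> ln (w m) + d * \<bar>real_of_int (n - m)\<bar> + C"
    using sv_seqE[OF assms d(1)] by blast
  have "ln (w n powr s) \<le> ln (w m powr s) + \<epsilon> * \<bar>real_of_int (n - m)\<bar> + \<bar>s\<bar> * C" for n m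
  proof -
    let ?x = "\<bar>real_of_int (n - m)\<bar>"
    have "\<bar>ln (w n) - ln (w m)\<bar> \<le> d * ?x + C"
      using C[of n m] C[of m n] by (simp add: abs_minus_commute)
    then have "\<bar>s\<bar> * \<bar>ln (w n) - ln (w m)\<bar> \<le> \<bar>s\<bar> * (d * ?x + C)"
      by (intro mult_left_mono) auto
    then have "s * (ln (w n) - ln (w m)) \<le> \<bar>s\<bar> * (d * ?x + C)"
      using abs_ge_self[of "s * (ln (w n) - ln (w m))"] by (simp add: abs_mult)
    also have "\<bar>s\<bar> * d * ?x \<le> \<epsilon> * ?x" using d by (intro mult_right_mono) auto
    then have "\<bar>s\<bar> * (d * ?x + C) \<le> \<epsilon> * ?x + \<bar>s\<bar> * C" by (simp add: algebra_simps)
    finally show ?thesis using sv_seq_pos[OF assms] by (simp add: ln_powr algebra_simps)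
  qed
  then show "\<exists>C. \<forall>n m. ln (w n powr s) \<le> ln (w m powr s) + \<epsilon> * \<bar>real_of_int (n - m)\<bar> + C" by blast
qed

lemma sv_seq_divide:
  assumes "sv_seq v" "sv_seq w" shows "sv_seq (\<lambda>k. v k / w k)"
proof -
  have "(\<lambda>k. v k / w k) = (\<lambda>k. v k * w k powr (-1))"
    using sv_seq_pos[OF assms(2)] by (intro ext) (simp add: powr_minus divide_inverse less_imp_le)
  then show ?thesis using sv_seq_mult[OF assms(1) sv_seq_powr[OF assms(2), of "-1"]] by simp
qed

text \<open>The slowly varying factor can cancel at most half of the rate c up to a constant, so
  growth at rate c/2 survives.\<close>

lemma inc_seqI:
  assumes "sv_seq w" "0 < c" "\<And>j. v j = exp (c * real_of_int j) * w j"
  shows "inc_seq v"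
proof -
  obtain C where C: "\<And>n m. ln (w n) \<le> ln (w m) + c / 2 * \<bar>real_of_int (n - m)\<bar> + C"
    using sv_seqE[OF assms(1), of "c / 2"] assms(2) by auto
  have "ln (v j) \<le> ln (v n) - c / 2 * real_of_int (n - j) + C" if "j \<le> n" for j n
  proof -
    have "ln (v k) = c * real_of_int k + ln (w k)" for k
      using sv_seq_pos[OF assms(1), of k] by (simp add: assms(3) ln_mult)
    then show ?thesis using C[of j n] that by (simp add: field_simps)
  qed
  moreover have "0 < v k" for k using sv_seq_pos[OF assms(1), of k] by (simp add: assms(3))
  ultimately show ?thesis using assms(2) unfolding inc_seq_def by (metis half_gt_zero)
qed

lemma dec_seqI:
  assumes "sv_seq w" "c < 0" "\<And>j. v j = exp (c * real_of_int j) * w j"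
  shows "dec_seq v"
  unfolding dec_seq_def
  by (rule inc_seqI[OF sv_seq_reflect[OF assms(1)], of "- c"]) (use assms(2,3) in auto)

lemma le_exp_of_ln_le:
  fixes x y c :: real
  assumes "0 < x" "0 < y" "ln x \<le> ln y + c" shows "x \<le> exp c * y"
proof -
  have "exp (ln x) \<le> exp (ln y + c)" using assms(3) by (simp only: exp_le_cancel_iff)
  then show ?thesis using assms by (simp add: exp_add mult.commute)
qed

text \<open>The kernel is summed by feeding the unit mass at n into \<open>lq_geometric\<close>,
  whose constant does not depend on n.\<close>

lemma lq_exp_le:
  assumes "0 < q" "0 < \<epsilon>"
  shows "\<exists>C<top. \<forall>n. lq q UNIV (\<lambda>j. ennreal (exp (- \<epsilon> * \<bar>real_of_int (n - j)\<bar>))) \<le> C"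
proof -
  obtain C where C: "C < top" "\<And>g. lq q UNIV (\<lambda>n. SUP j. ennreal (exp (- \<epsilon> * \<bar>real_of_int (n - j)\<bar>)) * g j) \<le> C * lq q UNIV g"
    using lq_geometric[OF assms] by blast
  have "lq q UNIV (\<lambda>j. ennreal (exp (- \<epsilon> * \<bar>real_of_int (n - j)\<bar>))) \<le> C" for n
  proof -
    let ?g = "\<lambda>j. 1 * indicator {n} j :: ennreal"
    have "lq q UNIV (\<lambda>j. ennreal (exp (- \<epsilon> * \<bar>real_of_int (n - j)\<bar>)))
       \<le> lq q UNIV (\<lambda>i. SUP j. ennreal (exp (- \<epsilon> * \<bar>real_of_int (i - j)\<bar>)) * ?g j)"
      by (intro lq_mono assms) (auto intro!: SUP_upper2[of n] simp: abs_minus_commute)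
    also have "\<dots> \<le> C * lq q UNIV ?g" by (rule C)
    also have "lq q UNIV ?g = lq q {n} (\<lambda>_. 1)" using lq_indicator[OF assms(1), of "{n}" UNIV "\<lambda>_. 1"] by simp
    also have "\<dots> = 1"
      using assms(1) by (auto simp: lq_def nn_integral_count_space_finite epow_ennreal[of 1, simplified])
    finally show ?thesis by simp
  qed
  then show ?thesis using C(1) by blast
qed

lemma lq_inc_seq:
  assumes "inc_seq v" "0 < q"
  shows "\<exists>C<top. \<forall>n. lq q {..n} (\<lambda>j. ennreal (v j)) \<le> C * ennreal (v n)"
proof -
  obtain \<epsilon> D where \<epsilon>: "0 < \<epsilon>" and D: "\<And>j n. j \<le> n \<Longrightarrow> ln (v j) \<le> ln (v n) - \<epsilon> * real_of_int (n - j) + D"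
    and pos: "\<And>k. 0 < v k"
    using assms(1) unfolding inc_seq_def by blast
  obtain C where C: "C < top" "\<And>n. lq q UNIV (\<lambda>j. ennreal (exp (- \<epsilon> * \<bar>real_of_int (n - j)\<bar>))) \<le> C"
    using lq_exp_le[OF assms(2) \<epsilon>] by blast
  have "lq q {..n} (\<lambda>j. ennreal (v j)) \<le> ennreal (exp D) * C * ennreal (v n)" for n
  proof -
    have "lq q {..n} (\<lambda>j. ennreal (v j)) \<le> lq q UNIV (\<lambda>j. ennreal (exp D * v n) * ennreal (exp (- \<epsilon> * \<bar>real_of_int (n - j)\<bar>)))"
    proof (intro lq_mono assms(2))
      fix j assume "j \<in> {..n}"
      then have "v j \<le> exp (- \<epsilon> * \<bar>real_of_int (n - j)\<bar> + D) * v n"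
        using D[of j n] by (intro le_exp_of_ln_le pos) auto
      then show "ennreal (v j) \<le> ennreal (exp D * v n) * ennreal (exp (- \<epsilon> * \<bar>real_of_int (n - j)\<bar>))"
        using pos[of n] by (subst ennreal_mult[symmetric]) (auto intro!: ennreal_leI simp: exp_add exp_diff exp_minus divide_inverse mult_ac)
    qed simp
    also have "\<dots> \<le> ennreal (exp D * v n) * C" by (simp only: lq_cmult[OF assms(2)]) (intro mult_left_mono C; simp)
    finally show ?thesis using pos[of n] by (simp add: ennreal_mult mult_ac)
  qed
  moreover have "ennreal (exp D) * C < top" using C by (simp add: ennreal_mult_less_top)
  ultimately show ?thesis by blast
qed

lemma lq_dec_seq:
  assumes "dec_seq v" "0 < q"
  shows "\<exists>C<top. \<forall>n. lq q {n..} (\<lambda>j. ennreal (v j)) \<le> C * ennreal (v n)"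
proof -
  obtain C where C: "C < top" "\<forall>n. lq q {..n} (\<lambda>j. ennreal (v (- j))) \<le> C * ennreal (v (- n))"
    using lq_inc_seq[OF assms(1)[unfolded dec_seq_def] assms(2)] by blast
  have "lq q {n..} (\<lambda>j. ennreal (v j)) \<le> C * ennreal (v n)" for n
    using C(2)[rule_format, of "- n"] lq_reflect[OF assms(2), of "{..- n}" "\<lambda>j. ennreal (v j)"] by simp
  then show ?thesis using C(1) by blast
qed

text \<open>The counterpart of \<open>sv_seq\<close> for sequences that may take the values 0 and
  \<infinity>; partial norms are handled in this form before they are known to be finite.\<close>

definition slow :: "(int \<Rightarrow> ennreal) \<Rightarrow> bool" where
  "slow F \<longleftrightarrow> (\<forall>\<epsilon>>0. \<exists>C<top. \<forall>n m. F n \<le> C * ennreal (exp (\<epsilon> * \<bar>real_of_int (n - m)\<bar>)) * F m)"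

definition dominated :: "('p \<Rightarrow> ennreal) \<Rightarrow> ('p \<Rightarrow> ennreal) \<Rightarrow> bool" (infix \<open>\<lessapprox>\<close> 50) where
  "F \<lessapprox> G \<longleftrightarrow> (\<exists>C<top. \<forall>x. F x \<le> C * G x)"

lemma slowE:
  assumes "slow F" "0 < \<epsilon>"
  obtains C where "C < top" "\<And>n m. F n \<le> C * ennreal (exp (\<epsilon> * \<bar>real_of_int (n - m)\<bar>)) * F m"
  using assms unfolding slow_def by blast

lemma dominatedE:
  assumes "F \<lessapprox> G" obtains C where "C < top" "\<And>x. F x \<le> C * G x"
  using assms unfolding dominated_def by blast

lemma dominatedI: "C < top \<Longrightarrow> (\<And>x. F x \<le> C * G x) \<Longrightarrow> F \<lessapprox> G"
  unfolding dominated_def by blast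

lemma slow_sv_seq: "sv_seq w \<Longrightarrow> slow (\<lambda>k. ennreal (w k))"
  unfolding slow_def
proof (intro allI impI)
  fix \<epsilon> :: real assume w: "sv_seq w" and e: "0 < \<epsilon>"
  obtain C where C: "\<And>n m. ln (w n) \<le> ln (w m) + \<epsilon> * \<bar>real_of_int (n - m)\<bar> + C"
    using sv_seqE[OF w e] by blast
  have "ennreal (w n) \<le> ennreal (exp C) * ennreal (exp (\<epsilon> * \<bar>real_of_int (n - m)\<bar>)) * ennreal (w m)" for n m
  proof -
    have "w n \<le> exp (\<epsilon> * \<bar>real_of_int (n - m)\<bar> + C) * w m"
      using C[of n m] by (intro le_exp_of_ln_le sv_seq_pos w) auto
    then show ?thesis using sv_seq_pos[OF w, of m]
      by (simp flip: ennreal_mult add: ennreal_leI exp_add mult_ac)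
  qed
  then show "\<exists>C<top. \<forall>n m. ennreal (w n) \<le> C * ennreal (exp (\<epsilon> * \<bar>real_of_int (n - m)\<bar>)) * ennreal (w m)"
    by (intro exI[of _ "ennreal (exp C)"]) auto
qed

lemma sv_seq_slow:
  assumes s: "slow (\<lambda>k. ennreal (w k))" and pos: "\<And>k. 0 < w k"
  shows "sv_seq w"
  unfolding sv_seq_def
proof (intro conjI allI impI pos)
  fix \<epsilon> :: real assume e: "0 < \<epsilon>"
  obtain C where C: "C < top" "\<And>n m. ennreal (w n) \<le> C * ennreal (exp (\<epsilon> * \<bar>real_of_int (n - m)\<bar>)) * ennreal (w m)"
    using slowE[OF s e] by blast
  then obtain c where c: "C = ennreal c" "0 \<le> c" by (cases C) auto
  have le: "w n \<le> c * exp (\<epsilon> * \<bar>real_of_int (n - m)\<bar>) * w m" for n m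
    using C(2)[of n m] c(2) pos[of m]
    by (simp add: c(1) less_imp_le flip: ennreal_mult)
  have c0: "0 < c" using le[of 0 0] pos[of 0] c(2) by (cases "c = 0") auto
  have "ln (w n) \<le> ln (w m) + \<epsilon> * \<bar>real_of_int (n - m)\<bar> + ln c" for n m
  proof -
    have "ln (w n) \<le> ln (c * exp (\<epsilon> * \<bar>real_of_int (n - m)\<bar>) * w m)"
      using le[of n m] pos[of n] by simp
    also have "\<dots> = ln (w m) + \<epsilon> * \<bar>real_of_int (n - m)\<bar> + ln c"
      using c0 pos[of m] by (simp add: ln_mult)
    finally show ?thesis .
  qed
  then show "\<exists>C. \<forall>n m. ln (w n) \<le> ln (w m) + \<epsilon> * \<bar>real_of_int (n - m)\<bar> + C" by blast
qed

lemma slow_mult: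
  assumes "slow F" "slow G" shows "slow (\<lambda>k. F k * G k)"
  unfolding slow_def
proof (intro allI impI)
  fix \<epsilon> :: real assume "0 < \<epsilon>"
  then have e: "0 < \<epsilon> / 2" by simp
  obtain C where C: "C < top" "\<And>n m. F n \<le> C * ennreal (exp (\<epsilon> / 2 * \<bar>real_of_int (n - m)\<bar>)) * F m"
    using slowE[OF assms(1) e] by blast
  obtain D where D: "D < top" "\<And>n m. G n \<le> D * ennreal (exp (\<epsilon> / 2 * \<bar>real_of_int (n - m)\<bar>)) * G m"
    using slowE[OF assms(2) e] by blast
  have "F n * G n \<le> (C * D) * ennreal (exp (\<epsilon> * \<bar>real_of_int (n - m)\<bar>)) * (F m * G m)" for n m
  proof -
    let ?e = "\<lambda>c. ennreal (exp (c * \<bar>real_of_int (n - m)\<bar>))"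
    have "F n * G n \<le> (C * ?e (\<epsilon> / 2) * F m) * (D * ?e (\<epsilon> / 2) * G m)"
      by (intro mult_mono C D) auto
    also have "\<dots> = (C * D) * (?e (\<epsilon> / 2) * ?e (\<epsilon> / 2)) * (F m * G m)" by (simp add: mult_ac)
    also have "?e (\<epsilon> / 2) * ?e (\<epsilon> / 2) = ?e \<epsilon>"
      by (simp flip: ennreal_mult exp_add)
    finally show ?thesis .
  qed
  then show "\<exists>C<top. \<forall>n m. F n * G n \<le> C * ennreal (exp (\<epsilon> * \<bar>real_of_int (n - m)\<bar>)) * (F m * G m)"
    using C D by (intro exI[of _ "C * D"]) (auto simp: ennreal_mult_less_top)
qed

lemma slow_add:
  assumes "slow F" "slow G" shows "slow (\<lambda>k. F k + G k)"
  unfolding slow_def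
proof (intro allI impI)
  fix \<epsilon> :: real assume e: "0 < \<epsilon>"
  obtain C where C: "C < top" "\<And>n m. F n \<le> C * ennreal (exp (\<epsilon> * \<bar>real_of_int (n - m)\<bar>)) * F m"
    using slowE[OF assms(1) e] by blast
  obtain D where D: "D < top" "\<And>n m. G n \<le> D * ennreal (exp (\<epsilon> * \<bar>real_of_int (n - m)\<bar>)) * G m"
    using slowE[OF assms(2) e] by blast
  have "F n + G n \<le> (C + D) * ennreal (exp (\<epsilon> * \<bar>real_of_int (n - m)\<bar>)) * (F m + G m)" for n m
  proof -
    let ?e = "ennreal (exp (\<epsilon> * \<bar>real_of_int (n - m)\<bar>))"
    have "F n + G n \<le> C * ?e * F m + D * ?e * G m" by (intro add_mono C D)
    also have "\<dots> \<le> (C + D) * ?e * F m + (C + D) * ?e * G m" by (intro add_mono mult_right_mono) auto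
    finally show ?thesis by (simp add: distrib_left)
  qed
  then show "\<exists>C<top. \<forall>n m. F n + G n \<le> C * ennreal (exp (\<epsilon> * \<bar>real_of_int (n - m)\<bar>)) * (F m + G m)"
    using C D by (intro exI[of _ "C + D"]) auto
qed

text \<open>For translates of a fixed index set, F (k + n) is compared with F (k + m) term by term,
  and all pairs have the same distance |n - m|. Initial segments and tails are such
  translates.\<close>

lemma slow_lq:
  assumes "slow F" "0 < q" shows "slow (\<lambda>n. lq q ((\<lambda>k. k + n) ` S) F)"
  unfolding slow_def
proof (intro allI impI)
  fix \<epsilon> :: real assume e: "0 < \<epsilon>"
  obtain C where C: "C < top" "\<And>n m. F n \<le> C * ennreal (exp (\<epsilon> * \<bar>real_of_int (n - m)\<bar>)) * F m"
    using slowE[OF assms(1) e] by blast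
  have "lq q ((\<lambda>k. k + n) ` S) F \<le> C * ennreal (exp (\<epsilon> * \<bar>real_of_int (n - m)\<bar>)) * lq q ((\<lambda>k. k + m) ` S) F" for n m
    unfolding lq_shift[OF assms(2)] lq_cmult[OF assms(2), symmetric]
  proof (intro lq_mono assms(2))
    show "F (k + n) \<le> C * ennreal (exp (\<epsilon> * \<bar>real_of_int (n - m)\<bar>)) * F (k + m)" for k
      using C(2)[of "k + n" "k + m"] by simp
  qed simp
  then show "\<exists>C<top. \<forall>n m. lq q ((\<lambda>k. k + n) ` S) F \<le> C * ennreal (exp (\<epsilon> * \<bar>real_of_int (n - m)\<bar>)) * lq q ((\<lambda>k. k + m) ` S) F"
    using C(1) by blast
qed

lemma slow_lq_atMost: "slow F \<Longrightarrow> 0 < q \<Longrightarrow> slow (\<lambda>n. lq q {..n} F)"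
proof -
  have "(\<lambda>k. k + n) ` {..0} = {..n::int}" for n
    by (auto intro!: image_eqI[of _ _ "_ - n"])
  then show "slow F \<Longrightarrow> 0 < q \<Longrightarrow> slow (\<lambda>n. lq q {..n} F)" using slow_lq[of F q "{..0}"] by simp
qed

lemma slow_lq_atLeast: "slow F \<Longrightarrow> 0 < q \<Longrightarrow> slow (\<lambda>n. lq q {n..} F)"
proof -
  have "(\<lambda>k. k + n) ` {0..} = {n::int..}" for n
    by (auto intro!: image_eqI[of _ _ "_ - n"])
  then show "slow F \<Longrightarrow> 0 < q \<Longrightarrow> slow (\<lambda>n. lq q {n..} F)" using slow_lq[of F q "{0..}"] by simp
qed

text \<open>This is how integrability assumed only near 0 or near \<infinity> extends to every
  t.\<close>

lemma slow_finite:
  assumes "slow F" "F m < top" shows "F n < top"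
proof -
  obtain C where C: "C < top" "\<And>n m. F n \<le> C * ennreal (exp (1 * \<bar>real_of_int (n - m)\<bar>)) * F m"
    using slowE[OF assms(1), of 1] by auto
  have "C * ennreal (exp (1 * \<bar>real_of_int (n - m)\<bar>)) * F m < top"
    using C(1) assms(2) by (simp add: ennreal_mult_less_top)
  then show ?thesis using C(2)[of n m] by (rule le_less_trans[rotated])
qed

lemma slow_equiv:
  assumes "slow G" "F \<lessapprox> G" "G \<lessapprox> F" shows "slow F"
  unfolding slow_def
proof (intro allI impI)
  fix \<epsilon> :: real assume e: "0 < \<epsilon>"
  obtain C where C: "C < top" "\<And>n m. G n \<le> C * ennreal (exp (\<epsilon> * \<bar>real_of_int (n - m)\<bar>)) * G m"
    using slowE[OF assms(1) e] by blast
  obtain D where D: "D < top" "\<And>x. F x \<le> D * G x" using dominatedE[OF assms(2)] by metis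
  obtain D' where D': "D' < top" "\<And>x. G x \<le> D' * F x" using dominatedE[OF assms(3)] by metis
  have "F n \<le> (D * C * D') * ennreal (exp (\<epsilon> * \<bar>real_of_int (n - m)\<bar>)) * F m" for n m
  proof -
    let ?e = "ennreal (exp (\<epsilon> * \<bar>real_of_int (n - m)\<bar>))"
    have "F n \<le> D * (C * ?e * (D' * F m))"
      by (intro order_trans[OF D(2)] mult_left_mono order_trans[OF C(2)[of n m]] D') auto
    then show ?thesis by (simp add: mult_ac)
  qed
  then show "\<exists>C<top. \<forall>n m. F n \<le> C * ennreal (exp (\<epsilon> * \<bar>real_of_int (n - m)\<bar>)) * F m"
    using C D D' by (intro exI[of _ "D * C * D'"]) (auto simp: ennreal_mult_less_top)
qed

text \<open>In the applications p is an element of A0 + A1 and F, G are norms: one constant has to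
  serve all elements.\<close>

definition equiv_on :: "'p set \<Rightarrow> ('p \<Rightarrow> ennreal) \<Rightarrow> ('p \<Rightarrow> ennreal) \<Rightarrow> bool" where
  "equiv_on P F G \<longleftrightarrow> (\<exists>C<top. \<forall>p\<in>P. F p \<le> C * G p \<and> G p \<le> C * F p)"

lemma equiv_onE:
  assumes "equiv_on P F G"
  obtains C where "C < top" "\<forall>p\<in>P. F p \<le> C * G p" "\<forall>p\<in>P. G p \<le> C * F p"
  using assms unfolding equiv_on_def by blast

lemma equiv_onI:
  assumes "C < top" "D < top" "\<And>p. p \<in> P \<Longrightarrow> F p \<le> C * G p" "\<And>p. p \<in> P \<Longrightarrow> G p \<le> D * F p"
  shows "equiv_on P F G"
  unfolding equiv_on_def
proof (intro exI[of _ "C + D"] conjI ballI)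
  show "C + D < top" using assms by simp
  show "F p \<le> (C + D) * G p" if "p \<in> P" for p by (rule order_trans[OF assms(3)[OF that] mult_right_mono]) auto
  show "G p \<le> (C + D) * F p" if "p \<in> P" for p by (rule order_trans[OF assms(4)[OF that] mult_right_mono]) auto
qed

section \<open>The discrete Holmstedt formula and Hardy inequalities\<close>

lemma ennreal_split:
  assumes "x = y * z" "0 \<le> y" shows "ennreal x * k = ennreal y * (ennreal z * k)"
  using assms by (simp add: ennreal_mult' mult.assoc)

lemma ennreal_le_divide:
  assumes "0 < a" "ennreal a * y \<le> D * ennreal x" shows "y \<le> D * ennreal (x / a)"
proof -
  have a: "ennreal (1 / a) * ennreal a = 1" using assms(1) by (subst ennreal_mult[symmetric]) auto
  have "ennreal (1 / a) * (ennreal a * y) \<le> ennreal (1 / a) * (D * ennreal x)"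
    by (intro mult_left_mono assms) auto
  then have "y \<le> D * (ennreal (1 / a) * ennreal x)"
    unfolding mult.assoc[symmetric] a by (simp add: mult_ac)
  then show ?thesis using assms(1) by (simp flip: ennreal_mult')
qed

text \<open>Both halves of the discrete K-functional formula are of the following form, the second one after
  the reflection \<open>k \<mapsto> - k\<close>.\<close>

locale iterated_sum =
  fixes q r :: ennreal and al b d :: "int \<Rightarrow> real"
  assumes q: "0 < q" and r: "0 < r" and al: "\<And>k. 0 < al k" and d: "sv_seq d"
    and sum_b: "\<exists>D<top. \<forall>n. lq r {..n} b \<le> D * ennreal (d n)"
begin

text \<open>The iterated norm stopped at n. The sequence d of the locale bounds the sums of the
  outer weight b up to n.\<close>

definition I :: "int \<Rightarrow> (int \<Rightarrow> ennreal) \<Rightarrow> ennreal" where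
  "I n \<kappa> = lq r {..n} (\<lambda>k. ennreal (b k) * lq q {k..n} (\<lambda>j. ennreal (al j) * \<kappa> j))"

lemma I_mono: "(\<And>j. j \<le> n \<Longrightarrow> \<kappa> j \<le> \<kappa>' j) \<Longrightarrow> I n \<kappa> \<le> I n \<kappa>'"
  unfolding I_def by (intro lq_mono r mult_left_mono q) auto

lemma I_cmult: "I n (\<lambda>j. c * \<kappa> j) = c * I n \<kappa>"
  unfolding I_def using lq_cmult[OF q] lq_cmult[OF r] by (simp only: mult.left_commute[of _ c])

lemma I_add: "\<exists>C<top. \<forall>n \<kappa> \<kappa>'. I n (\<lambda>j. \<kappa> j + \<kappa>' j) \<le> C * (I n \<kappa> + I n \<kappa>')"
proof -
  obtain C where C: "C < top" "\<And>S f g. lq q S (\<lambda>k. f k + g k) \<le> C * (lq q S f + lq q S g)"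
    using lq_add_le[OF q] by blast
  obtain D where D: "D < top" "\<And>S f g. lq r S (\<lambda>k. f k + g k) \<le> D * (lq r S f + lq r S g)"
    using lq_add_le[OF r] by blast
  have "I n (\<lambda>j. \<kappa> j + \<kappa>' j) \<le> C * D * (I n \<kappa> + I n \<kappa>')" for n \<kappa> \<kappa>'
  proof -
    let ?J = "\<lambda>\<kappa> k. lq q {k..n} (\<lambda>j. ennreal (al j) * \<kappa> j)"
    have "I n (\<lambda>j. \<kappa> j + \<kappa>' j) \<le> lq r {..n} (\<lambda>k. C * (ennreal (b k) * ?J \<kappa> k + ennreal (b k) * ?J \<kappa>' k))"
      unfolding I_def
    proof (intro lq_mono r)
      fix k
      have "?J (\<lambda>j. \<kappa> j + \<kappa>' j) k \<le> C * (?J \<kappa> k + ?J \<kappa>' k)"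
        using C(2)[of "{k..n}" "\<lambda>j. ennreal (al j) * \<kappa> j" "\<lambda>j. ennreal (al j) * \<kappa>' j"]
        by (simp only: distrib_left)
      then have "ennreal (b k) * ?J (\<lambda>j. \<kappa> j + \<kappa>' j) k \<le> ennreal (b k) * (C * (?J \<kappa> k + ?J \<kappa>' k))"
        by (intro mult_left_mono) auto
      then show "ennreal (b k) * ?J (\<lambda>j. \<kappa> j + \<kappa>' j) k \<le> C * (ennreal (b k) * ?J \<kappa> k + ennreal (b k) * ?J \<kappa>' k)"
        by (simp add: distrib_left mult_ac)
    qed simp
    also have "\<dots> \<le> C * (D * (I n \<kappa> + I n \<kappa>'))"
      unfolding lq_cmult[OF r] I_def by (intro mult_left_mono D) auto
    finally show ?thesis by (simp add: mult.assoc)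
  qed
  then show ?thesis using C D by (intro exI[of _ "C * D"]) (auto simp: ennreal_mult_less_top)
qed

text \<open>If the terms are dominated by a geometrically growing y, the inner norm is at most a
  multiple of y n whatever its lower end k; the outer norm then only sums b and produces d n. The
  free factor m allows suprema of unknown size.\<close>

lemma I_bound:
  assumes y: "inc_seq y"
  shows "\<exists>C<top. \<forall>n m \<kappa>. (\<forall>j\<le>n. ennreal (al j) * \<kappa> j \<le> m * ennreal (y j)) \<longrightarrow> I n \<kappa> \<le> C * (m * ennreal (y n * d n))"
proof -
  obtain C where C: "C < top" "\<And>n. lq q {..n} y \<le> C * ennreal (y n)"
    using lq_inc_seq[OF y q] by blast
  obtain D where D: "D < top" "\<And>n. lq r {..n} b \<le> D * ennreal (d n)"
    using sum_b by blast
  have ypos: "0 < y n" for n using y by (simp add: inc_seq_def)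
  have "I n \<kappa> \<le> C * D * (m * ennreal (y n * d n))"
    if \<kappa>: "\<And>j. j \<le> n \<Longrightarrow> ennreal (al j) * \<kappa> j \<le> m * ennreal (y j)" for n m \<kappa>
  proof -
    have "I n \<kappa> \<le> lq r {..n} (\<lambda>k. ennreal (b k) * (m * (C * ennreal (y n))))"
      unfolding I_def
    proof (intro lq_mono r mult_left_mono)
      fix k
      have "lq q {k..n} (\<lambda>j. ennreal (al j) * \<kappa> j) \<le> lq q {..n} (\<lambda>j. m * y j)"
        by (intro lq_mono q \<kappa>) auto
      also have "\<dots> \<le> m * (C * ennreal (y n))"
        unfolding lq_cmult[OF q] by (intro mult_left_mono C) auto
      finally show "lq q {k..n} (\<lambda>j. ennreal (al j) * \<kappa> j) \<le> m * (C * ennreal (y n))" .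
    qed auto
    also have "\<dots> \<le> (D * ennreal (d n)) * (m * (C * ennreal (y n)))"
      unfolding lq_multc[OF r] by (intro mult_right_mono D) auto
    also have "\<dots> = C * D * (m * ennreal (y n * d n))"
      unfolding ennreal_mult'[OF less_imp_le[OF ypos]] by (simp only: mult_ac)
    finally show ?thesis .
  qed
  moreover have "C * D < top" using C D by (simp add: ennreal_mult_less_top)
  ultimately show ?thesis by blast
qed

text \<open>The natural size of the contribution of index n to \<open>I\<close>: its term times the
  bound d n for the sum of the outer weights.\<close>

definition M :: "int \<Rightarrow> (int \<Rightarrow> ennreal) \<Rightarrow> ennreal" where
  "M n \<kappa> = ennreal (al n * d n) * \<kappa> n"

text \<open>The geometric decay of \<open>\<omega>\<close> absorbs the sum over \<open>j \<le> n\<close>: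
  passing to a weighted supremum of \<open>M\<close> avoids convexity, so all exponents in \<open>(0, \<infinity>]\<close> are covered.\<close>

lemma hardy:
  assumes \<omega>: "dec_seq \<omega>" and p: "0 < p"
  shows "\<exists>C<top. \<forall>\<kappa>. lq p UNIV (\<lambda>n. \<omega> n * I n \<kappa>) \<le> C * lq p UNIV (\<lambda>n. \<omega> n * M n \<kappa>)"
proof -
  obtain \<epsilon> D where \<epsilon>: "0 < \<epsilon>" and D': "\<And>j n. j \<le> n \<Longrightarrow> ln (\<omega> (- j)) \<le> ln (\<omega> (- n)) - \<epsilon> * real_of_int (n - j) + D"
    and \<omega>pos': "\<And>k. 0 < \<omega> (- k)"
    using \<omega> unfolding dec_seq_def inc_seq_def by blast
  have D: "ln (\<omega> n) \<le> ln (\<omega> j) - \<epsilon> * real_of_int (n - j) + D" if "j \<le> n" for j n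
    using D'[of "- n" "- j"] that by simp
  have \<omega>pos: "0 < \<omega> k" for k using \<omega>pos'[of "- k"] by simp
  \<comment> \<open>Half of the decay of \<omega> pays for the supremum \<open>H\<close>; the other
    half is left for \<open>lq_geometric\<close>.\<close>
  define \<delta> where "\<delta> = \<epsilon> / 2"
  have \<delta>: "0 < \<delta>" using \<epsilon> by (simp add: \<delta>_def)
  have dpos: "0 < d k" for k by (rule sv_seq_pos[OF d])
  \<comment> \<open>Chosen so that y j * d j is a pure exponential: the bound from
    \<open>I_bound\<close> then has no slowly varying factor left.\<close>
  define y where "y j = exp (\<delta> * j) * (1 / d j)" for j
  have "inc_seq y"
    using \<delta> by (intro inc_seqI[OF sv_seq_powr[OF d, of "- 1"], of \<delta>]) (use sv_seq_pos[OF d] in \<open>auto simp: y_def powr_minus divide_inverse less_imp_le\<close>)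
  then obtain C where C: "C < top" "\<And>n m \<kappa>. (\<forall>j\<le>n. ennreal (al j) * \<kappa> j \<le> m * ennreal (y j)) \<Longrightarrow> I n \<kappa> \<le> C * (m * ennreal (y n * d n))"
    using I_bound by blast
  obtain E where E: "E < top" "\<And>g. lq p UNIV (\<lambda>n. SUP j. ennreal (exp (- \<delta> * \<bar>real_of_int (n - j)\<bar>)) * g j) \<le> E * lq p UNIV g"
    using lq_geometric[OF p \<delta>] by blast
  have "lq p UNIV (\<lambda>n. \<omega> n * I n \<kappa>) \<le> C * ennreal (exp D) * E * lq p UNIV (\<lambda>n. \<omega> n * M n \<kappa>)" for \<kappa>
  proof -
    \<comment> \<open>The smallest H n for which M j is at most exp(- \<delta> (n - j)) H n for all
      j \<le> n.\<close>
    define H where "H n = (SUP j\<in>{..n}. ennreal (exp (\<delta> * (n - j))) * M j \<kappa>)" for n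
    have IH: "I n \<kappa> \<le> C * H n" for n
    proof -
      have "ennreal (al j) * \<kappa> j \<le> (ennreal (exp (- \<delta> * n)) * H n) * ennreal (y j)" if "j \<le> n" for j
      proof -
        have "al j = (exp (- \<delta> * n) * y j * exp (\<delta> * (n - j))) * (al j * d j)"
        proof -
          have "exp (- \<delta> * n) * exp (\<delta> * j) * exp (\<delta> * (n - j)) = 1"
            by (simp flip: exp_add add: algebra_simps)
          then have "exp (- \<delta> * n) * y j * exp (\<delta> * (n - j)) = 1 / d j"
            by (simp add: y_def)
          then show ?thesis using dpos[of j] by simp
        qed
        then have "ennreal (al j) * \<kappa> j = ennreal (exp (- \<delta> * n) * y j * exp (\<delta> * (n - j))) * M j \<kappa>"
          unfolding M_def using al[of j] dpos[of j] by (intro ennreal_split) (auto simp: y_def)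
        also have "\<dots> = ennreal (exp (- \<delta> * n) * y j) * (ennreal (exp (\<delta> * (n - j))) * M j \<kappa>)"
          using al[of j] dpos[of j] by (intro ennreal_split) (auto simp: y_def)
        also have "\<dots> \<le> ennreal (exp (- \<delta> * n) * y j) * H n"
          unfolding H_def using that by (intro mult_left_mono SUP_upper2[of j]) auto
        finally show ?thesis unfolding ennreal_mult'[OF exp_ge_zero] by (simp only: mult_ac)
      qed
      then have "I n \<kappa> \<le> C * ((ennreal (exp (- \<delta> * n)) * H n) * ennreal (y n * d n))"
        by (intro C) auto
      also have "y n * d n = exp (\<delta> * n)" using dpos[of n] by (simp add: y_def)
      also have "(ennreal (exp (- \<delta> * n)) * H n) * ennreal (exp (\<delta> * n)) = H n"
      proof -
        have "ennreal (exp (- \<delta> * n)) * ennreal (exp (\<delta> * n)) = 1"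
          by (simp flip: ennreal_mult' exp_add)
        then show ?thesis by (metis mult.assoc mult.commute mult_1_left)
      qed
      finally show ?thesis .
    qed
    \<comment> \<open>The choice \<epsilon> = 2 \<delta> acts here: decay at rate \<epsilon> against
      growth at rate \<delta> leaves decay at rate \<delta>.\<close>
    have \<omega>H: "\<omega> n * H n \<le> ennreal (exp D) * (SUP j. ennreal (exp (- \<delta> * \<bar>real_of_int (n - j)\<bar>)) * (\<omega> j * M j \<kappa>))" for n
    proof -
      have "\<omega> n * H n = (SUP j\<in>{..n}. \<omega> n * (ennreal (exp (\<delta> * (n - j))) * M j \<kappa>))"
        unfolding H_def by (simp add: SUP_mult_left_ennreal)
      also have "\<dots> \<le> (SUP j. ennreal (exp D) * (ennreal (exp (- \<delta> * \<bar>real_of_int (n - j)\<bar>)) * (\<omega> j * M j \<kappa>)))"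
      proof (intro SUP_mono bexI)
        fix j assume j: "j \<in> {..n}"
        then have "\<omega> n \<le> exp (- \<epsilon> * real_of_int (n - j) + D) * \<omega> j"
          using D[of j n] by (intro le_exp_of_ln_le \<omega>pos) auto
        then have "\<omega> n * exp (\<delta> * (n - j)) \<le> exp (- \<epsilon> * real_of_int (n - j) + D) * \<omega> j * exp (\<delta> * (n - j))"
          by (intro mult_right_mono) auto
        also have "\<dots> = exp (- \<epsilon> * real_of_int (n - j) + D + \<delta> * (n - j)) * \<omega> j" by (simp add: exp_add mult_ac)
        also have "- \<epsilon> * real_of_int (n - j) + D + \<delta> * (n - j) = D - \<delta> * \<bar>real_of_int (n - j)\<bar>"
          using j by (simp add: \<delta>_def field_simps)
        also have "exp (D - \<delta> * \<bar>real_of_int (n - j)\<bar>) * \<omega> j = exp D * exp (- \<delta> * \<bar>real_of_int (n - j)\<bar>) * \<omega> j"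
          by (simp add: exp_diff exp_minus divide_inverse)
        finally have "ennreal (\<omega> n * exp (\<delta> * (n - j))) \<le> ennreal (exp D * exp (- \<delta> * \<bar>real_of_int (n - j)\<bar>) * \<omega> j)"
          by (rule ennreal_leI)
        then have "ennreal (\<omega> n * exp (\<delta> * (n - j))) * M j \<kappa> \<le> ennreal (exp D * exp (- \<delta> * \<bar>real_of_int (n - j)\<bar>) * \<omega> j) * M j \<kappa>"
          by (rule mult_right_mono) simp
        then show "\<omega> n * (ennreal (exp (\<delta> * (n - j))) * M j \<kappa>)
          \<le> ennreal (exp D) * (ennreal (exp (- \<delta> * \<bar>real_of_int (n - j)\<bar>)) * (\<omega> j * M j \<kappa>))"
          using \<omega>pos[of n] by (simp add: ennreal_mult' ennreal_mult'' mult_ac)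
      qed simp
      finally show ?thesis by (simp add: SUP_mult_left_ennreal)
    qed
    have "lq p UNIV (\<lambda>n. \<omega> n * I n \<kappa>)
      \<le> lq p UNIV (\<lambda>n. C * ennreal (exp D) * (SUP j. ennreal (exp (- \<delta> * \<bar>real_of_int (n - j)\<bar>)) * (\<omega> j * M j \<kappa>)))"
    proof (intro lq_mono p)
      fix n
      have "\<omega> n * I n \<kappa> \<le> \<omega> n * (C * H n)" by (intro mult_left_mono IH) auto
      also have "\<dots> = C * (\<omega> n * H n)" by (simp add: mult_ac)
      also have "\<dots> \<le> C * (ennreal (exp D) * (SUP j. ennreal (exp (- \<delta> * \<bar>real_of_int (n - j)\<bar>)) * (\<omega> j * M j \<kappa>)))"
        by (intro mult_left_mono \<omega>H) auto
      finally show "\<omega> n * I n \<kappa> \<le> C * ennreal (exp D) * (SUP j. ennreal (exp (- \<delta> * \<bar>real_of_int (n - j)\<bar>)) * (\<omega> j * M j \<kappa>))"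
        by (simp only: mult.assoc)
    qed simp
    also have "\<dots> \<le> C * ennreal (exp D) * (E * lq p UNIV (\<lambda>n. \<omega> n * M n \<kappa>))"
      unfolding lq_cmult[OF p] by (intro mult_left_mono E) auto
    finally show ?thesis by (simp only: mult.assoc)
  qed
  moreover have "C * ennreal (exp D) * E < top" using C E by (simp add: ennreal_mult_less_top)
  ultimately show ?thesis by blast
qed

end

text \<open>Here \<chi>0 and \<chi>1 will be samples of the continuous functions, so they are only
  comparable to the discrete expressions built from the sampled weights. The factors exp(- \<theta>0
  L j) and exp(- L j) below are powers of the grid point x_j = exp(L j).\<close>

locale discrete =
  fixes q0 r0 q1 r1 :: ennreal and a0 b0 a1 b1 \<chi>0 \<chi>1 :: "int \<Rightarrow> real" and \<theta>0 L :: real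
  assumes q0: "0 < q0" and r0: "0 < r0" and q1: "0 < q1" and r1: "0 < r1"
    and \<theta>0: "0 < \<theta>0" "\<theta>0 < 1" and L: "0 < L"
    and a0: "sv_seq a0" and b0: "sv_seq b0" and a1: "sv_seq a1" and b1: "sv_seq b1"
    and \<chi>0: "sv_seq \<chi>0" and \<chi>1: "sv_seq \<chi>1"
    and \<chi>0_ge: "(\<lambda>n. ennreal (a0 n) * lq r0 {..n} b0) \<lessapprox> \<chi>0"
    and \<chi>0_le: "\<chi>0 \<lessapprox> (\<lambda>n. ennreal (a0 n) * lq r0 {..n} b0)"
    and \<chi>1_ge: "(\<lambda>n. lq r1 {..n} (\<lambda>k. ennreal (b1 k) * lq q1 {..k} a1) + lq r1 {n..} b1 * lq q1 {..n} a1) \<lessapprox> \<chi>1"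
    and \<chi>1_le: "\<chi>1 \<lessapprox> (\<lambda>n. lq r1 {..n} (\<lambda>k. ennreal (b1 k) * lq q1 {..k} a1) + lq r1 {n..} b1 * lq q1 {..n} a1)"
begin

definition al0 :: "int \<Rightarrow> real" where "al0 j = exp (- \<theta>0 * L * j) * a0 j"
definition al1 :: "int \<Rightarrow> real" where "al1 j = exp (- L * j) * a1 j"
definition rho :: "int \<Rightarrow> real" where "rho j = exp ((1 - \<theta>0) * L * j) * (\<chi>0 j / \<chi>1 j)"

text \<open>\<open>N0\<close> and \<open>N1\<close> are the discrete norms of the R and the L space.
  \<open>I0\<close> and \<open>I1\<close> keep both indices on one side of n, and \<open>M0\<close>,
  \<open>M1\<close> are the matching contributions of the single index n.\<close>

definition N0 :: "(int \<Rightarrow> ennreal) \<Rightarrow> ennreal" where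
  "N0 \<kappa> = lq r0 UNIV (\<lambda>k. ennreal (b0 k) * lq q0 {k..} (\<lambda>j. ennreal (al0 j) * \<kappa> j))"
definition N1 :: "(int \<Rightarrow> ennreal) \<Rightarrow> ennreal" where
  "N1 \<kappa> = lq r1 UNIV (\<lambda>k. ennreal (b1 k) * lq q1 {..k} (\<lambda>j. ennreal (al1 j) * \<kappa> j))"
definition I0 :: "int \<Rightarrow> (int \<Rightarrow> ennreal) \<Rightarrow> ennreal" where
  "I0 n \<kappa> = lq r0 {..n} (\<lambda>k. ennreal (b0 k) * lq q0 {k..n} (\<lambda>j. ennreal (al0 j) * \<kappa> j))"
definition I1 :: "int \<Rightarrow> (int \<Rightarrow> ennreal) \<Rightarrow> ennreal" where
  "I1 n \<kappa> = lq r1 {n..} (\<lambda>k. ennreal (b1 k) * lq q1 {n..k} (\<lambda>j. ennreal (al1 j) * \<kappa> j))"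
definition M0 :: "int \<Rightarrow> (int \<Rightarrow> ennreal) \<Rightarrow> ennreal" where
  "M0 n \<kappa> = ennreal (exp (- \<theta>0 * L * n) * \<chi>0 n) * \<kappa> n"
definition M1 :: "int \<Rightarrow> (int \<Rightarrow> ennreal) \<Rightarrow> ennreal" where
  "M1 n \<kappa> = ennreal (exp (- L * n) * \<chi>1 n) * \<kappa> n"

lemmas pos = sv_seq_pos[OF a0] sv_seq_pos[OF b0] sv_seq_pos[OF a1] sv_seq_pos[OF b1] sv_seq_pos[OF \<chi>0] sv_seq_pos[OF \<chi>1]

lemma rho_pos: "0 < rho n"
  using pos by (simp add: rho_def)

text \<open>The identity behind the definition of rho: at the parameter t = rho n the contributions
  of index n to the two extreme norms balance.\<close>

lemma rho_M1: "rho n * M1 n \<kappa> = M0 n \<kappa>"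
proof -
  have "exp (- \<theta>0 * L * n) = exp ((1 - \<theta>0) * L * n) * exp (- L * n)"
    by (simp flip: exp_add add: algebra_simps)
  then have "exp (- \<theta>0 * L * n) * \<chi>0 n = rho n * (exp (- L * n) * \<chi>1 n)"
    using pos(6)[of n] by (simp add: rho_def)
  then show ?thesis
    unfolding M0_def M1_def using rho_pos[of n] by (subst ennreal_split) (auto simp: less_imp_le)
qed

lemma ennreal_al0: "ennreal (al0 n) = ennreal (exp (- \<theta>0 * L * n)) * ennreal (a0 n)"
  unfolding al0_def by (simp only: ennreal_mult' exp_ge_zero)

lemma ennreal_al1: "ennreal (al1 n) = ennreal (exp (- L * n)) * ennreal (a1 n)"
  unfolding al1_def by (simp only: ennreal_mult' exp_ge_zero)

lemma M1_split: "M1 n \<kappa> = ennreal (exp (- L * n)) * ennreal (\<chi>1 n) * \<kappa> n"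
  unfolding M1_def by (simp only: ennreal_mult' exp_ge_zero)

lemma dec_al0: "dec_seq al0"
  using \<theta>0 L by (intro dec_seqI[OF a0, of "- \<theta>0 * L"]) (auto simp: al0_def)

lemma dec_b0_al0: "dec_seq (\<lambda>k. b0 k * al0 k)"
  using \<theta>0 L by (intro dec_seqI[OF sv_seq_mult[OF b0 a0], of "- \<theta>0 * L"]) (auto simp: al0_def)

lemma M1_cmult: "M1 n (\<lambda>j. c * \<kappa> j) = c * M1 n \<kappa>"
  unfolding M1_def by (rule mult.left_commute)

sublocale left: iterated_sum q0 r0 al0 b0 "\<lambda>n. \<chi>0 n / a0 n"
proof
  show "0 < q0" "0 < r0" by (rule q0 r0)+
  show "0 < al0 k" for k using pos(1) by (simp add: al0_def)
  show "sv_seq (\<lambda>n. \<chi>0 n / a0 n)" by (rule sv_seq_divide[OF \<chi>0 a0])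
  obtain D where D: "D < top" "\<And>n. ennreal (a0 n) * lq r0 {..n} b0 \<le> D * ennreal (\<chi>0 n)"
    using dominatedE[OF \<chi>0_ge] by metis
  have "lq r0 {..n} b0 \<le> D * ennreal (\<chi>0 n / a0 n)" for n
    by (rule ennreal_le_divide[OF pos(1) D(2)])
  then show "\<exists>D<top. \<forall>n. lq r0 {..n} b0 \<le> D * ennreal (\<chi>0 n / a0 n)" using D(1) by blast
qed

text \<open>After the reflection the tails of b1 become initial segments. They are bounded by a
  multiple of \<chi>1 / a1, because the second summand of \<chi>1 is the tail of b1 times a norm of
  a1 that is at least a1 n.\<close>

sublocale right: iterated_sum q1 r1 "\<lambda>n. al1 (- n)" "\<lambda>n. b1 (- n)" "\<lambda>n. \<chi>1 (- n) / a1 (- n)"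
proof
  show "0 < q1" "0 < r1" by (rule q1 r1)+
  show "0 < al1 (- k)" for k using pos(3) by (simp add: al1_def)
  show "sv_seq (\<lambda>n. \<chi>1 (- n) / a1 (- n))" by (rule sv_seq_divide[OF sv_seq_reflect[OF \<chi>1] sv_seq_reflect[OF a1]])
  obtain D where D: "D < top" "\<And>n. lq r1 {..n} (\<lambda>k. b1 k * lq q1 {..k} a1) + lq r1 {n..} b1 * lq q1 {..n} a1 \<le> D * ennreal (\<chi>1 n)"
    using dominatedE[OF \<chi>1_ge] by metis
  have "ennreal (a1 n) * lq r1 {n..} b1 \<le> D * ennreal (\<chi>1 n)" for n
  proof -
    have "ennreal (a1 n) * lq r1 {n..} b1 \<le> lq q1 {..n} a1 * lq r1 {n..} b1"
      by (intro mult_right_mono lq_point[OF q1, where f = "\<lambda>k. ennreal (a1 k)"]) auto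
    also have "\<dots> \<le> D * ennreal (\<chi>1 n)"
      by (intro order_trans[OF _ D(2)]) (simp add: mult.commute)
    finally show ?thesis .
  qed
  then have "lq r1 {- n..} b1 \<le> D * ennreal (\<chi>1 (- n) / a1 (- n))" for n
    by (intro ennreal_le_divide[OF pos(3)])
  then have "lq r1 {..n} (\<lambda>k. b1 (- k)) \<le> D * ennreal (\<chi>1 (- n) / a1 (- n))" for n
    using lq_reflect[OF r1, of "{..n}" "\<lambda>k. ennreal (b1 k)"] by simp
  then show "\<exists>D<top. \<forall>n. lq r1 {..n} (\<lambda>k. b1 (- k)) \<le> D * ennreal (\<chi>1 (- n) / a1 (- n))" using D(1) by blast
qed

lemma I0_eq: "I0 n \<kappa> = left.I n \<kappa>"
  by (simp only: I0_def left.I_def)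

lemma I1_eq: "I1 n \<kappa> = right.I (- n) (\<lambda>j. \<kappa> (- j))"
proof -
  have "lq q1 {n..k} (\<lambda>j. ennreal (al1 j) * \<kappa> j) = lq q1 {- k..- n} (\<lambda>j. ennreal (al1 (- j)) * \<kappa> (- j))" for k
    using lq_reflect[OF q1, of "{- k..- n}" "\<lambda>j. ennreal (al1 j) * \<kappa> j"] by simp
  then show ?thesis
    using lq_reflect[OF r1, of "{..- n}" "\<lambda>k. ennreal (b1 k) * lq q1 {n..k} (\<lambda>j. ennreal (al1 j) * \<kappa> j)"]
    by (simp add: I1_def right.I_def)
qed

lemma I0_mono: "(\<And>j. \<kappa> j \<le> \<kappa>' j) \<Longrightarrow> I0 n \<kappa> \<le> I0 n \<kappa>'"
  unfolding I0_eq by (intro left.I_mono)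

lemma I1_mono: "(\<And>j. \<kappa> j \<le> \<kappa>' j) \<Longrightarrow> I1 n \<kappa> \<le> I1 n \<kappa>'"
  unfolding I1_eq by (intro right.I_mono)

lemma I0_cmult: "I0 n (\<lambda>j. c * \<kappa> j) = c * I0 n \<kappa>"
  unfolding I0_eq by (rule left.I_cmult)

lemma I1_cmult: "I1 n (\<lambda>j. c * \<kappa> j) = c * I1 n \<kappa>"
  unfolding I1_eq by (rule right.I_cmult)

lemma I0_add: "\<exists>C<top. \<forall>n \<kappa> \<kappa>'. I0 n (\<lambda>j. \<kappa> j + \<kappa>' j) \<le> C * (I0 n \<kappa> + I0 n \<kappa>')"
  unfolding I0_eq by (rule left.I_add)

lemma I1_add: "\<exists>C<top. \<forall>n \<kappa> \<kappa>'. I1 n (\<lambda>j. \<kappa> j + \<kappa>' j) \<le> C * (I1 n \<kappa> + I1 n \<kappa>')"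
proof -
  obtain C where C: "C < top" "\<forall>n \<kappa> \<kappa>'. right.I n (\<lambda>j. \<kappa> j + \<kappa>' j) \<le> C * (right.I n \<kappa> + right.I n \<kappa>')"
    using right.I_add by (elim exE conjE)
  show ?thesis unfolding I1_eq
    by (intro exI[of _ C] conjI allI C(1) C(2)[rule_format])
qed

lemma I0_le_N0: "I0 n \<kappa> \<le> N0 \<kappa>"
  unfolding I0_def N0_def by (intro lq_mono r0 mult_left_mono q0) auto

lemma I1_le_N1: "I1 n \<kappa> \<le> N1 \<kappa>"
  unfolding I1_def N1_def by (intro lq_mono r1 mult_left_mono q1) auto

section \<open>Truncated sequences, single terms and cross terms\<close>

lemma al0_le_I0: "ennreal (al0 n) * lq r0 {..n} b0 * \<kappa> n \<le> I0 n \<kappa>"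
proof -
  have "ennreal (al0 n) * lq r0 {..n} b0 * \<kappa> n = lq r0 {..n} (\<lambda>k. ennreal (b0 k) * (ennreal (al0 n) * \<kappa> n))"
    unfolding lq_multc[OF r0] by (simp only: mult_ac)
  also have "\<dots> \<le> I0 n \<kappa>"
    unfolding I0_def by (intro lq_mono r0 mult_left_mono lq_point[OF q0, of n]) auto
  finally show ?thesis .
qed

text \<open>Every inner norm over {k..n} contains the term j = n. Keeping only it leaves the partial
  norm of b0, which together with a0 is \<chi>0 up to a constant.\<close>

lemma M0_le_I0: "\<exists>C<top. \<forall>n \<kappa>. M0 n \<kappa> \<le> C * I0 n \<kappa>"
proof -
  obtain C where C: "C < top" "\<And>n. ennreal (\<chi>0 n) \<le> C * (ennreal (a0 n) * lq r0 {..n} b0)"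
    using dominatedE[OF \<chi>0_le] by metis
  have "M0 n \<kappa> \<le> C * I0 n \<kappa>" for n \<kappa>
  proof -
    have "M0 n \<kappa> = ennreal (exp (- \<theta>0 * L * n)) * ennreal (\<chi>0 n) * \<kappa> n"
      unfolding M0_def by (simp add: ennreal_mult')
    also have "\<dots> \<le> ennreal (exp (- \<theta>0 * L * n)) * (C * (ennreal (a0 n) * lq r0 {..n} b0)) * \<kappa> n"
      by (intro mult_left_mono mult_right_mono C) auto
    also have "\<dots> = C * (ennreal (al0 n) * lq r0 {..n} b0 * \<kappa> n)"
      unfolding ennreal_al0 by (simp only: mult_ac)
    also have "\<dots> \<le> C * I0 n \<kappa>" by (intro mult_left_mono al0_le_I0) auto
    finally show ?thesis .
  qed
  then show ?thesis using C(1) by blast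
qed

text \<open>\<kappa>' stands for the samples of the first component of a splitting at n. Beyond n
  the weights al0 and b0 al0 decay geometrically, so all tails collapse to the term at n, which
  already occurs in \<open>I0\<close>.\<close>

lemma N0_truncated:
  "\<exists>C<top. \<forall>n \<kappa> \<kappa>'. (\<forall>j. \<kappa>' j \<le> \<kappa> n) \<longrightarrow> (\<forall>j\<le>n. \<kappa>' j \<le> \<kappa> j) \<longrightarrow> N0 \<kappa>' \<le> C * I0 n \<kappa>"
proof -
  obtain Ca where Ca: "Ca < top" "\<And>S T f. lq q0 (S \<union> T) f \<le> Ca * (lq q0 S f + lq q0 T f)"
    using lq_Un_le[OF q0] by blast
  obtain Cr where Cr: "Cr < top" "\<And>S T f. lq r0 (S \<union> T) f \<le> Cr * (lq r0 S f + lq r0 T f)"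
    using lq_Un_le[OF r0] by blast
  obtain Cd where Cd: "Cd < top" "\<And>n. lq q0 {n..} al0 \<le> Cd * ennreal (al0 n)"
    using lq_dec_seq[OF dec_al0 q0] by blast
  obtain Ce where Ce: "Ce < top" "\<And>n. lq r0 {n..} (\<lambda>k. ennreal (b0 k * al0 k)) \<le> Ce * ennreal (b0 n * al0 n)"
    using lq_dec_seq[OF dec_b0_al0 r0] by blast
  have "N0 \<kappa>' \<le> Cr * (Ca * (1 + Cd) + Cd * Ce) * I0 n \<kappa>"
    if \<kappa>: "\<And>j. \<kappa>' j \<le> \<kappa> n" "\<And>j. j \<le> n \<Longrightarrow> \<kappa>' j \<le> \<kappa> j" for n \<kappa> \<kappa>'
  proof -
    define J where "J k = lq q0 {k..n} (\<lambda>j. ennreal (al0 j) * \<kappa> j)" for k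
    define J' where "J' k = lq q0 {k..} (\<lambda>j. ennreal (al0 j) * \<kappa>' j)" for k
    have tail: "J' k \<le> Cd * ennreal (al0 k) * \<kappa> n" for k
    proof -
      have "J' k \<le> lq q0 {k..} (\<lambda>j. ennreal (al0 j) * \<kappa> n)"
        unfolding J'_def by (intro lq_mono q0 mult_left_mono \<kappa>) auto
      also have "\<dots> \<le> Cd * ennreal (al0 k) * \<kappa> n"
        unfolding lq_multc[OF q0] by (intro mult_right_mono Cd) auto
      finally show ?thesis .
    qed
    have pt: "ennreal (al0 n) * \<kappa> n \<le> J k" if "k \<le> n" for k
      unfolding J_def using that by (intro lq_point[OF q0]) auto
    have left: "J' k \<le> Ca * (1 + Cd) * J k" if k: "k \<le> n" for k
    proof -
      have eq: "{k..} = {k..n} \<union> {n..}" using k by auto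
      have "J' k \<le> Ca * (lq q0 {k..n} (\<lambda>j. ennreal (al0 j) * \<kappa>' j) + J' n)"
        unfolding J'_def by (subst eq) (rule Ca)
      also have "\<dots> \<le> Ca * (J k + Cd * J k)"
      proof (intro mult_left_mono add_mono)
        show "lq q0 {k..n} (\<lambda>j. ennreal (al0 j) * \<kappa>' j) \<le> J k"
          unfolding J_def by (intro lq_mono q0 mult_left_mono \<kappa>) auto
        show "J' n \<le> Cd * J k"
          by (intro order_trans[OF tail]) (simp add: mult.assoc mult_left_mono pt k)
      qed auto
      finally show ?thesis by (simp add: distrib_left distrib_right mult.assoc)
    qed
    have 1: "lq r0 {..n} (\<lambda>k. ennreal (b0 k) * J' k) \<le> Ca * (1 + Cd) * I0 n \<kappa>"
      unfolding I0_def J_def[symmetric] lq_cmult[OF r0, symmetric]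
      by (intro lq_mono r0) (auto simp: mult.left_commute[of "Ca * (1 + Cd)"] intro!: mult_left_mono left)
    have "lq r0 {n..} (\<lambda>k. ennreal (b0 k) * J' k) \<le> lq r0 {n..} (\<lambda>k. Cd * \<kappa> n * ennreal (b0 k * al0 k))"
    proof (intro lq_mono r0)
      fix k
      have "ennreal (b0 k) * J' k \<le> ennreal (b0 k) * (Cd * ennreal (al0 k) * \<kappa> n)" by (intro mult_left_mono tail) auto
      then show "ennreal (b0 k) * J' k \<le> Cd * \<kappa> n * ennreal (b0 k * al0 k)"
        using pos(2)[of k] by (simp add: ennreal_mult' mult_ac)
    qed simp
    also have "\<dots> \<le> Cd * \<kappa> n * (Ce * ennreal (b0 n * al0 n))"
      unfolding lq_cmult[OF r0] by (intro mult_left_mono Ce) auto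
    also have "\<dots> = Cd * Ce * (ennreal (b0 n) * (ennreal (al0 n) * \<kappa> n))"
      using pos(2)[of n] by (simp add: ennreal_mult' mult_ac)
    also have "\<dots> \<le> Cd * Ce * I0 n \<kappa>"
    proof (intro mult_left_mono)
      have "ennreal (b0 n) * (ennreal (al0 n) * \<kappa> n) \<le> b0 n * J n" by (intro mult_left_mono pt) auto
      also have "\<dots> \<le> I0 n \<kappa>" unfolding I0_def J_def[symmetric] by (rule lq_point[OF r0]) simp
      finally show "ennreal (b0 n) * (ennreal (al0 n) * \<kappa> n) \<le> I0 n \<kappa>" .
    qed simp
    finally have 2: "lq r0 {n..} (\<lambda>k. ennreal (b0 k) * J' k) \<le> Cd * Ce * I0 n \<kappa>" .
    have "N0 \<kappa>' = lq r0 ({..n} \<union> {n..}) (\<lambda>k. ennreal (b0 k) * J' k)"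
      unfolding N0_def J'_def by (intro arg_cong2[where f = "lq r0"]) auto
    also have "\<dots> \<le> Cr * (lq r0 {..n} (\<lambda>k. ennreal (b0 k) * J' k) + lq r0 {n..} (\<lambda>k. ennreal (b0 k) * J' k))" by (rule Cr)
    also have "\<dots> \<le> Cr * (Ca * (1 + Cd) * I0 n \<kappa> + Cd * Ce * I0 n \<kappa>)"
      by (intro mult_left_mono add_mono 1 2) auto
    finally show ?thesis by (simp add: distrib_left distrib_right mult_ac)
  qed
  moreover have "Cr * (Ca * (1 + Cd) + Cd * Ce) < top"
    using Ca Cr Cd Ce by (simp add: ennreal_mult_less_top)
  ultimately show ?thesis by blast
qed

text \<open>\<kappa>' stands for the second component. Its linear bound up to n cancels the power in
  \<open>al1\<close> and leaves sums of a1 and b1 alone. These are the two summands of \<chi>1, the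
  first from outer indices k \<le> n and the second from k \<ge> n; hence the term
  \<open>M1\<close>.\<close>

lemma N1_truncated:
  "\<exists>C<top. \<forall>n \<kappa> \<kappa>'. (\<forall>j\<le>n. \<kappa>' j \<le> ennreal (exp (- L * real_of_int (n - j))) * \<kappa> n) \<longrightarrow> (\<forall>j\<ge>n. \<kappa>' j \<le> \<kappa> j)
     \<longrightarrow> N1 \<kappa>' \<le> C * (M1 n \<kappa> + I1 n \<kappa>)"
proof -
  obtain Ca where Ca: "Ca < top" "\<And>S T f. lq q1 (S \<union> T) f \<le> Ca * (lq q1 S f + lq q1 T f)"
    using lq_Un_le[OF q1] by blast
  obtain Cr where Cr: "Cr < top" "\<And>S T f. lq r1 (S \<union> T) f \<le> Cr * (lq r1 S f + lq r1 T f)"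
    using lq_Un_le[OF r1] by blast
  obtain Cb where Cb: "Cb < top" "\<And>S f g. lq r1 S (\<lambda>k. f k + g k) \<le> Cb * (lq r1 S f + lq r1 S g)"
    using lq_add_le[OF r1] by blast
  define S1 where "S1 n = lq r1 {..n} (\<lambda>k. ennreal (b1 k) * lq q1 {..k} a1)" for n
  define S2 where "S2 n = lq r1 {n..} b1 * lq q1 {..n} a1" for n
  obtain Cs where Cs: "Cs < top" "\<And>n. S1 n + S2 n \<le> Cs * ennreal (\<chi>1 n)"
    using dominatedE[OF \<chi>1_ge] unfolding S1_def S2_def by metis
  have "N1 \<kappa>' \<le> Cr * (Cs + Ca * Cb * (Cs + 1)) * (M1 n \<kappa> + I1 n \<kappa>)"
    if \<kappa>: "\<And>j. j \<le> n \<Longrightarrow> \<kappa>' j \<le> ennreal (exp (- L * real_of_int (n - j))) * \<kappa> n" "\<And>j. n \<le> j \<Longrightarrow> \<kappa>' j \<le> \<kappa> j" for n \<kappa> \<kappa>'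
  proof -
    define J where "J k = lq q1 {n..k} (\<lambda>j. ennreal (al1 j) * \<kappa> j)" for k
    define J' where "J' k = lq q1 {..k} (\<lambda>j. ennreal (al1 j) * \<kappa>' j)" for k
    \<comment> \<open>The slope \<kappa> n / x_n: for j \<le> n the bound on \<kappa>' j is e *
      x_j.\<close>
    define e where "e = ennreal (exp (- L * n)) * \<kappa> n"
    have eM: "e * (Cs * ennreal (\<chi>1 n)) = Cs * M1 n \<kappa>"
      unfolding e_def M1_split by (simp only: mult_ac)
    have head: "J' k \<le> e * lq q1 {..k} a1" if k: "k \<le> n" for k
    proof -
      have "J' k \<le> lq q1 {..k} (\<lambda>j. e * a1 j)"
        unfolding J'_def
      proof (intro lq_mono q1)
        fix j assume "j \<in> {..k}"
        then have "ennreal (al1 j) * \<kappa>' j \<le> ennreal (al1 j) * (ennreal (exp (- L * real_of_int (n - j))) * \<kappa> n)"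
          using k by (intro mult_left_mono \<kappa>) auto
        also have "\<dots> = ennreal (exp (- L * n) * a1 j) * \<kappa> n"
          using pos(3)[of j]
          by (subst ennreal_split[of _ "al1 j" "exp (- L * real_of_int (n - j))"])
             (auto simp: al1_def exp_add[symmetric] algebra_simps less_imp_le)
        finally show "ennreal (al1 j) * \<kappa>' j \<le> e * a1 j"
          unfolding e_def ennreal_mult'[OF exp_ge_zero] by (simp only: mult_ac)
      qed simp
      then show ?thesis by (simp add: lq_cmult[OF q1])
    qed
    have "lq r1 {..n} (\<lambda>k. ennreal (b1 k) * J' k) \<le> lq r1 {..n} (\<lambda>k. e * (ennreal (b1 k) * lq q1 {..k} a1))"
    proof (intro lq_mono r1)
      fix k assume "k \<in> {..n}"
      then have "ennreal (b1 k) * J' k \<le> ennreal (b1 k) * (e * lq q1 {..k} a1)" by (intro mult_left_mono head) auto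
      then show "ennreal (b1 k) * J' k \<le> e * (ennreal (b1 k) * lq q1 {..k} a1)" by (simp add: mult_ac)
    qed simp
    also have "\<dots> = e * S1 n" by (simp add: lq_cmult[OF r1] S1_def)
    also have "\<dots> \<le> e * (Cs * ennreal (\<chi>1 n))"
      by (intro mult_left_mono order_trans[OF _ Cs(2)]) auto
    finally have 1: "lq r1 {..n} (\<lambda>k. ennreal (b1 k) * J' k) \<le> Cs * M1 n \<kappa>" unfolding eM .
    have right: "J' k \<le> Ca * (e * lq q1 {..n} a1 + J k)" if k: "n \<le> k" for k
    proof -
      have eq: "{..k} = {..n} \<union> {n..k}" using k by auto
      have "J' k \<le> Ca * (J' n + lq q1 {n..k} (\<lambda>j. ennreal (al1 j) * \<kappa>' j))"
        unfolding J'_def by (subst eq) (rule Ca)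
      also have "\<dots> \<le> Ca * (e * lq q1 {..n} a1 + J k)"
      proof (intro mult_left_mono add_mono)
        show "J' n \<le> e * lq q1 {..n} a1" by (rule head) simp
        show "lq q1 {n..k} (\<lambda>j. ennreal (al1 j) * \<kappa>' j) \<le> J k"
          unfolding J_def by (intro lq_mono q1 mult_left_mono \<kappa>) auto
      qed auto
      finally show ?thesis .
    qed
    have "lq r1 {n..} (\<lambda>k. ennreal (b1 k) * J' k) \<le> lq r1 {n..} (\<lambda>k. Ca * (e * lq q1 {..n} a1 * b1 k + ennreal (b1 k) * J k))"
    proof (intro lq_mono r1)
      fix k assume "k \<in> {n..}"
      then have "ennreal (b1 k) * J' k \<le> ennreal (b1 k) * (Ca * (e * lq q1 {..n} a1 + J k))" by (intro mult_left_mono right) auto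
      then show "ennreal (b1 k) * J' k \<le> Ca * (e * lq q1 {..n} a1 * b1 k + ennreal (b1 k) * J k)"
        by (simp add: distrib_left mult_ac)
    qed simp
    also have "\<dots> \<le> Ca * (Cb * (e * S2 n + I1 n \<kappa>))"
    proof -
      have eq: "lq r1 {n..} (\<lambda>k. e * lq q1 {..n} a1 * b1 k) = e * S2 n"
        unfolding lq_cmult[OF r1] S2_def by (simp only: mult_ac)
      have "lq r1 {n..} (\<lambda>k. e * lq q1 {..n} a1 * b1 k + b1 k * J k) \<le> Cb * (e * S2 n + I1 n \<kappa>)"
        using Cb(2)[of "{n..}" "\<lambda>k. e * lq q1 {..n} a1 * b1 k" "\<lambda>k. b1 k * J k"]
        unfolding I1_def J_def[symmetric] eq .
      then show ?thesis unfolding lq_cmult[OF r1, of _ Ca] by (intro mult_left_mono) auto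
    qed
    also have "\<dots> \<le> Ca * (Cb * (e * (Cs * ennreal (\<chi>1 n)) + I1 n \<kappa>))"
      by (intro mult_left_mono add_mono order_trans[OF _ Cs(2)]) auto
    finally have 2: "lq r1 {n..} (\<lambda>k. ennreal (b1 k) * J' k) \<le> Ca * (Cb * (Cs * M1 n \<kappa> + I1 n \<kappa>))" unfolding eM .
    let ?X = "M1 n \<kappa> + I1 n \<kappa>"
    have "N1 \<kappa>' = lq r1 ({..n} \<union> {n..}) (\<lambda>k. ennreal (b1 k) * J' k)"
      unfolding N1_def J'_def by (intro arg_cong2[where f = "lq r1"]) auto
    also have "\<dots> \<le> Cr * (lq r1 {..n} (\<lambda>k. ennreal (b1 k) * J' k) + lq r1 {n..} (\<lambda>k. ennreal (b1 k) * J' k))" by (rule Cr)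
    also have "\<dots> \<le> Cr * (Cs * M1 n \<kappa> + Ca * (Cb * (Cs * M1 n \<kappa> + I1 n \<kappa>)))"
      by (intro mult_left_mono add_mono 1 2) auto
    also have "\<dots> \<le> Cr * (Cs * ?X + Ca * (Cb * (Cs * ?X + 1 * ?X)))"
      by (intro mult_left_mono add_mono) auto
    finally show ?thesis by (simp add: distrib_left distrib_right mult_ac add_ac)
  qed
  moreover have "Cr * (Cs + Ca * Cb * (Cs + 1)) < top"
    using Ca Cr Cb Cs by (simp add: ennreal_mult_less_top)
  ultimately show ?thesis by blast
qed

text \<open>For j \<le> n the quotient \<kappa> j / x_j is at least its value e at n. Restricting
  the outer index to k \<le> n, or to k \<ge> n with inner range {..n}, bounds e times each summand
  of \<chi>1 by \<open>N1\<close>.\<close>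

lemma M1_le_N1:
  "\<exists>C<top. \<forall>n \<kappa>. (\<forall>j\<le>n. ennreal (exp (- L * n)) * \<kappa> n \<le> ennreal (exp (- L * j)) * \<kappa> j) \<longrightarrow> M1 n \<kappa> \<le> C * N1 \<kappa>"
proof -
  define S1 where "S1 n = lq r1 {..n} (\<lambda>k. ennreal (b1 k) * lq q1 {..k} a1)" for n
  define S2 where "S2 n = lq r1 {n..} b1 * lq q1 {..n} a1" for n
  obtain C where C: "C < top" "\<And>n. ennreal (\<chi>1 n) \<le> C * (S1 n + S2 n)"
    using dominatedE[OF \<chi>1_le] unfolding S1_def S2_def by metis
  have "M1 n \<kappa> \<le> C * 2 * N1 \<kappa>"
    if \<kappa>: "\<And>j. j \<le> n \<Longrightarrow> ennreal (exp (- L * n)) * \<kappa> n \<le> ennreal (exp (- L * j)) * \<kappa> j" for n \<kappa>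
  proof -
    define e where "e = ennreal (exp (- L * n)) * \<kappa> n"
    have le: "e * a1 j \<le> ennreal (al1 j) * \<kappa> j" if "j \<le> n" for j
      using mult_right_mono[OF \<kappa>[OF that] zero_le, of "ennreal (a1 j)"] by (simp only: e_def ennreal_al1 mult_ac)
    have "e * S1 n = lq r1 {..n} (\<lambda>k. ennreal (b1 k) * lq q1 {..k} (\<lambda>j. e * a1 j))"
      unfolding S1_def by (simp add: lq_cmult[OF q1] lq_cmult[OF r1] mult.left_commute[of _ e])
    also have "\<dots> \<le> N1 \<kappa>"
      unfolding N1_def by (intro lq_mono r1 mult_left_mono q1 le) auto
    finally have 1: "e * S1 n \<le> N1 \<kappa>" .
    have "e * S2 n = lq r1 {n..} (\<lambda>k. ennreal (b1 k) * lq q1 {..n} (\<lambda>j. e * a1 j))"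
      unfolding S2_def lq_cmult[OF q1] lq_multc[OF r1] by (simp only: mult_ac)
    also have "\<dots> \<le> N1 \<kappa>"
      unfolding N1_def by (intro lq_mono r1 mult_left_mono q1 le) auto
    finally have 2: "e * S2 n \<le> N1 \<kappa>" .
    have "M1 n \<kappa> = e * ennreal (\<chi>1 n)" unfolding e_def M1_split by (simp only: mult_ac)
    also have "\<dots> \<le> e * (C * (S1 n + S2 n))" by (intro mult_left_mono C) auto
    also have "\<dots> = C * (e * S1 n + e * S2 n)" by (simp add: distrib_left mult_ac)
    also have "\<dots> \<le> C * (N1 \<kappa> + N1 \<kappa>)" by (intro mult_left_mono add_mono 1 2) auto
    finally show ?thesis by (simp add: mult_2 mult.assoc)
  qed
  moreover have "C * 2 < top" using C by (simp add: ennreal_mult_less_top)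
  ultimately show ?thesis by blast
qed

text \<open>A bound m on \<open>M1\<close> says \<kappa> j \<le> m x_j / \<chi>1 j. Inserted into
  \<open>I0\<close> this leaves the exponent 1 - \<theta>0 > 0, so the last index dominates and
  yields rho n.\<close>

lemma I0_le_of_M1:
  "\<exists>C<top. \<forall>n m \<kappa>. (\<forall>j. M1 j \<kappa> \<le> m) \<longrightarrow> I0 n \<kappa> \<le> C * (ennreal (rho n) * m)"
proof -
  define y where "y j = exp ((1 - \<theta>0) * L * j) * (a0 j / \<chi>1 j)" for j
  have "inc_seq y"
    using \<theta>0 L by (intro inc_seqI[OF sv_seq_divide[OF a0 \<chi>1], of "(1 - \<theta>0) * L"]) (auto simp: y_def)
  then obtain C where C: "C < top" "\<And>n m \<kappa>. (\<forall>j\<le>n. ennreal (al0 j) * \<kappa> j \<le> m * ennreal (y j)) \<Longrightarrow> I0 n \<kappa> \<le> C * (m * ennreal (y n * (\<chi>0 n / a0 n)))"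
    using left.I_bound unfolding I0_eq by blast
  have "I0 n \<kappa> \<le> C * (ennreal (rho n) * m)" if m: "\<forall>j. M1 j \<kappa> \<le> m" for n m \<kappa>
  proof -
    have yr: "y n * (\<chi>0 n / a0 n) = rho n" using pos(1)[of n] by (simp add: y_def rho_def)
    have "ennreal (al0 j) * \<kappa> j \<le> m * ennreal (y j)" for j
    proof -
      have "exp ((1 - \<theta>0) * L * j) * exp (- L * j) = exp (- \<theta>0 * L * j)"
        by (simp flip: exp_add add: algebra_simps)
      then have "al0 j = y j * (exp (- L * j) * \<chi>1 j)"
        using pos(6)[of j] by (simp add: y_def al0_def)
      then have "ennreal (al0 j) * \<kappa> j = y j * M1 j \<kappa>"
        unfolding M1_def using pos(1)[of j] pos(6)[of j] by (intro ennreal_split) (auto simp: y_def)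
      also have "\<dots> \<le> ennreal (y j) * m" using m by (intro mult_left_mono) auto
      finally show ?thesis by (simp add: mult.commute)
    qed
    then have "I0 n \<kappa> \<le> C * (m * ennreal (y n * (\<chi>0 n / a0 n)))" by (intro C) auto
    then show ?thesis by (simp only: yr mult.commute)
  qed
  then show ?thesis using C(1) by blast
qed

text \<open>The mirror image: a bound on \<open>M0\<close> inserted into \<open>I1\<close> leaves
  the exponent -(1 - \<theta>0) < 0, so the first index dominates and yields 1 / rho n.\<close>

lemma I1_le_of_M0:
  "\<exists>C<top. \<forall>n m \<kappa>. (\<forall>j. M0 j \<kappa> \<le> m) \<longrightarrow> rho n * I1 n \<kappa> \<le> C * m"
proof -
  define y where "y j = exp (- (1 - \<theta>0) * L * j) * (a1 j / \<chi>0 j)" for j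
  have "dec_seq y"
    using \<theta>0 L by (intro dec_seqI[OF sv_seq_divide[OF a1 \<chi>0], of "- (1 - \<theta>0) * L"])
      (auto simp: y_def mult_less_0_iff)
  from right.I_bound[OF this[unfolded dec_seq_def]] obtain C where C: "C < top"
    "\<And>n m \<kappa>. (\<forall>j\<le>n. ennreal (al1 (- j)) * \<kappa> j \<le> m * ennreal (y (- j))) \<Longrightarrow>
      right.I n \<kappa> \<le> C * (m * ennreal (y (- n) * (\<chi>1 (- n) / a1 (- n))))"
    by blast
  have "rho n * I1 n \<kappa> \<le> C * m" if m: "\<forall>j. M0 j \<kappa> \<le> m" for n m \<kappa>
  proof -
    have "exp ((1 - \<theta>0) * L * n) * exp (- (1 - \<theta>0) * L * n) = 1"
      by (simp flip: exp_add add: algebra_simps)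
    then have yr: "rho n * (y n * (\<chi>1 n / a1 n)) = 1"
      using pos(3)[of n] pos(5)[of n] pos(6)[of n] by (simp add: y_def rho_def)
    have yr': "ennreal (rho n) * ennreal (y n * (\<chi>1 n / a1 n)) = 1"
      using rho_pos[of n] by (subst ennreal_mult'[symmetric]) (simp_all only: yr less_imp_le ennreal_1)
    have "ennreal (al1 j) * \<kappa> j \<le> m * ennreal (y j)" for j
    proof -
      have "exp (- (1 - \<theta>0) * L * j) * exp (- \<theta>0 * L * j) = exp (- L * j)"
        by (simp flip: exp_add add: algebra_simps)
      then have "al1 j = y j * (exp (- \<theta>0 * L * j) * \<chi>0 j)"
        using pos(5)[of j] by (simp add: y_def al1_def)
      then have "ennreal (al1 j) * \<kappa> j = y j * M0 j \<kappa>"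
        unfolding M0_def using pos(3)[of j] pos(5)[of j] by (intro ennreal_split) (auto simp: y_def)
      also have "\<dots> \<le> ennreal (y j) * m" using m by (intro mult_left_mono) auto
      finally show ?thesis by (simp add: mult.commute)
    qed
    then have "I1 n \<kappa> \<le> C * (m * ennreal (y n * (\<chi>1 n / a1 n)))"
      unfolding I1_eq using C(2)[of "- n" "\<lambda>j. \<kappa> (- j)" m] by simp
    then have "rho n * I1 n \<kappa> \<le> rho n * (C * (m * ennreal (y n * (\<chi>1 n / a1 n))))" by (intro mult_left_mono) auto
    also have "\<dots> = C * m * (ennreal (rho n) * ennreal (y n * (\<chi>1 n / a1 n)))" by (simp only: mult_ac)
    finally show ?thesis by (simp only: yr' mult_1_right)
  qed
  then show ?thesis using C(1) by blast
qed

lemma M0_eq: "M0 n \<kappa> = left.M n \<kappa>"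
  using pos(1)[of n] by (simp add: M0_def left.M_def al0_def)

lemma M1_eq: "M1 n \<kappa> = right.M (- n) (\<lambda>j. \<kappa> (- j))"
  using pos(3)[of n] right.M_def[of "- n" "\<lambda>j. \<kappa> (- j)"] by (simp add: M1_def al1_def)

lemma hardy_left:
  assumes "dec_seq \<omega>" "0 < p"
  shows "\<exists>C<top. \<forall>\<kappa>. lq p UNIV (\<lambda>n. \<omega> n * I0 n \<kappa>) \<le> C * lq p UNIV (\<lambda>n. \<omega> n * M0 n \<kappa>)"
  using left.hardy[OF assms] unfolding I0_eq M0_eq .

lemma hardy_right:
  assumes "inc_seq \<omega>" and p: "0 < p"
  shows "\<exists>C<top. \<forall>\<kappa>. lq p UNIV (\<lambda>n. \<omega> n * I1 n \<kappa>) \<le> C * lq p UNIV (\<lambda>n. \<omega> n * M1 n \<kappa>)"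
proof -
  have "dec_seq (\<lambda>n. \<omega> (- n))" using assms(1) by (simp add: dec_seq_def)
  from right.hardy[OF this p] obtain C where C: "C < top"
    "\<forall>\<kappa>. lq p UNIV (\<lambda>n. \<omega> (- n) * right.I n \<kappa>) \<le> C * lq p UNIV (\<lambda>n. \<omega> (- n) * right.M n \<kappa>)" by blast
  have "lq p UNIV (\<lambda>n. \<omega> n * I1 n \<kappa>) \<le> C * lq p UNIV (\<lambda>n. \<omega> n * M1 n \<kappa>)" for \<kappa>
    using C(2)[rule_format, of "\<lambda>j. \<kappa> (- j)"]
      lq_reflect[OF p, of UNIV "\<lambda>n. \<omega> n * I1 n \<kappa>"] lq_reflect[OF p, of UNIV "\<lambda>n. \<omega> n * M1 n \<kappa>"]
    by (simp add: I1_eq M1_eq surj_uminus)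
  then show ?thesis using C(1) by blast
qed

text \<open>The first two conclusions are stated separately because they give finiteness, hence
  membership of the two components; the third is the estimate itself. The extra \<open>M1\<close>
  disappears there since rho n * M1 = M0 is bounded by \<open>I0\<close>.\<close>

lemma split_upper:
  "\<exists>C<top. \<forall>n \<kappa> \<kappa>0 \<kappa>1. (\<forall>j. \<kappa>0 j \<le> \<kappa> n) \<longrightarrow> (\<forall>j\<le>n. \<kappa>0 j \<le> \<kappa> j) \<longrightarrow>
     (\<forall>j\<le>n. \<kappa>1 j \<le> ennreal (exp (- L * real_of_int (n - j))) * \<kappa> n) \<longrightarrow> (\<forall>j\<ge>n. \<kappa>1 j \<le> \<kappa> j) \<longrightarrow>
     N0 \<kappa>0 \<le> C * I0 n \<kappa> \<and> N1 \<kappa>1 \<le> C * (M1 n \<kappa> + I1 n \<kappa>) \<and>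
     N0 \<kappa>0 + rho n * N1 \<kappa>1 \<le> C * (I0 n \<kappa> + rho n * I1 n \<kappa>)"
proof -
  obtain C where C: "C < top" "\<forall>n \<kappa> \<kappa>'. (\<forall>j. \<kappa>' j \<le> \<kappa> n) \<longrightarrow> (\<forall>j\<le>n. \<kappa>' j \<le> \<kappa> j) \<longrightarrow> N0 \<kappa>' \<le> C * I0 n \<kappa>"
    using N0_truncated by (elim exE conjE)
  obtain D where D: "D < top" "\<forall>n \<kappa> \<kappa>'. (\<forall>j\<le>n. \<kappa>' j \<le> ennreal (exp (- L * real_of_int (n - j))) * \<kappa> n) \<longrightarrow> (\<forall>j\<ge>n. \<kappa>' j \<le> \<kappa> j)
     \<longrightarrow> N1 \<kappa>' \<le> D * (M1 n \<kappa> + I1 n \<kappa>)"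
    using N1_truncated by (elim exE conjE)
  obtain E where E: "E < top" "\<forall>n \<kappa>. M0 n \<kappa> \<le> E * I0 n \<kappa>"
    using M0_le_I0 by (elim exE conjE)
  note C = C(1) C(2)[rule_format] and D = D(1) D(2)[rule_format] and E = E(1) E(2)[rule_format]
  show ?thesis
  proof (intro exI[of _ "C + D * E + D"] conjI allI impI)
    show "C + D * E + D < top" using C D E by (simp add: ennreal_mult_less_top)
    fix n \<kappa> \<kappa>0 \<kappa>1
    assume 0: "\<forall>j. \<kappa>0 j \<le> \<kappa> n" "\<forall>j\<le>n. \<kappa>0 j \<le> \<kappa> j"
      and 1: "\<forall>j\<le>n. \<kappa>1 j \<le> ennreal (exp (- L * real_of_int (n - j))) * \<kappa> n" "\<forall>j\<ge>n. \<kappa>1 j \<le> \<kappa> j"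
    have N0: "N0 \<kappa>0 \<le> C * I0 n \<kappa>" using 0 by (intro C) auto
    then show "N0 \<kappa>0 \<le> (C + D * E + D) * I0 n \<kappa>" by (rule order_trans) (intro mult_right_mono, auto simp: add_increasing2)
    have N1: "N1 \<kappa>1 \<le> D * (M1 n \<kappa> + I1 n \<kappa>)" using 1 by (intro D) auto
    then show "N1 \<kappa>1 \<le> (C + D * E + D) * (M1 n \<kappa> + I1 n \<kappa>)" by (rule order_trans) (intro mult_right_mono, auto simp: add_increasing2 add_increasing)
    have "rho n * N1 \<kappa>1 \<le> rho n * (D * (M1 n \<kappa> + I1 n \<kappa>))" by (intro mult_left_mono N1) auto
    also have "\<dots> = D * (rho n * M1 n \<kappa> + rho n * I1 n \<kappa>)" by (simp only: distrib_left mult_ac)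
    also have "\<dots> \<le> D * (E * I0 n \<kappa> + rho n * I1 n \<kappa>)"
      unfolding rho_M1 by (intro mult_left_mono add_mono E) auto
    finally have "N0 \<kappa>0 + rho n * N1 \<kappa>1 \<le> C * I0 n \<kappa> + D * (E * I0 n \<kappa> + rho n * I1 n \<kappa>)"
      by (intro add_mono N0)
    also have "\<dots> = (C + D * E) * I0 n \<kappa> + D * (rho n * I1 n \<kappa>)"
      by (simp only: distrib_left distrib_right add_ac mult_ac)
    also have "\<dots> \<le> (C + D * E + D) * I0 n \<kappa> + (C + D * E + D) * (rho n * I1 n \<kappa>)"
      by (rule add_mono; rule mult_right_mono) (auto simp: add_increasing2 add_increasing)
    finally show "N0 \<kappa>0 + rho n * N1 \<kappa>1 \<le> (C + D * E + D) * (I0 n \<kappa> + rho n * I1 n \<kappa>)"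
      by (simp only: distrib_left)
  qed
qed

text \<open>Each component is harmless in its own norm; the work lies in the cross terms.
  \<open>I0\<close> of \<kappa>1 is controlled by the supremum of \<open>M1\<close>, hence by
  \<open>N1\<close>, where the monotone quotients of \<kappa>1 enter; \<open>I1\<close> of \<kappa>0
  is controlled by the supremum of \<open>M0\<close>, hence by \<open>N0\<close>.\<close>

lemma split_lower:
  "\<exists>C<top. \<forall>n \<kappa>0 \<kappa>1. (\<forall>j k. j \<le> k \<longrightarrow> ennreal (exp (- L * k)) * \<kappa>1 k \<le> ennreal (exp (- L * j)) * \<kappa>1 j) \<longrightarrow>
     I0 n (\<lambda>j. \<kappa>0 j + \<kappa>1 j) + rho n * I1 n (\<lambda>j. \<kappa>0 j + \<kappa>1 j) \<le> C * (N0 \<kappa>0 + rho n * N1 \<kappa>1)"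
proof -
  obtain C where C: "C < top" "\<forall>n \<kappa> \<kappa>'. I0 n (\<lambda>j. \<kappa> j + \<kappa>' j) \<le> C * (I0 n \<kappa> + I0 n \<kappa>')"
    using I0_add by (elim exE conjE)
  obtain D where D: "D < top" "\<forall>n \<kappa> \<kappa>'. I1 n (\<lambda>j. \<kappa> j + \<kappa>' j) \<le> D * (I1 n \<kappa> + I1 n \<kappa>')"
    using I1_add by (elim exE conjE)
  obtain E where E: "E < top" "\<forall>n \<kappa>. M0 n \<kappa> \<le> E * I0 n \<kappa>"
    using M0_le_I0 by (elim exE conjE)
  obtain F where F: "F < top" "\<forall>n \<kappa>. (\<forall>j\<le>n. ennreal (exp (- L * n)) * \<kappa> n \<le> ennreal (exp (- L * j)) * \<kappa> j) \<longrightarrow> M1 n \<kappa> \<le> F * N1 \<kappa>"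
    using M1_le_N1 by (elim exE conjE)
  obtain G where G: "G < top" "\<forall>n m \<kappa>. (\<forall>j. M1 j \<kappa> \<le> m) \<longrightarrow> I0 n \<kappa> \<le> G * (ennreal (rho n) * m)"
    using I0_le_of_M1 by (elim exE conjE)
  obtain H where H: "H < top" "\<forall>n m \<kappa>. (\<forall>j. M0 j \<kappa> \<le> m) \<longrightarrow> rho n * I1 n \<kappa> \<le> H * m"
    using I1_le_of_M0 by (elim exE conjE)
  note C = C(1) C(2)[rule_format] and D = D(1) D(2)[rule_format] and E = E(1) E(2)[rule_format]
    and F = F(1) F(2)[rule_format] and G = G(1) G(2)[rule_format] and H = H(1) H(2)[rule_format]
  let ?c = "C * (1 + G * F) + D * (H * E + 1)"
  show ?thesis
  proof (intro exI[of _ ?c] conjI allI impI)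
    show "?c < top" using C D E F G H by (simp add: ennreal_mult_less_top)
    fix n \<kappa>0 \<kappa>1
    assume \<kappa>1: "\<forall>j k. j \<le> k \<longrightarrow> ennreal (exp (- L * real_of_int k)) * \<kappa>1 k \<le> ennreal (exp (- L * real_of_int j)) * \<kappa>1 j"
    let ?R = "rho n * N1 \<kappa>1"
    have a: "I0 n \<kappa>1 \<le> G * F * ?R"
    proof -
      have "I0 n \<kappa>1 \<le> G * (ennreal (rho n) * (F * N1 \<kappa>1))" using \<kappa>1 by (intro G F) auto
      then show ?thesis by (simp only: mult_ac)
    qed
    have b: "rho n * I1 n \<kappa>0 \<le> H * E * N0 \<kappa>0"
    proof -
      have "M0 j \<kappa>0 \<le> E * N0 \<kappa>0" for j by (intro order_trans[OF E(2)] mult_left_mono I0_le_N0) auto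
      then have "rho n * I1 n \<kappa>0 \<le> H * (E * N0 \<kappa>0)" by (intro H) auto
      then show ?thesis by (simp only: mult_ac)
    qed
    have 1: "I0 n (\<lambda>j. \<kappa>0 j + \<kappa>1 j) \<le> C * (1 * N0 \<kappa>0 + G * F * ?R)"
      by (rule order_trans[OF C(2)], intro mult_left_mono add_mono a) (use I0_le_N0 in auto)
    have "rho n * I1 n (\<lambda>j. \<kappa>0 j + \<kappa>1 j) \<le> rho n * (D * (I1 n \<kappa>0 + I1 n \<kappa>1))"
      by (intro mult_left_mono D) auto
    also have "\<dots> = D * (rho n * I1 n \<kappa>0 + rho n * I1 n \<kappa>1)" by (simp only: distrib_left mult_ac)
    also have "\<dots> \<le> D * (H * E * N0 \<kappa>0 + 1 * ?R)"
      by (intro mult_left_mono add_mono b) (auto intro!: mult_left_mono I1_le_N1)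
    finally have 2: "rho n * I1 n (\<lambda>j. \<kappa>0 j + \<kappa>1 j) \<le> D * (H * E * N0 \<kappa>0 + 1 * ?R)" .
    have mono: "u * x + v * y \<le> (u + v) * (x + y)" for u v x y :: ennreal
      unfolding distrib_left distrib_right by (intro add_mono) (auto simp: add_increasing add_increasing2)
    have "I0 n (\<lambda>j. \<kappa>0 j + \<kappa>1 j) + rho n * I1 n (\<lambda>j. \<kappa>0 j + \<kappa>1 j)
       \<le> C * ((1 + G * F) * (N0 \<kappa>0 + ?R)) + D * ((H * E + 1) * (N0 \<kappa>0 + ?R))"
      by (rule add_mono[OF order_trans[OF 1 mult_left_mono[OF mono]] order_trans[OF 2 mult_left_mono[OF mono]]]) auto
    then show "I0 n (\<lambda>j. \<kappa>0 j + \<kappa>1 j) + rho n * I1 n (\<lambda>j. \<kappa>0 j + \<kappa>1 j) \<le> ?c * (N0 \<kappa>0 + ?R)"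
      by (simp only: distrib_right[of _ _ "N0 \<kappa>0 + ?R"] mult.assoc)
  qed
qed

end

section \<open>Sampled functions\<close>

context grid
begin

lemma Lq_lower_multD:
  assumes C: "Lq_lower q C" "0 < q" and T: "T \<in> sets lebesgue" "(\<Union>k\<in>S. {exp (z k)<..<exp (z (k + 1))}) \<subseteq> T"
    and c: "c < top" "\<And>k u. k \<in> S \<Longrightarrow> exp (z k) < u \<Longrightarrow> u < exp (z (k + 1)) \<Longrightarrow> G k \<le> c * g u"
  shows "lq q S G \<le> (c + 1) * C * Lq_norm q T (\<lambda>u. ennreal (u powr (- recip q)) * g u)"
proof -
  \<comment> \<open>Passing to c + 1 makes the factor positive, hence invertible, even if c =
    0.\<close>
  obtain d where d: "c + 1 = ennreal d" "0 < d"
    using that[of "enn2real c + 1"] c(1) by (simp add: ennreal_plus add_nonneg_pos)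
  have inv: "ennreal (1 / d) * ennreal d = 1" "ennreal d * ennreal (1 / d) = 1"
    using d(2) by (simp_all flip: ennreal_mult')
  have "lq q S (\<lambda>k. ennreal (1 / d) * G k) \<le> C * Lq_norm q T (\<lambda>u. ennreal (u powr (- recip q)) * g u)"
  proof (rule Lq_lowerD[OF C(1) T])
    fix k u assume "k \<in> S" "exp (z k) < u" "u < exp (z (k + 1))"
    then have "G k \<le> (c + 1) * g u"
      by (rule order_trans[OF c(2) mult_right_mono]) auto
    then have "ennreal (1 / d) * G k \<le> ennreal (1 / d) * (ennreal d * g u)" unfolding d(1) by (intro mult_left_mono) auto
    then show "ennreal (1 / d) * G k \<le> g u" by (simp only: mult.assoc[symmetric] inv mult_1_left)
  qed
  then have "ennreal d * (ennreal (1 / d) * lq q S G) \<le> ennreal d * (C * Lq_norm q T (\<lambda>u. ennreal (u powr (- recip q)) * g u))"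
    unfolding lq_cmult[OF C(2)] by (intro mult_left_mono) auto
  then show ?thesis by (simp only: mult.assoc[symmetric] inv mult_1_left d(1))
qed

text \<open>Cells are closed: each grid point lies in two of them, which makes neighbouring samples
  comparable. The parameter p runs over a family of functions, usually indexed by f, with a common
  constant.\<close>

definition sampled_const :: "'p set \<Rightarrow> ('p \<Rightarrow> real \<Rightarrow> ennreal) \<Rightarrow> ('p \<Rightarrow> int \<Rightarrow> ennreal) \<Rightarrow> ennreal \<Rightarrow> bool" where
  "sampled_const P g G C \<longleftrightarrow> (\<forall>p\<in>P. \<forall>k u. exp (z k) \<le> u \<longrightarrow> u \<le> exp (z (k + 1)) \<longrightarrow>
     g p u \<le> C * G p k \<and> G p k \<le> C * g p u)"

definition sampled :: "'p set \<Rightarrow> ('p \<Rightarrow> real \<Rightarrow> ennreal) \<Rightarrow> ('p \<Rightarrow> int \<Rightarrow> ennreal) \<Rightarrow> bool" where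
  "sampled P g G \<longleftrightarrow> (\<exists>C<top. sampled_const P g G C)"

lemma sampled_constD:
  assumes "sampled_const P g G C" "p \<in> P" "exp (z k) \<le> u" "u \<le> exp (z (k + 1))"
  shows "g p u \<le> C * G p k" "G p k \<le> C * g p u"
  using assms unfolding sampled_const_def by auto

lemma sampledE:
  assumes "sampled P g G" obtains C where "C < top" "sampled_const P g G C"
  using assms unfolding sampled_def by blast

lemma sampledI:
  assumes "C < top" "D < top"
    and "\<And>p k u. p \<in> P \<Longrightarrow> exp (z k) \<le> u \<Longrightarrow> u \<le> exp (z (k + 1)) \<Longrightarrow> g p u \<le> C * G p k"
    and "\<And>p k u. p \<in> P \<Longrightarrow> exp (z k) \<le> u \<Longrightarrow> u \<le> exp (z (k + 1)) \<Longrightarrow> G p k \<le> D * g p u"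
  shows "sampled P g G"
  unfolding sampled_def sampled_const_def
proof (intro exI[of _ "C + D"] conjI ballI allI impI)
  show "C + D < top" using assms by simp
  fix p k u assume *: "p \<in> P" "exp (z k) \<le> u" "u \<le> exp (z (k + 1))"
  show "g p u \<le> (C + D) * G p k" by (rule order_trans[OF assms(3)[OF *] mult_right_mono]) auto
  show "G p k \<le> (C + D) * g p u" by (rule order_trans[OF assms(4)[OF *] mult_right_mono]) auto
qed

lemma sampled_mult:
  assumes "sampled P g G" "sampled P h H"
  shows "sampled P (\<lambda>p u. g p u * h p u) (\<lambda>p k. G p k * H p k)"
proof -
  obtain C where C: "C < top" and C': "sampled_const P g G C"
    using sampledE[OF assms(1)] .
  note C = C sampled_constD[OF C']
  obtain D where D: "D < top" and D': "sampled_const P h H D"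
    using sampledE[OF assms(2)] .
  note D = D sampled_constD[OF D']
  have CD: "C * D < top" using C D by (simp add: ennreal_mult_less_top)
  show ?thesis
  proof (rule sampledI[OF CD CD])
    fix p k u assume *: "p \<in> P" "exp (z k) \<le> u" "u \<le> exp (z (k + 1))"
    show "g p u * h p u \<le> C * D * (G p k * H p k)"
      using mult_mono[OF C(2)[OF *] D(2)[OF *]] by (simp add: mult_ac)
    show "G p k * H p k \<le> C * D * (g p u * h p u)"
      using mult_mono[OF C(3)[OF *] D(3)[OF *]] by (simp add: mult_ac)
  qed
qed

lemma sampled_add:
  assumes "sampled P g G" "sampled P h H"
  shows "sampled P (\<lambda>p u. g p u + h p u) (\<lambda>p k. G p k + H p k)"
proof -
  obtain C where C: "C < top" and C': "sampled_const P g G C"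
    using sampledE[OF assms(1)] .
  note C = C sampled_constD[OF C']
  obtain D where D: "D < top" and D': "sampled_const P h H D"
    using sampledE[OF assms(2)] .
  note D = D sampled_constD[OF D']
  have *: "x + y \<le> (C + D) * (a + b)" if "x \<le> C * a" "y \<le> D * b" for x y a b
  proof -
    have "x + y \<le> C * a + D * b" using that by (intro add_mono)
    also have "\<dots> \<le> (C + D) * a + (C + D) * b" by (intro add_mono mult_right_mono) auto
    finally show ?thesis by (simp add: distrib_left)
  qed
  have CD: "C + D < top" using C D by simp
  show ?thesis by (rule sampledI[OF CD CD]) (intro * C D; assumption)+
qed

lemma sampled_step:
  assumes "sampled P g G"
  obtains C where "C < top" "\<And>p k. p \<in> P \<Longrightarrow> G p (k + 1) \<le> C * G p k" "\<And>p k. p \<in> P \<Longrightarrow> G p k \<le> C * G p (k + 1)"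
proof -
  obtain C where C: "C < top" and C': "sampled_const P g G C"
    using sampledE[OF assms] .
  note C = C sampled_constD[OF C']
  have le: "exp (z k) \<le> exp (z (k + 1))" for k by (simp add: z_le_iff)
  have "G p (k + 1) \<le> C * C * G p k" "G p k \<le> C * C * G p (k + 1)" if "p \<in> P" for p k
  proof -
    have "G p (k + 1) \<le> C * g p (exp (z (k + 1)))" by (rule C(3)[OF that order_refl le])
    also have "\<dots> \<le> C * (C * G p k)" by (intro mult_left_mono C(2)[OF that le order_refl]) auto
    finally show "G p (k + 1) \<le> C * C * G p k" by (simp add: mult.assoc)
    have "G p k \<le> C * g p (exp (z (k + 1)))" by (rule C(3)[OF that le order_refl])
    also have "\<dots> \<le> C * (C * G p (k + 1))" by (intro mult_left_mono C(2)[OF that order_refl le]) auto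
    finally show "G p k \<le> C * C * G p (k + 1)" by (simp add: mult.assoc)
  qed
  then show ?thesis using C(1) by (intro that[of "C * C"]) (auto simp: ennreal_mult_less_top)
qed

lemma sampled_at_points:
  assumes "sampled P g G"
  shows "sampled P g (\<lambda>p k. g p (exp (z k)))"
proof -
  obtain C where C: "C < top" and C': "sampled_const P g G C"
    using sampledE[OF assms] .
  note C = C sampled_constD[OF C']
  have CC: "C * C < top" using C by (simp add: ennreal_mult_less_top)
  have le: "exp (z k) \<le> exp (z (k + 1))" for k by (simp add: z_le_iff)
  show ?thesis
  proof (rule sampledI[OF CC CC])
    fix p k u assume *: "p \<in> P" "exp (z k) \<le> u" "u \<le> exp (z (k + 1))"
    show "g p u \<le> C * C * g p (exp (z k))"
      unfolding mult.assoc by (intro order_trans[OF C(2)[OF *]] mult_left_mono C(3)) (use * le in auto)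
    show "g p (exp (z k)) \<le> C * C * g p u"
      unfolding mult.assoc by (intro order_trans[OF C(2)[of p k "exp (z k)"]] mult_left_mono C(3)) (use * le in auto)
  qed
qed

text \<open>S has to contain every cell meeting T, whereas in \<open>sampled_lower\<close> it
  consists of cells inside T. The two together bracket intervals that end in the middle of a
  cell.\<close>

definition sampled_upper :: "ennreal \<Rightarrow> 'p set \<Rightarrow> ('p \<Rightarrow> real \<Rightarrow> ennreal) \<Rightarrow> ('p \<Rightarrow> int \<Rightarrow> ennreal) \<Rightarrow> ennreal \<Rightarrow> bool" where
  "sampled_upper q P g G C \<longleftrightarrow> (\<forall>p\<in>P. \<forall>S T. T \<in> sets lebesgue \<longrightarrow> T \<subseteq> {0<..} \<longrightarrow>
     (\<forall>u\<in>T. \<forall>k. exp (z k) \<le> u \<longrightarrow> u < exp (z (k + 1)) \<longrightarrow> k \<in> S) \<longrightarrow>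
     Lq_norm q T (\<lambda>u. ennreal (u powr (- recip q)) * g p u) \<le> C * lq q S (G p))"

definition sampled_lower :: "ennreal \<Rightarrow> 'p set \<Rightarrow> ('p \<Rightarrow> real \<Rightarrow> ennreal) \<Rightarrow> ('p \<Rightarrow> int \<Rightarrow> ennreal) \<Rightarrow> ennreal \<Rightarrow> bool" where
  "sampled_lower q P g G C \<longleftrightarrow> (\<forall>p\<in>P. \<forall>S T. T \<in> sets lebesgue \<longrightarrow>
     (\<forall>k\<in>S. \<forall>u. exp (z k) < u \<longrightarrow> u < exp (z (k + 1)) \<longrightarrow> u \<in> T) \<longrightarrow>
     lq q S (G p) \<le> C * Lq_norm q T (\<lambda>u. ennreal (u powr (- recip q)) * g p u))"

lemma sampled_upperD:
  assumes "sampled_upper q P g G C" "p \<in> P" "T \<in> sets lebesgue" "T \<subseteq> {0<..}"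
    and "\<And>u k. u \<in> T \<Longrightarrow> exp (z k) \<le> u \<Longrightarrow> u < exp (z (k + 1)) \<Longrightarrow> k \<in> S"
  shows "Lq_norm q T (\<lambda>u. ennreal (u powr (- recip q)) * g p u) \<le> C * lq q S (G p)"
  by (rule assms(1)[unfolded sampled_upper_def, rule_format]) (use assms in auto)

lemma sampled_lowerD:
  assumes "sampled_lower q P g G C" "p \<in> P" "T \<in> sets lebesgue"
    and "\<And>k u. k \<in> S \<Longrightarrow> exp (z k) < u \<Longrightarrow> u < exp (z (k + 1)) \<Longrightarrow> u \<in> T"
  shows "lq q S (G p) \<le> C * Lq_norm q T (\<lambda>u. ennreal (u powr (- recip q)) * g p u)"
  by (rule assms(1)[unfolded sampled_lower_def, rule_format]) (use assms in auto)

lemma sampled_Lq_le: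
  assumes "sampled P g G" "0 < q"
  shows "\<exists>C<top. sampled_upper q P g G C"
proof -
  obtain C where C: "C < top" and C': "sampled_const P g G C"
    using sampledE[OF assms(1)] .
  note C = C sampled_constD(1)[OF C']
  obtain D where D: "D < top" and D': "Lq_upper q D"
    using Lq_norm_le_lq[OF assms(2)] by blast
  note D = D Lq_upperD[OF D']
  have "Lq_norm q T (\<lambda>u. ennreal (u powr (- recip q)) * g p u) \<le> D * C * lq q S (G p)"
    if p: "p \<in> P" and T: "T \<in> sets lebesgue" "T \<subseteq> {0<..}"
      "\<And>u k. u \<in> T \<Longrightarrow> exp (z k) \<le> u \<Longrightarrow> u < exp (z (k + 1)) \<Longrightarrow> k \<in> S" for p S T
  proof -
    have "Lq_norm q T (\<lambda>u. ennreal (u powr (- recip q)) * g p u) \<le> D * lq q S (\<lambda>k. C * G p k)"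
    proof (rule D(2)[OF T(1)])
      show "T \<subseteq> (\<Union>k\<in>S. {exp (z k)..<exp (z (k + 1))})"
      proof
        fix u assume u: "u \<in> T"
        then have "0 < u" using T(2) by auto
        then obtain k where "exp (z k) \<le> u" "u < exp (z (k + 1))" by (rule grid_cover)
        then show "u \<in> (\<Union>k\<in>S. {exp (z k)..<exp (z (k + 1))})" using T(3)[OF u] by auto
      qed
      show "g p u \<le> C * G p k" if "exp (z k) \<le> u" "u < exp (z (k + 1))" for k u
        using C(2)[OF p] that by simp
    qed
    then show ?thesis by (simp add: lq_cmult[OF assms(2)] mult.assoc)
  qed
  then show ?thesis unfolding sampled_upper_def using C(1) D(1) by (intro exI[of _ "D * C"]) (auto simp: ennreal_mult_less_top)
qed

lemma sampled_le_Lq: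
  assumes "sampled P g G" "0 < q"
  shows "\<exists>C<top. sampled_lower q P g G C"
proof -
  obtain C where C: "C < top" and C': "sampled_const P g G C"
    using sampledE[OF assms(1)] .
  note C = C sampled_constD(2)[OF C']
  obtain D where D: "D < top" and D': "Lq_lower q D"
    using lq_le_Lq_norm[OF assms(2)] by blast
  note D = D Lq_lowerD[OF D']
  have "lq q S (G p) \<le> (C + 1) * D * Lq_norm q T (\<lambda>u. ennreal (u powr (- recip q)) * g p u)"
    if p: "p \<in> P" and T: "T \<in> sets lebesgue"
      "\<And>u k. k \<in> S \<Longrightarrow> exp (z k) < u \<Longrightarrow> u < exp (z (k + 1)) \<Longrightarrow> u \<in> T" for p S T
  proof (rule Lq_lower_multD[OF D' assms(2) T(1) _ C(1)])
    show "(\<Union>k\<in>S. {exp (z k)<..<exp (z (k + 1))}) \<subseteq> T" using T(2) by auto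
  qed (intro C(2) p; simp)
  then show ?thesis unfolding sampled_lower_def using C(1) D(1)
    by (intro exI[of _ "(C + 1) * D"]) (auto simp: ennreal_mult_less_top)
qed

lemma sampled_full:
  assumes "sampled P g G" "0 < q"
  shows "equiv_on P (\<lambda>p. Lq_norm q {0<..} (\<lambda>u. ennreal (u powr (- recip q)) * g p u)) (\<lambda>p. lq q UNIV (G p))"
proof -
  obtain C where C: "C < top" "sampled_upper q P g G C"
    using sampled_Lq_le[OF assms] by blast
  obtain D where D: "D < top" "sampled_lower q P g G D"
    using sampled_le_Lq[OF assms] by blast
  show ?thesis
  proof (rule equiv_onI[OF C(1) D(1)])
    fix p assume p: "p \<in> P"
    show "Lq_norm q {0<..} (\<lambda>u. ennreal (u powr (- recip q)) * g p u) \<le> C * lq q UNIV (G p)"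
      by (rule sampled_upperD[OF C(2) p]) auto
    show "lq q UNIV (G p) \<le> D * Lq_norm q {0<..} (\<lambda>u. ennreal (u powr (- recip q)) * g p u)"
      by (rule sampled_lowerD[OF D(2) p]) (auto intro: less_trans[OF exp_gt_zero])
  qed
qed

lemma shift_image: "(\<lambda>k. k + c) ` {..n::int} = {..n + c}" "(\<lambda>k. k + c) ` {n::int..} = {n + c..}"
  "(\<lambda>k. k + c) ` {m::int..n} = {m + c..n + c}"
  by (auto intro!: image_eqI[of _ _ "_ - c"])

text \<open>For t in cell k the interval (0,t) meets only cells up to k, but is sure to contain only
  those up to k - 1. The missing cell is recovered by shifting the sum by one and comparing
  neighbouring samples.\<close>

lemma sampled_left:
  assumes "sampled P g G" "0 < q"
  shows "sampled P (\<lambda>p t. Lq_norm q {0<..<t} (\<lambda>u. ennreal (u powr (- recip q)) * g p u)) (\<lambda>p k. lq q {..k} (G p))"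
proof -
  obtain C where C: "C < top" and C': "sampled_upper q P g G C"
    using sampled_Lq_le[OF assms] by blast
  note C = C sampled_upperD[OF C']
  obtain D where D: "D < top" and D': "sampled_lower q P g G D"
    using sampled_le_Lq[OF assms] by blast
  note D = D sampled_lowerD[OF D']
  obtain E where E: "E < top" "\<And>p k. p \<in> P \<Longrightarrow> G p (k + 1) \<le> E * G p k"
    using sampled_step[OF assms(1)] by metis
  have ED: "E * D < top" using D E by (simp add: ennreal_mult_less_top)
  show ?thesis
  proof (rule sampledI[OF C(1) ED])
    fix p k t assume *: "p \<in> P" "exp (z k) \<le> t" "t \<le> exp (z (k + 1))"
    show "Lq_norm q {0<..<t} (\<lambda>u. ennreal (u powr (- recip q)) * g p u) \<le> C * lq q {..k} (G p)"
    proof (rule C(2)[OF *(1)])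
      fix u j assume u: "u \<in> {0<..<t}" "exp (z j) \<le> u"
      then have "exp (z j) < exp (z (k + 1))" using *(3) unfolding greaterThanLessThan_iff by linarith
      then show "j \<in> {..k}" by (simp add: z_less_iff)
    qed auto
    have "lq q {..k} (G p) = lq q {..k - 1} (\<lambda>j. G p (j + 1))"
      using lq_shift[OF assms(2), of 1 "{..k - 1}" "G p"] by (simp add: shift_image)
    also have "\<dots> \<le> lq q {..k - 1} (\<lambda>j. E * G p j)" by (intro lq_mono assms E *) auto
    also have "\<dots> \<le> E * (D * Lq_norm q {0<..<t} (\<lambda>u. ennreal (u powr (- recip q)) * g p u))"
      unfolding lq_cmult[OF assms(2)]
    proof (intro mult_left_mono D *)
      fix j u assume "j \<in> {..k - 1}" "exp (z j) < u" "u < exp (z (j + 1))"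
      moreover have "exp (z (j + 1)) \<le> exp (z k)" using \<open>j \<in> {..k - 1}\<close> by (simp add: z_le_iff)
      ultimately show "u \<in> {0<..<t}" using *(2) exp_gt_zero[of "z j"] unfolding greaterThanLessThan_iff by linarith
    qed auto
    finally show "lq q {..k} (G p) \<le> E * D * Lq_norm q {0<..<t} (\<lambda>u. ennreal (u powr (- recip q)) * g p u)"
      by (simp add: mult.assoc)
  qed
qed

lemma sampled_right:
  assumes "sampled P g G" "0 < q"
  shows "sampled P (\<lambda>p t. Lq_norm q {t<..} (\<lambda>u. ennreal (u powr (- recip q)) * g p u)) (\<lambda>p k. lq q {k..} (G p))"
proof -
  obtain C where C: "C < top" and C': "sampled_upper q P g G C"
    using sampled_Lq_le[OF assms] by blast
  note C = C sampled_upperD[OF C']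
  obtain D where D: "D < top" and D': "sampled_lower q P g G D"
    using sampled_le_Lq[OF assms] by blast
  note D = D sampled_lowerD[OF D']
  obtain E where E: "E < top" "\<And>p k. p \<in> P \<Longrightarrow> G p k \<le> E * G p (k + 1)"
    using sampled_step[OF assms(1)] by metis
  have ED: "E * D < top" using D E by (simp add: ennreal_mult_less_top)
  show ?thesis
  proof (rule sampledI[OF C(1) ED])
    fix p k t assume *: "p \<in> P" "exp (z k) \<le> t" "t \<le> exp (z (k + 1))"
    have t: "0 < t" using *(2) by (meson exp_gt_zero less_le_trans)
    show "Lq_norm q {t<..} (\<lambda>u. ennreal (u powr (- recip q)) * g p u) \<le> C * lq q {k..} (G p)"
    proof (rule C(2)[OF *(1)])
      fix u j assume u: "u \<in> {t<..}" "u < exp (z (j + 1))"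
      then have "exp (z k) < exp (z (j + 1))" using *(2) unfolding greaterThan_iff by linarith
      then show "j \<in> {k..}" by (simp add: z_less_iff)
    qed (use t in auto)
    have "lq q {k..} (G p) \<le> lq q {k..} (\<lambda>j. E * G p (j + 1))" by (intro lq_mono assms E *) auto
    also have "\<dots> = E * lq q {k + 1..} (G p)"
      using lq_shift[OF assms(2), of 1 "{k..}" "G p"] by (simp add: shift_image lq_cmult[OF assms(2)])
    also have "\<dots> \<le> E * (D * Lq_norm q {t<..} (\<lambda>u. ennreal (u powr (- recip q)) * g p u))"
    proof (intro mult_left_mono D *)
      fix j u assume "j \<in> {k + 1..}" "exp (z j) < u" "u < exp (z (j + 1))"
      moreover have "exp (z (k + 1)) \<le> exp (z j)" using \<open>j \<in> {k + 1..}\<close> by (simp add: z_le_iff)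
      ultimately show "u \<in> {t<..}" using *(3) unfolding greaterThan_iff by linarith
    qed auto
    finally show "lq q {k..} (G p) \<le> E * D * Lq_norm q {t<..} (\<lambda>u. ennreal (u powr (- recip q)) * g p u)"
      by (simp add: mult.assoc)
  qed
qed

text \<open>With s in cell k and t in cell n, the cells sure to lie inside (s,t) are k + 1, ..., n -
  1: one fewer at each end than in the range {k..n}.\<close>

lemma sampled_right_left:
  assumes g: "sampled P g G" and b: "sampled P b B" and q: "0 < q" and r: "0 < r"
  shows "sampled P (\<lambda>p t. Lq_norm r {0<..<t} (\<lambda>s. ennreal (s powr (- recip r)) * (b p s * Lq_norm q {s<..<t} (\<lambda>u. ennreal (u powr (- recip q)) * g p u))))
    (\<lambda>p n. lq r {..n} (\<lambda>k. B p k * lq q {k..n} (G p)))"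
proof -
  obtain C where C: "C < top" and C': "sampled_upper q P g G C"
    using sampled_Lq_le[OF g q] by blast
  note C = C sampled_upperD[OF C']
  obtain D where D: "D < top" and D': "sampled_lower q P g G D"
    using sampled_le_Lq[OF g q] by blast
  note D = D sampled_lowerD[OF D']
  obtain E where E: "E < top" "\<And>p k. p \<in> P \<Longrightarrow> G p (k + 1) \<le> E * G p k"
    using sampled_step[OF g] by metis
  obtain E' where E': "E' < top" "\<And>p k. p \<in> P \<Longrightarrow> B p (k + 1) \<le> E' * B p k"
    using sampled_step[OF b] by metis
  obtain F where F: "F < top" and F': "sampled_const P b B F"
    using sampledE[OF b] .
  note F = F sampled_constD[OF F']
  obtain C' where C': "C' < top" and C'': "Lq_upper r C'"
    using Lq_norm_le_lq[OF r] by blast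
  note C' = C' Lq_upperD[OF C'']
  obtain D' where D': "D' < top" and D'': "Lq_lower r D'"
    using lq_le_Lq_norm[OF r] by blast
  let ?I = "\<lambda>p s t. Lq_norm q {s<..<t} (\<lambda>u. ennreal (u powr (- recip q)) * g p u)"
  have CC: "C' * (F * C) < top" using C F C' by (simp add: ennreal_mult_less_top)
  have DD: "E' * E' * E * ((F * D + 1) * D') < top" using D E E' F D' by (simp add: ennreal_mult_less_top)
  show ?thesis
  proof (rule sampledI[OF CC DD])
    fix p n t assume *: "p \<in> P" "exp (z n) \<le> t" "t \<le> exp (z (n + 1))"
    have "Lq_norm r {0<..<t} (\<lambda>s. ennreal (s powr (- recip r)) * (b p s * ?I p s t))
      \<le> C' * lq r {..n} (\<lambda>k. (F * C) * (B p k * lq q {k..n} (G p)))"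
    proof (rule C'(2))
      show "{0<..<t} \<subseteq> (\<Union>k\<in>{..n}. {exp (z k)..<exp (z (k + 1))})"
      proof
        fix u assume u: "u \<in> {0<..<t}"
        then have "0 < u" by simp
        then obtain k where k: "exp (z k) \<le> u" "u < exp (z (k + 1))" by (rule grid_cover)
        have "exp (z k) < exp (z (n + 1))" using k u *(3) unfolding greaterThanLessThan_iff by linarith
        then have "k \<le> n" by (simp add: z_less_iff)
        then show "u \<in> (\<Union>k\<in>{..n}. {exp (z k)..<exp (z (k + 1))})" using k by auto
      qed
      fix k s assume s: "k \<in> {..n}" "s \<in> {0<..<t}" "exp (z k) \<le> s" "s < exp (z (k + 1))"
      have "?I p s t \<le> C * lq q {k..n} (G p)"
      proof (rule C(2)[OF *(1)])
        fix u j assume u: "u \<in> {s<..<t}" "exp (z j) \<le> u" "u < exp (z (j + 1))"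
        have "exp (z j) < exp (z (n + 1))" "exp (z k) < exp (z (j + 1))"
          using u s *(3) unfolding greaterThanLessThan_iff by linarith+
        then show "j \<in> {k..n}" by (simp add: z_less_iff)
      qed (use s in auto)
      then have "b p s * ?I p s t \<le> (F * B p k) * (C * lq q {k..n} (G p))"
        using s by (intro mult_mono F *) auto
      then show "b p s * ?I p s t \<le> (F * C) * (B p k * lq q {k..n} (G p))" by (simp add: mult_ac)
    qed auto
    then show "Lq_norm r {0<..<t} (\<lambda>s. ennreal (s powr (- recip r)) * (b p s * ?I p s t))
      \<le> C' * (F * C) * lq r {..n} (\<lambda>k. B p k * lq q {k..n} (G p))"
      by (simp add: lq_cmult[OF r] mult.assoc)
    let ?N = "Lq_norm r {0<..<t} (\<lambda>s. ennreal (s powr (- recip r)) * (b p s * ?I p s t))"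
    \<comment> \<open>Raising k by 2 shortens {k..n} by two indices; shifting the inner index by 1
      then centres it as {k + 1..n - 1}.\<close>
    have "lq r {..n} (\<lambda>k. B p k * lq q {k..n} (G p)) = lq r {..n - 2} (\<lambda>k. B p (k + 2) * lq q {k + 1..n - 1} (\<lambda>j. G p (j + 1)))"
    proof -
      have "lq q {k + 2..n} (G p) = lq q {k + 1..n - 1} (\<lambda>j. G p (j + 1))" for k
        using lq_shift[OF q, of 1 "{k + 1..n - 1}" "G p"] by (simp add: shift_image add.assoc)
      then show ?thesis
        using lq_shift[OF r, of 2 "{..n - 2}" "\<lambda>k. B p k * lq q {k..n} (G p)"] by (simp add: shift_image)
    qed
    also have "\<dots> \<le> lq r {..n - 2} (\<lambda>k. (E' * (E' * B p k)) * lq q {k + 1..n - 1} (\<lambda>j. E * G p j))"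
    proof (intro lq_mono r q mult_mono E *)
      fix k
      have "B p (k + 1 + 1) \<le> E' * (E' * B p k)" by (intro order_trans[OF E'(2)] mult_left_mono E' *) auto
      then show "B p (k + 2) \<le> E' * (E' * B p k)" by (simp add: add.assoc)
    qed auto
    also have "\<dots> = E' * E' * E * lq r {..n - 2} (\<lambda>k. B p k * lq q {k + 1..n - 1} (G p))"
      unfolding lq_cmult[OF q] lq_cmult[OF r, symmetric] by (simp only: mult_ac)
    also have "\<dots> \<le> E' * E' * E * ((F * D + 1) * D' * ?N)"
    proof (intro mult_left_mono Lq_lower_multD[OF D'' r])
      show "(\<Union>k\<in>{..n - 2}. {exp (z k)<..<exp (z (k + 1))}) \<subseteq> {0<..<t}"
      proof (intro UN_least subsetI)
        fix k u assume "k \<in> {..n - 2}" "u \<in> {exp (z k)<..<exp (z (k + 1))}"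
        moreover have "exp (z (k + 1)) \<le> exp (z n)" using \<open>k \<in> {..n - 2}\<close> by (simp add: z_le_iff)
        ultimately show "u \<in> {0<..<t}" using *(2) exp_gt_zero[of "z k"] unfolding greaterThanLessThan_iff by linarith
      qed
      show "F * D < top" using F D by (simp add: ennreal_mult_less_top)
      fix k s assume s: "k \<in> {..n - 2}" "exp (z k) < s" "s < exp (z (k + 1))"
      have "lq q {k + 1..n - 1} (G p) \<le> D * ?I p s t"
      proof (rule D(2)[OF *(1)])
        fix j u assume "j \<in> {k + 1..n - 1}" "exp (z j) < u" "u < exp (z (j + 1))"
        moreover have "exp (z (k + 1)) \<le> exp (z j)" "exp (z (j + 1)) \<le> exp (z n)"
          using \<open>j \<in> {k + 1..n - 1}\<close> by (simp_all add: z_le_iff)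
        ultimately show "u \<in> {s<..<t}" using s *(2) unfolding greaterThanLessThan_iff by linarith
      qed auto
      then have "B p k * lq q {k + 1..n - 1} (G p) \<le> (F * b p s) * (D * ?I p s t)"
        using s by (intro mult_mono F *) auto
      then show "B p k * lq q {k + 1..n - 1} (G p) \<le> F * D * (b p s * ?I p s t)" by (simp only: mult_ac)
    qed auto
    finally show "lq r {..n} (\<lambda>k. B p k * lq q {k..n} (G p)) \<le> E' * E' * E * ((F * D + 1) * D') * ?N"
      by (simp only: mult.assoc)
  qed
qed

lemma sampled_left_right:
  assumes g: "sampled P g G" and b: "sampled P b B" and q: "0 < q" and r: "0 < r"
  shows "sampled P (\<lambda>p t. Lq_norm r {t<..} (\<lambda>s. ennreal (s powr (- recip r)) * (b p s * Lq_norm q {t<..<s} (\<lambda>u. ennreal (u powr (- recip q)) * g p u))))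
    (\<lambda>p n. lq r {n..} (\<lambda>k. B p k * lq q {n..k} (G p)))"
proof -
  obtain C where C: "C < top" and C': "sampled_upper q P g G C"
    using sampled_Lq_le[OF g q] by blast
  note C = C sampled_upperD[OF C']
  obtain D where D: "D < top" and D': "sampled_lower q P g G D"
    using sampled_le_Lq[OF g q] by blast
  note D = D sampled_lowerD[OF D']
  obtain E where E: "E < top" "\<And>p k. p \<in> P \<Longrightarrow> G p k \<le> E * G p (k + 1)"
    using sampled_step[OF g] by metis
  obtain E' where E': "E' < top" "\<And>p k. p \<in> P \<Longrightarrow> B p k \<le> E' * B p (k + 1)"
    using sampled_step[OF b] by metis
  obtain F where F: "F < top" and F': "sampled_const P b B F"
    using sampledE[OF b] .
  note F = F sampled_constD[OF F']
  obtain C' where C': "C' < top" and C'': "Lq_upper r C'"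
    using Lq_norm_le_lq[OF r] by blast
  note C' = C' Lq_upperD[OF C'']
  obtain D' where D': "D' < top" and D'': "Lq_lower r D'"
    using lq_le_Lq_norm[OF r] by blast
  let ?I = "\<lambda>p s t. Lq_norm q {t<..<s} (\<lambda>u. ennreal (u powr (- recip q)) * g p u)"
  have CC: "C' * (F * C) < top" using C F C' by (simp add: ennreal_mult_less_top)
  have DD: "E' * E' * E * ((F * D + 1) * D') < top" using D E E' F D' by (simp add: ennreal_mult_less_top)
  show ?thesis
  proof (rule sampledI[OF CC DD])
    fix p n t assume *: "p \<in> P" "exp (z n) \<le> t" "t \<le> exp (z (n + 1))"
    have t: "0 < t" using *(2) by (meson exp_gt_zero less_le_trans)
    have "Lq_norm r {t<..} (\<lambda>s. ennreal (s powr (- recip r)) * (b p s * ?I p s t))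
      \<le> C' * lq r {n..} (\<lambda>k. (F * C) * (B p k * lq q {n..k} (G p)))"
    proof (rule C'(2))
      show "{t<..} \<subseteq> (\<Union>k\<in>{n..}. {exp (z k)..<exp (z (k + 1))})"
      proof
        fix u assume u: "u \<in> {t<..}"
        then have "0 < u" using t by simp
        then obtain k where k: "exp (z k) \<le> u" "u < exp (z (k + 1))" by (rule grid_cover)
        have "exp (z n) < exp (z (k + 1))" using k u *(2) unfolding greaterThan_iff by linarith
        then have "n \<le> k" by (simp add: z_less_iff)
        then show "u \<in> (\<Union>k\<in>{n..}. {exp (z k)..<exp (z (k + 1))})" using k by auto
      qed
      fix k s assume s: "k \<in> {n..}" "s \<in> {t<..}" "exp (z k) \<le> s" "s < exp (z (k + 1))"
      have "?I p s t \<le> C * lq q {n..k} (G p)"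
      proof (rule C(2)[OF *(1)])
        fix u j assume u: "u \<in> {t<..<s}" "exp (z j) \<le> u" "u < exp (z (j + 1))"
        have "exp (z n) < exp (z (j + 1))" "exp (z j) < exp (z (k + 1))"
          using u s *(2) unfolding greaterThanLessThan_iff by linarith+
        then show "j \<in> {n..k}" by (simp add: z_less_iff)
      qed (use t in auto)
      then have "b p s * ?I p s t \<le> (F * B p k) * (C * lq q {n..k} (G p))"
        using s by (intro mult_mono F *) auto
      then show "b p s * ?I p s t \<le> (F * C) * (B p k * lq q {n..k} (G p))" by (simp add: mult_ac)
    qed auto
    then show "Lq_norm r {t<..} (\<lambda>s. ennreal (s powr (- recip r)) * (b p s * ?I p s t))
      \<le> C' * (F * C) * lq r {n..} (\<lambda>k. B p k * lq q {n..k} (G p))"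
      by (simp add: lq_cmult[OF r] mult.assoc)
    let ?N = "Lq_norm r {t<..} (\<lambda>s. ennreal (s powr (- recip r)) * (b p s * ?I p s t))"
    \<comment> \<open>Outer samples move up by 2 and inner ones by 1, so that after reindexing the
      inner range is {n + 1..k - 1}, the cells between t and s.\<close>
    have "lq r {n..} (\<lambda>k. B p k * lq q {n..k} (G p)) \<le> lq r {n..} (\<lambda>k. (E' * (E' * B p (k + 2))) * lq q {n..k} (\<lambda>j. E * G p (j + 1)))"
    proof (intro lq_mono r q mult_mono E *)
      fix k
      have "B p k \<le> E' * (E' * B p (k + 1 + 1))" by (intro order_trans[OF E'(2)] mult_left_mono E' *) auto
      then show "B p k \<le> E' * (E' * B p (k + 2))" by (simp add: add.assoc)
    qed auto
    also have "\<dots> = E' * E' * E * lq r {n..} (\<lambda>k. B p (k + 2) * lq q {n..k} (\<lambda>j. G p (j + 1)))"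
      unfolding lq_cmult[OF q] lq_cmult[OF r, symmetric] by (simp only: mult_ac)
    also have "lq r {n..} (\<lambda>k. B p (k + 2) * lq q {n..k} (\<lambda>j. G p (j + 1))) = lq r {n + 2..} (\<lambda>k. B p k * lq q {n + 1..k - 1} (G p))"
    proof -
      have "lq q {n..k} (\<lambda>j. G p (j + 1)) = lq q {n + 1..k + 1} (G p)" for k
        using lq_shift[OF q, of 1 "{n..k}" "G p"] by (simp add: shift_image)
      then show ?thesis
        using lq_shift[OF r, of 2 "{n..}" "\<lambda>k. B p k * lq q {n + 1..k - 1} (G p)"] by (simp add: shift_image algebra_simps)
    qed
    also have "E' * E' * E * \<dots> \<le> E' * E' * E * ((F * D + 1) * D' * ?N)"
    proof (intro mult_left_mono Lq_lower_multD[OF D'' r])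
      show "(\<Union>k\<in>{n + 2..}. {exp (z k)<..<exp (z (k + 1))}) \<subseteq> {t<..}"
      proof (intro UN_least subsetI)
        fix k u assume "k \<in> {n + 2..}" "u \<in> {exp (z k)<..<exp (z (k + 1))}"
        moreover have "exp (z (n + 1)) \<le> exp (z k)" using \<open>k \<in> {n + 2..}\<close> by (simp add: z_le_iff)
        ultimately show "u \<in> {t<..}" using *(3) unfolding greaterThanLessThan_iff greaterThan_iff by linarith
      qed
      show "F * D < top" using F D by (simp add: ennreal_mult_less_top)
      fix k s assume s: "k \<in> {n + 2..}" "exp (z k) < s" "s < exp (z (k + 1))"
      have "lq q {n + 1..k - 1} (G p) \<le> D * ?I p s t"
      proof (rule D(2)[OF *(1)])
        fix j u assume "j \<in> {n + 1..k - 1}" "exp (z j) < u" "u < exp (z (j + 1))"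
        moreover have "exp (z (n + 1)) \<le> exp (z j)" "exp (z (j + 1)) \<le> exp (z k)"
          using \<open>j \<in> {n + 1..k - 1}\<close> by (simp_all add: z_le_iff)
        ultimately show "u \<in> {t<..<s}" using s *(3) unfolding greaterThanLessThan_iff by linarith
      qed auto
      then have "B p k * lq q {n + 1..k - 1} (G p) \<le> (F * b p s) * (D * ?I p s t)"
        using s by (intro mult_mono F *) auto
      then show "B p k * lq q {n + 1..k - 1} (G p) \<le> F * D * (b p s * ?I p s t)" by (simp only: mult_ac)
    qed auto
    finally show "lq r {n..} (\<lambda>k. B p k * lq q {n..k} (G p)) \<le> E' * E' * E * ((F * D + 1) * D') * ?N"
      by (simp only: mult.assoc)
  qed
qed

end

section \<open>Slowly varying functions and K-functionals\<close>

text \<open>Membership in \<open>SV\<close>, up to measurability, in logarithmic form.\<close>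

definition slowvar :: "(real \<Rightarrow> real) \<Rightarrow> bool" where
  "slowvar b \<longleftrightarrow> (\<forall>t>0. 0 < b t) \<and>
     (\<forall>\<epsilon>>0. \<exists>C. \<forall>x>0. \<forall>y>0. ln (b x) \<le> ln (b y) + \<epsilon> * \<bar>ln x - ln y\<bar> + C)"

lemma slowvar_pos: "slowvar b \<Longrightarrow> 0 < t \<Longrightarrow> 0 < b t"
  unfolding slowvar_def by (elim conjE allE impE)

lemma slowvarE:
  assumes "slowvar b" "0 < \<epsilon>"
  obtains C where "\<forall>x>0. \<forall>y>0. ln (b x) \<le> ln (b y) + \<epsilon> * \<bar>ln x - ln y\<bar> + C"
  using conjunct2[OF assms(1)[unfolded slowvar_def], THEN spec, THEN mp, OF assms(2)] by (rule exE)

text \<open>The increasing function comparable to t^\<epsilon> b serves the case x \<le> y, the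
  decreasing one comparable to t^(-\<epsilon>) b the case x > y; each costs twice the logarithm of
  its constant.\<close>

lemma SV_imp_slowvar:
  assumes "b \<in> SV" shows "slowvar b"
  unfolding slowvar_def
proof (intro conjI allI impI)
  note SV = assms[unfolded SV_def mem_Collect_eq]
  have "\<forall>t>0. 0 < b t" by (rule conjunct1[OF conjunct2[OF SV]])
  then show pos: "0 < b t" if "0 < t" for t using that by blast
  fix \<epsilon> :: real assume e: "0 < \<epsilon>"
  note ex = conjunct2[OF conjunct2[OF assms[unfolded SV_def mem_Collect_eq]], THEN spec, THEN mp, OF e]
  obtain g where g: "\<forall>t>0. 0 < g t" "mono_on {0<..} g" "equivalent_pos (\<lambda>t. t powr \<epsilon> * b t) g"
    using conjunct1[OF ex] by (elim exE conjE)
  obtain h where h: "\<forall>t>0. 0 < h t" "antimono_on {0<..} h" "equivalent_pos (\<lambda>t. t powr (-\<epsilon>) * b t) h"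
    using conjunct2[OF ex] by (elim exE conjE)
  obtain C where C: "0 < C" "\<forall>t>0. inverse C * g t \<le> t powr \<epsilon> * b t \<and> t powr \<epsilon> * b t \<le> C * g t"
    using g(3) unfolding equivalent_pos_def by (elim exE conjE)
  obtain D where D: "0 < D" "\<forall>t>0. inverse D * h t \<le> t powr (-\<epsilon>) * b t \<and> t powr (-\<epsilon>) * b t \<le> D * h t"
    using h(3) unfolding equivalent_pos_def by (elim exE conjE)
  have lnle: "ln x \<le> ln y + 2 * ln c" if "0 < c" "0 < x" "0 < (w::real)" "0 < v" "x \<le> c * w" "w \<le> v" "inverse c * v \<le> y" for x y c w v
  proof -
    have y: "0 < y" using that by (intro less_le_trans[OF _ that(7)]) simp
    have "ln x \<le> ln (c * w)" using that by simp
    also have "\<dots> = ln c + ln w" using that by (simp add: ln_mult)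
    also have "ln w \<le> ln v" using that by simp
    also have "ln (inverse c * v) \<le> ln y" using that y by (subst ln_le_cancel_iff) auto
    then have "ln v \<le> ln c + ln y" using that by (simp add: ln_mult ln_inverse)
    finally show ?thesis by simp
  qed
  have "ln (b x) \<le> ln (b y) + \<epsilon> * \<bar>ln x - ln y\<bar> + (2 * \<bar>ln C\<bar> + 2 * \<bar>ln D\<bar>)" if xy: "0 < x" "0 < y" for x y
  proof (cases "x \<le> y")
    case True
    have "ln (x powr \<epsilon> * b x) \<le> ln (y powr \<epsilon> * b y) + 2 * ln C"
      using xy True g pos C by (intro lnle[of C _ "g x" "g y"]) (auto simp: mono_on_def)
    then have "\<epsilon> * ln x + ln (b x) \<le> \<epsilon> * ln y + ln (b y) + 2 * ln C"
      using xy pos[OF xy(1)] pos[OF xy(2)] by (simp add: ln_mult ln_powr)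
    then have "ln (b x) \<le> ln (b y) + \<epsilon> * \<bar>ln x - ln y\<bar> + 2 * ln C"
      using True xy by (simp add: algebra_simps)
    moreover have "2 * ln C \<le> 2 * \<bar>ln C\<bar> + 2 * \<bar>ln D\<bar>" by (simp add: add_increasing2)
    ultimately show ?thesis by linarith
  next
    case False
    have "ln (x powr (-\<epsilon>) * b x) \<le> ln (y powr (-\<epsilon>) * b y) + 2 * ln D"
      using xy False h pos D by (intro lnle[of D _ "h x" "h y"]) (auto simp: monotone_on_def)
    then have "- \<epsilon> * ln x + ln (b x) \<le> - \<epsilon> * ln y + ln (b y) + 2 * ln D"
      using xy pos[OF xy(1)] pos[OF xy(2)] by (simp add: ln_mult ln_powr)
    then have "ln (b x) \<le> ln (b y) + \<epsilon> * \<bar>ln x - ln y\<bar> + 2 * ln D"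
      using False xy by (simp add: algebra_simps)
    moreover have "2 * ln D \<le> 2 * \<bar>ln C\<bar> + 2 * \<bar>ln D\<bar>" by (simp add: add_increasing)
    ultimately show ?thesis by linarith
  qed
  then show "\<exists>C. \<forall>x>0. \<forall>y>0. ln (b x) \<le> ln (b y) + \<epsilon> * \<bar>ln x - ln y\<bar> + C" by blast
qed

text \<open>Since ln \<rho> moves at speed at most c up to a bounded error, slow variation of a with
  the smaller exponent \<epsilon> / (|c| + 1) absorbs that speed.\<close>

lemma sv_seq_slowvar_comp:
  assumes a: "slowvar a" and pos: "\<And>k. 0 < \<rho> k"
    and lip: "\<And>n m. \<bar>ln (\<rho> n) - ln (\<rho> m)\<bar> \<le> c * \<bar>real_of_int (n - m)\<bar> + d"
  shows "sv_seq (\<lambda>k. a (\<rho> k))"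
  unfolding sv_seq_def
proof (intro conjI allI impI slowvar_pos[OF a] pos)
  fix \<epsilon> :: real assume e: "0 < \<epsilon>"
  define \<delta> where "\<delta> = \<epsilon> / (\<bar>c\<bar> + 1)"
  have \<delta>: "0 < \<delta>" "\<delta> * \<bar>c\<bar> \<le> \<epsilon>" using e by (auto simp: \<delta>_def field_simps)
  obtain C where C: "\<forall>x>0. \<forall>y>0. ln (a x) \<le> ln (a y) + \<delta> * \<bar>ln x - ln y\<bar> + C"
    by (rule slowvarE[OF a \<delta>(1)])
  note C = C[rule_format]
  have "ln (a (\<rho> n)) \<le> ln (a (\<rho> m)) + \<epsilon> * \<bar>real_of_int (n - m)\<bar> + (\<delta> * d + C)" for n m
  proof -
    let ?x = "\<bar>real_of_int (n - m)\<bar>"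
    have "c * ?x \<le> \<bar>c\<bar> * ?x" by (intro mult_right_mono) auto
    then have "\<delta> * \<bar>ln (\<rho> n) - ln (\<rho> m)\<bar> \<le> \<delta> * (\<bar>c\<bar> * ?x + d)"
      using lip[of n m] \<delta>(1) by (intro mult_left_mono) auto
    also have "\<dots> \<le> \<epsilon> * ?x + \<delta> * d"
      using mult_right_mono[OF \<delta>(2), of ?x] by (simp add: algebra_simps)
    finally show ?thesis using C[OF pos pos, of n m] by simp
  qed
  then show "\<exists>C. \<forall>n m. ln (a (\<rho> n)) \<le> ln (a (\<rho> m)) + \<epsilon> * \<bar>real_of_int (n - m)\<bar> + C" by blast
qed

lemma sv_seq_slowvar: "slowvar a \<Longrightarrow> sv_seq (\<lambda>k. a (exp (L * real_of_int k)))"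
  by (rule sv_seq_slowvar_comp[where c = "\<bar>L\<bar>" and d = 0])
     (auto simp: abs_mult[symmetric] algebra_simps)

section \<open>Weights with bounded logarithmic oscillation on the cells\<close>

context grid
begin

text \<open>A pointwise condition, so it passes to composites such as a \<circ> \<rho> whose
  measurability is unknown.\<close>

definition sampled_weight :: "(real \<Rightarrow> real) \<Rightarrow> bool" where
  "sampled_weight w \<longleftrightarrow> (\<forall>t>0. 0 < w t) \<and> (\<exists>C. \<forall>k u. exp (z k) \<le> u \<longrightarrow> u \<le> exp (z (k + 1)) \<longrightarrow>
     \<bar>ln (w u) - ln (w (exp (z k)))\<bar> \<le> C)"

lemma sampled_weight_pos: "sampled_weight w \<Longrightarrow> 0 < t \<Longrightarrow> 0 < w t"
  unfolding sampled_weight_def by (elim conjE allE impE)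

lemma sampled_weightE:
  assumes "sampled_weight w"
  obtains C where "\<forall>k u. exp (z k) \<le> u \<longrightarrow> u \<le> exp (z (k + 1)) \<longrightarrow> \<bar>ln (w u) - ln (w (exp (z k)))\<bar> \<le> C"
  using conjunct2[OF assms[unfolded sampled_weight_def]] by (rule exE)

lemma sampled_weightI:
  assumes "\<And>t. 0 < t \<Longrightarrow> 0 < w t"
    and "\<And>k u. exp (z k) \<le> u \<Longrightarrow> u \<le> exp (z (k + 1)) \<Longrightarrow> \<bar>ln (w u) - ln (w (exp (z k)))\<bar> \<le> C"
  shows "sampled_weight w"
  unfolding sampled_weight_def by (intro conjI allI impI exI[of _ C] assms)

lemma sampled_of_weight:
  assumes "sampled_weight w"
  shows "sampled P (\<lambda>p u. ennreal (w u)) (\<lambda>p k. ennreal (w (exp (z k))))"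
proof -
  obtain C where C: "\<forall>k u. exp (z k) \<le> u \<longrightarrow> u \<le> exp (z (k + 1)) \<longrightarrow> \<bar>ln (w u) - ln (w (exp (z k)))\<bar> \<le> C"
    by (rule sampled_weightE[OF assms])
  note C = C[rule_format]
  have C': "ennreal (exp C) < top" by simp
  show ?thesis
  proof (rule sampledI[OF C' C'])
    fix k u assume *: "exp (z k) \<le> u" "u \<le> exp (z (k + 1))"
    then have u: "0 < u" by (meson exp_gt_zero less_le_trans)
    have "w u \<le> exp C * w (exp (z k))" "w (exp (z k)) \<le> exp C * w u"
      using C[OF *] u by (auto intro!: le_exp_of_ln_le sampled_weight_pos[OF assms])
    then show "ennreal (w u) \<le> ennreal (exp C) * ennreal (w (exp (z k)))"
      "ennreal (w (exp (z k))) \<le> ennreal (exp C) * ennreal (w u)"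
      by (auto simp flip: ennreal_mult' intro!: ennreal_leI)
  qed
qed

text \<open>The way back from \<open>sampled\<close>, meant for \<chi>0 and \<chi>1: their
  comparison with discrete sums is known before their oscillation.\<close>

lemma sampled_weight_of_sampled:
  assumes s: "sampled {()} (\<lambda>p u. ennreal (w u)) (\<lambda>p. G)" and pos: "\<And>t. 0 < t \<Longrightarrow> 0 < w t"
  shows "sampled_weight w"
proof -
  obtain C where C: "C < top" and C': "sampled_const {()} (\<lambda>p u. ennreal (w u)) (\<lambda>p k. ennreal (w (exp (z k)))) C"
    using sampledE[OF sampled_at_points[OF s]] .
  obtain c where c: "C = ennreal c" "0 \<le> c" using C by (cases C) auto
  have "\<bar>ln (w u) - ln (w (exp (z k)))\<bar> \<le> ln (c + 1)" if *: "exp (z k) \<le> u" "u \<le> exp (z (k + 1))" for k u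
  proof -
    have u: "0 < u" using * by (meson exp_gt_zero less_le_trans)
    have wp: "0 < w u" "0 < w (exp (z k))" using pos u by auto
    have le: "w u \<le> c * w (exp (z k))" "w (exp (z k)) \<le> c * w u"
      using sampled_constD[OF C' singletonI *] c wp by (simp_all add: ennreal_mult'[symmetric] ennreal_le_iff)
    have "x \<le> c * y \<Longrightarrow> 0 < x \<Longrightarrow> 0 < y \<Longrightarrow> ln x \<le> ln (c + 1) + ln y" for x y :: real
    proof -
      assume xy: "x \<le> c * y" "0 < x" "0 < y"
      have "ln x \<le> ln ((c + 1) * y)" using xy c(2) by (subst ln_le_cancel_iff) (auto simp: algebra_simps)
      then show "ln x \<le> ln (c + 1) + ln y" using xy c(2) by (simp add: ln_mult)
    qed
    from this[OF le(1) wp] this[OF le(2) wp(2,1)] show ?thesis by simp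
  qed
  then show ?thesis by (intro sampled_weightI pos)
qed

lemma sampled_weight_cong:
  assumes "sampled_weight v" "\<And>t. 0 < t \<Longrightarrow> w t = v t" shows "sampled_weight w"
proof -
  obtain C where C: "\<forall>k u. exp (z k) \<le> u \<longrightarrow> u \<le> exp (z (k + 1)) \<longrightarrow> \<bar>ln (v u) - ln (v (exp (z k)))\<bar> \<le> C"
    by (rule sampled_weightE[OF assms(1)])
  note C = C[rule_format]
  show ?thesis
  proof (rule sampled_weightI)
    show "0 < w t" if "0 < t" for t using assms(2) sampled_weight_pos[OF assms(1)] that by simp
    fix k u assume *: "exp (z k) \<le> u" "u \<le> exp (z (k + 1))"
    then have "0 < u" by (meson exp_gt_zero less_le_trans)
    then show "\<bar>ln (w u) - ln (w (exp (z k)))\<bar> \<le> C" using C[OF *] assms(2) by simp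
  qed
qed

lemma sampled_weight_mult:
  assumes "sampled_weight v" "sampled_weight w" shows "sampled_weight (\<lambda>t. v t * w t)"
proof -
  obtain C where C: "\<forall>k u. exp (z k) \<le> u \<longrightarrow> u \<le> exp (z (k + 1)) \<longrightarrow> \<bar>ln (v u) - ln (v (exp (z k)))\<bar> \<le> C"
    by (rule sampled_weightE[OF assms(1)])
  note C = C[rule_format]
  obtain D where D: "\<forall>k u. exp (z k) \<le> u \<longrightarrow> u \<le> exp (z (k + 1)) \<longrightarrow> \<bar>ln (w u) - ln (w (exp (z k)))\<bar> \<le> D"
    by (rule sampled_weightE[OF assms(2)])
  note D = D[rule_format]
  have l: "ln (v t * w t) = ln (v t) + ln (w t)" if "0 < t" for t
    using assms[THEN sampled_weight_pos, OF that] by (simp add: ln_mult)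
  have "\<bar>ln (v u * w u) - ln (v (exp (z k)) * w (exp (z k)))\<bar> \<le> C + D"
    if *: "exp (z k) \<le> u" "u \<le> exp (z (k + 1))" for k u
    using C[OF *] D[OF *] l[of u] l[of "exp (z k)"] less_le_trans[OF exp_gt_zero *(1)] by simp
  then show ?thesis by (intro sampled_weightI mult_pos_pos assms[THEN sampled_weight_pos])
qed

lemma sampled_weight_powr:
  assumes "sampled_weight w" shows "sampled_weight (\<lambda>t. w t powr s)"
proof -
  obtain C where C: "\<forall>k u. exp (z k) \<le> u \<longrightarrow> u \<le> exp (z (k + 1)) \<longrightarrow> \<bar>ln (w u) - ln (w (exp (z k)))\<bar> \<le> C"
    by (rule sampled_weightE[OF assms])
  note C = C[rule_format]
  have l: "ln (w t powr s) = s * ln (w t)" if "0 < t" for t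
    using sampled_weight_pos[OF assms that] by (simp add: ln_powr)
  have "\<bar>ln (w u powr s) - ln (w (exp (z k)) powr s)\<bar> \<le> \<bar>s\<bar> * C"
    if *: "exp (z k) \<le> u" "u \<le> exp (z (k + 1))" for k u
    using mult_left_mono[OF C[OF *], of "\<bar>s\<bar>"] l[of u] l[of "exp (z k)"] less_le_trans[OF exp_gt_zero *(1)]
    by (simp add: abs_mult[symmetric] right_diff_distrib)
  moreover have "0 < w t powr s" if "0 < t" for t using sampled_weight_pos[OF assms that] by simp
  ultimately show ?thesis by (intro sampled_weightI)
qed

lemma sampled_weight_slowvar_comp:
  assumes a: "slowvar a" and \<rho>: "sampled_weight \<rho>" shows "sampled_weight (\<lambda>t. a (\<rho> t))"
proof -
  obtain C where C: "\<forall>x>0. \<forall>y>0. ln (a x) \<le> ln (a y) + 1 * \<bar>ln x - ln y\<bar> + C"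
    by (rule slowvarE[OF a zero_less_one])
  note C = C[rule_format]
  obtain D where D: "\<forall>k u. exp (z k) \<le> u \<longrightarrow> u \<le> exp (z (k + 1)) \<longrightarrow> \<bar>ln (\<rho> u) - ln (\<rho> (exp (z k)))\<bar> \<le> D"
    by (rule sampled_weightE[OF \<rho>])
  note D = D[rule_format]
  have "\<bar>ln (a (\<rho> u)) - ln (a (\<rho> (exp (z k))))\<bar> \<le> D + C"
    if *: "exp (z k) \<le> u" "u \<le> exp (z (k + 1))" for k u
  proof -
    have p: "0 < \<rho> u" "0 < \<rho> (exp (z k))"
      using sampled_weight_pos[OF \<rho>] less_le_trans[OF exp_gt_zero *(1)] by auto
    show ?thesis using C[OF p] C[OF p(2) p(1)] D[OF *]
      unfolding abs_minus_commute[of "ln (\<rho> (exp (z k)))"] abs_le_iff[of "ln (a _) - _"] by simp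
  qed
  then show ?thesis by (intro sampled_weightI slowvar_pos[OF a] sampled_weight_pos[OF \<rho>])
qed

lemma sampled_weight_id: "sampled_weight (\<lambda>t. t)"
proof -
  have "\<bar>ln u - ln (exp (z k))\<bar> \<le> l2" if *: "exp (z k) \<le> u" "u \<le> exp (z (k + 1))" for k u
  proof -
    have u: "0 < u" using less_le_trans[OF exp_gt_zero *(1)] .
    have "z k \<le> ln u" "ln u \<le> z (k + 1)" using * u by (simp_all add: ln_ge_iff) (metis exp_ln exp_le_cancel_iff u)
    then show ?thesis using step_le[of k] by simp
  qed
  then show ?thesis by (intro sampled_weightI)
qed

lemma sampled_weight_slowvar: "slowvar a \<Longrightarrow> sampled_weight a"
  using sampled_weight_slowvar_comp[OF _ sampled_weight_id] by simp

end

text \<open>All that is established about the two extreme spaces before their K-functional is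
  formed. The facts about K needed for that couple are stated under this condition.\<close>

definition nonneg_space :: "'a::real_vector qspace \<Rightarrow> bool" where
  "nonneg_space X \<longleftrightarrow> (\<forall>f\<in>pts X. 0 \<le> qnorm X f)"

lemma K_functional_le:
  assumes "nonneg_space X0" "nonneg_space X1" "0 \<le> t" "f0 \<in> pts X0" "f1 \<in> pts X1"
  shows "K_functional t (f0 + f1) X0 X1 \<le> qnorm X0 f0 + t * qnorm X1 f1"
  unfolding K_functional_def
proof (rule cInf_lower)
  show "bdd_below {qnorm X0 f0' + t * qnorm X1 f1' | f0' f1'. f0' \<in> pts X0 \<and> f1' \<in> pts X1 \<and> f0 + f1 = f0' + f1'}"
    using assms unfolding nonneg_space_def by (intro bdd_belowI[of _ 0]) auto
qed (use assms in blast)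

lemma K_functional_greatest:
  assumes "f \<in> sum_pts X0 X1"
    and "\<And>f0 f1. f0 \<in> pts X0 \<Longrightarrow> f1 \<in> pts X1 \<Longrightarrow> f = f0 + f1 \<Longrightarrow> y \<le> qnorm X0 f0 + t * qnorm X1 f1"
  shows "y \<le> K_functional t f X0 X1"
  unfolding K_functional_def
  using assms by (intro cInf_greatest) (auto simp: sum_pts_def)

lemma K_functional_nonneg:
  assumes "nonneg_space X0" "nonneg_space X1" "0 \<le> t" "f \<in> sum_pts X0 X1"
  shows "0 \<le> K_functional t f X0 X1"
  using assms by (intro K_functional_greatest) (auto simp: nonneg_space_def)

lemma K_functional_mono:
  assumes "nonneg_space X0" "nonneg_space X1" "0 \<le> s" "s \<le> t" "f \<in> sum_pts X0 X1"
  shows "K_functional s f X0 X1 \<le> K_functional t f X0 X1"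
proof (rule K_functional_greatest[OF assms(5)])
  fix f0 f1 assume *: "f0 \<in> pts X0" "f1 \<in> pts X1" "f = f0 + f1"
  have "K_functional s f X0 X1 \<le> qnorm X0 f0 + s * qnorm X1 f1" using K_functional_le assms * by blast
  also have "\<dots> \<le> qnorm X0 f0 + t * qnorm X1 f1"
    using assms * by (intro add_left_mono mult_right_mono) (auto simp: nonneg_space_def)
  finally show "K_functional s f X0 X1 \<le> qnorm X0 f0 + t * qnorm X1 f1" .
qed

text \<open>For every decomposition, s / t times its cost at t is at most its cost at s, because s /
  t \<le> 1 only lowers the first summand.\<close>

lemma K_functional_quotient:
  assumes "nonneg_space X0" "nonneg_space X1" "0 < s" "s \<le> t" "f \<in> sum_pts X0 X1"
  shows "K_functional t f X0 X1 \<le> t / s * K_functional s f X0 X1"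
proof -
  have "s / t * K_functional t f X0 X1 \<le> K_functional s f X0 X1"
  proof (rule K_functional_greatest[OF assms(5)])
    fix f0 f1 assume *: "f0 \<in> pts X0" "f1 \<in> pts X1" "f = f0 + f1"
    have n: "0 \<le> qnorm X0 f0" using assms * by (auto simp: nonneg_space_def)
    have "K_functional t f X0 X1 \<le> qnorm X0 f0 + t * qnorm X1 f1"
      using K_functional_le[OF assms(1,2)] assms * by simp
    then have "s / t * K_functional t f X0 X1 \<le> s / t * (qnorm X0 f0 + t * qnorm X1 f1)"
      using assms by (intro mult_left_mono) auto
    also have "\<dots> = s / t * qnorm X0 f0 + s * qnorm X1 f1" using assms by (simp add: field_simps)
    also have "s / t * qnorm X0 f0 \<le> qnorm X0 f0"
      using assms n mult_right_mono[of "s / t" 1 "qnorm X0 f0"] by simp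
    finally show "s / t * K_functional t f X0 X1 \<le> qnorm X0 f0 + s * qnorm X1 f1" by simp
  qed
  then show ?thesis using assms by (simp add: field_simps)
qed

lemma (in grid) sampled_K_functional:
  assumes "nonneg_space X0" "nonneg_space X1"
  shows "sampled (sum_pts X0 X1) (\<lambda>f u. ennreal (K_functional u f X0 X1)) (\<lambda>f k. ennreal (K_functional (exp (z k)) f X0 X1))"
proof -
  have C: "ennreal (exp l2) < top" by simp
  show ?thesis
  proof (rule sampledI[OF C C])
    fix f k u assume f: "f \<in> sum_pts X0 X1" and *: "exp (z k) \<le> u" "u \<le> exp (z (k + 1))"
    have u: "0 < u" using less_le_trans[OF exp_gt_zero *(1)] .
    have nn: "0 \<le> K_functional t f X0 X1" if "0 < t" for t
      using K_functional_nonneg[OF assms _ f, of t] that by simp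
    have "u / exp (z k) \<le> exp l2"
    proof -
      have "u / exp (z k) \<le> exp (z (k + 1)) / exp (z k)" using * by (intro divide_right_mono) auto
      also have "\<dots> = exp (z (k + 1) - z k)" by (simp add: exp_diff)
      also have "\<dots> \<le> exp l2" using step_le[of k] by simp
      finally show ?thesis .
    qed
    then have "u / exp (z k) * K_functional (exp (z k)) f X0 X1 \<le> exp l2 * K_functional (exp (z k)) f X0 X1"
      by (intro mult_right_mono nn) auto
    then have "K_functional u f X0 X1 \<le> exp l2 * K_functional (exp (z k)) f X0 X1"
      using K_functional_quotient[OF assms _ *(1) f] by simp
    then show "ennreal (K_functional u f X0 X1) \<le> ennreal (exp l2) * ennreal (K_functional (exp (z k)) f X0 X1)"
      by (simp flip: ennreal_mult' add: ennreal_leI)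
    have "K_functional (exp (z k)) f X0 X1 \<le> K_functional u f X0 X1"
      using K_functional_mono[OF assms _ *(1) f] by simp
    also have "\<dots> \<le> exp l2 * K_functional u f X0 X1"
      using nn[OF u] step_le[of 0] step_ge[of 0] l1 mult_right_mono[of 1 "exp l2" "K_functional u f X0 X1"] by simp
    finally show "ennreal (K_functional (exp (z k)) f X0 X1) \<le> ennreal (exp l2) * ennreal (K_functional u f X0 X1)"
      by (simp flip: ennreal_mult' add: ennreal_leI)
  qed
qed

section \<open>Quasi-normed couples and near-optimal decompositions\<close>

lemma quasi_normed_nonneg: "quasi_normed X \<Longrightarrow> nonneg_space X"
  by (simp add: quasi_normed_def nonneg_space_def)

lemma quasi_normed_simps:
  assumes "quasi_normed X"
  shows "subspace (pts X)" "0 \<in> pts X" "qnorm X 0 = 0" "\<And>f. f \<in> pts X \<Longrightarrow> - f \<in> pts X"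
    "\<And>f. f \<in> pts X \<Longrightarrow> qnorm X (- f) = qnorm X f"
proof -
  show s: "subspace (pts X)" using assms by (simp add: quasi_normed_def)
  show 0: "0 \<in> pts X" using subspace_0[OF s] .
  show "qnorm X 0 = 0" using assms 0 by (simp add: quasi_normed_def)
  show "- f \<in> pts X" if "f \<in> pts X" for f using subspace_neg[OF s that] .
  show "qnorm X (- f) = qnorm X f" if "f \<in> pts X" for f
  proof -
    have "qnorm X ((-1) *\<^sub>R f) = \<bar>-1\<bar> * qnorm X f"
      using assms that unfolding quasi_normed_def by blast
    then show ?thesis by simp
  qed
qed

lemma sum_pts_add:
  assumes "quasi_normed A0" "quasi_normed A1" "f \<in> sum_pts A0 A1" "g \<in> sum_pts A0 A1"
  shows "f + g \<in> sum_pts A0 A1"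
proof -
  obtain f0 f1 g0 g1 where *: "f = f0 + f1" "g = g0 + g1" "f0 \<in> pts A0" "f1 \<in> pts A1" "g0 \<in> pts A0" "g1 \<in> pts A1"
    using assms(3,4) unfolding sum_pts_def by blast
  then have "f + g = (f0 + g0) + (f1 + g1)" "f0 + g0 \<in> pts A0" "f1 + g1 \<in> pts A1"
    using quasi_normed_simps(1)[OF assms(1)] quasi_normed_simps(1)[OF assms(2)] by (auto simp: subspace_add)
  then show ?thesis unfolding sum_pts_def by blast
qed

lemma sum_ptsI1: "quasi_normed A1 \<Longrightarrow> f \<in> pts A0 \<Longrightarrow> f \<in> sum_pts A0 A1"
  unfolding sum_pts_def using quasi_normed_simps(2)[of A1] by (metis (mono_tags, lifting) add.right_neutral mem_Collect_eq)

lemma sum_ptsI2: "quasi_normed A0 \<Longrightarrow> f \<in> pts A1 \<Longrightarrow> f \<in> sum_pts A0 A1"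
  unfolding sum_pts_def using quasi_normed_simps(2)[of A0] by (metis (mono_tags, lifting) add.left_neutral mem_Collect_eq)

lemma K_functional_quasi_triangle:
  assumes "quasi_normed A0" "quasi_normed A1"
  obtains C where "1 \<le> C" "\<forall>t f g. 0 \<le> t \<longrightarrow> f \<in> sum_pts A0 A1 \<longrightarrow> g \<in> sum_pts A0 A1 \<longrightarrow>
    K_functional t (f + g) A0 A1 \<le> C * (K_functional t f A0 A1 + K_functional t g A0 A1)"
proof -
  obtain C0 where C0: "1 \<le> C0" "\<forall>x\<in>pts A0. \<forall>y\<in>pts A0. qnorm A0 (x + y) \<le> C0 * (qnorm A0 x + qnorm A0 y)"
    using assms(1) unfolding quasi_normed_def by (elim conjE exE)
  note C0 = C0(1) C0(2)[rule_format]
  obtain C1 where C1: "1 \<le> C1" "\<forall>x\<in>pts A1. \<forall>y\<in>pts A1. qnorm A1 (x + y) \<le> C1 * (qnorm A1 x + qnorm A1 y)"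
    using assms(2) unfolding quasi_normed_def by (elim conjE exE)
  note C1 = C1(1) C1(2)[rule_format]
  define C where "C = max C0 C1"
  have C: "1 \<le> C" "C0 \<le> C" "C1 \<le> C" using C0 by (auto simp: C_def)
  note nn = quasi_normed_nonneg[OF assms(1)] quasi_normed_nonneg[OF assms(2)]
  have "K_functional t (f + g) A0 A1 \<le> C * (K_functional t f A0 A1 + K_functional t g A0 A1)"
    if t: "0 \<le> t" and f: "f \<in> sum_pts A0 A1" and g: "g \<in> sum_pts A0 A1" for t f g
  proof -
    let ?K = "K_functional t (f + g) A0 A1"
    have main: "?K / C \<le> (qnorm A0 f0 + t * qnorm A1 f1) + (qnorm A0 g0 + t * qnorm A1 g1)"
      if *: "f0 \<in> pts A0" "f1 \<in> pts A1" "f = f0 + f1" "g0 \<in> pts A0" "g1 \<in> pts A1" "g = g0 + g1" for f0 f1 g0 g1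
    proof -
      have eq: "f + g = (f0 + g0) + (f1 + g1)" using * by simp
      have p: "0 \<le> qnorm A0 f0" "0 \<le> qnorm A0 g0" "0 \<le> qnorm A1 f1" "0 \<le> qnorm A1 g1"
        using nn * by (auto simp: nonneg_space_def)
      have "?K \<le> qnorm A0 (f0 + g0) + t * qnorm A1 (f1 + g1)"
        unfolding eq using * quasi_normed_simps(1)[OF assms(1)] quasi_normed_simps(1)[OF assms(2)]
        by (intro K_functional_le nn t) (auto simp: subspace_add)
      also have "\<dots> \<le> C * (qnorm A0 f0 + qnorm A0 g0) + t * (C * (qnorm A1 f1 + qnorm A1 g1))"
        using C p t by (intro add_mono mult_left_mono order_trans[OF C0(2)] order_trans[OF C1(2)] mult_right_mono * add_nonneg_nonneg) auto
      also have "\<dots> = C * ((qnorm A0 f0 + t * qnorm A1 f1) + (qnorm A0 g0 + t * qnorm A1 g1))"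
        by (simp add: algebra_simps)
      finally show ?thesis using C(1) by (simp add: field_simps)
    qed
    \<comment> \<open>The two infima are taken in turn: for a fixed decomposition of f first over
      those of g, then over those of f.\<close>
    have "?K / C - K_functional t g A0 A1 \<le> K_functional t f A0 A1"
    proof (rule K_functional_greatest[OF f])
      fix f0 f1 assume f': "f0 \<in> pts A0" "f1 \<in> pts A1" "f = f0 + f1"
      have "?K / C - (qnorm A0 f0 + t * qnorm A1 f1) \<le> K_functional t g A0 A1"
        by (rule K_functional_greatest[OF g]) (use main[OF f'] in force)
      then show "?K / C - K_functional t g A0 A1 \<le> qnorm A0 f0 + t * qnorm A1 f1" by simp
    qed
    then have "?K / C \<le> K_functional t f A0 A1 + K_functional t g A0 A1" by simp
    then show ?thesis using C(1) by (simp add: field_simps)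
  qed
  then show ?thesis by (intro that[OF C(1)]) simp
qed

text \<open>The Hausdorff topology is used here. Choose neighbourhoods P and Q of 0 whose sum lies
  in a set U disjoint from a neighbourhood of f; a decomposition of small cost has its parts in P
  and Q, so it cannot add up to f.\<close>

lemma K_functional_eq_0:
  assumes "compatible_couple A0 A1" "nonneg_space A0" "nonneg_space A1" "f \<in> sum_pts A0 A1" "0 < t"
    and K: "K_functional t f A0 A1 = 0"
  shows "f = 0"
proof (rule ccontr)
  assume f: "f \<noteq> 0"
  obtain T where T: "hausdorff_tvs T" "embedded_in_tvs A0 T" "embedded_in_tvs A1 T"
    using assms(1) unfolding compatible_couple_def by (elim exE conjE)
  note h = T(1)[unfolded hausdorff_tvs_def]
  have top: "topspace T = UNIV" by (rule conjunct1[OF h])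
  have haus: "Hausdorff_space T" by (rule conjunct1[OF conjunct2[OF h]])
  have add: "continuous_map (prod_topology T T) T (\<lambda>(x, y). x + y)" by (rule conjunct1[OF conjunct2[OF conjunct2[OF h]]])
  have "\<exists>U V. openin T U \<and> openin T V \<and> 0 \<in> U \<and> f \<in> V \<and> disjnt U V"
    using haus[unfolded Hausdorff_space_def, THEN spec, THEN spec, THEN mp, of 0 f] f top by simp
  then obtain U V where UV: "openin T U" "openin T V" "0 \<in> U" "f \<in> V" "disjnt U V" by (elim exE conjE)
  define W where "W = {x \<in> topspace (prod_topology T T). (case x of (x, y) \<Rightarrow> x + y) \<in> U}"
  have "openin (prod_topology T T) W"
    unfolding W_def using add UV(1) by (rule openin_continuous_map_preimage)
  moreover have "(0, 0) \<in> W" using UV top by (simp add: W_def)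
  ultimately have "\<exists>P Q. openin T P \<and> openin T Q \<and> 0 \<in> P \<and> 0 \<in> Q \<and> P \<times> Q \<subseteq> W"
    unfolding openin_prod_topology_alt by (elim allE impE)
  then obtain P Q where PQ: "openin T P" "openin T Q" "0 \<in> P" "0 \<in> Q" "P \<times> Q \<subseteq> W" by (elim exE conjE)
  obtain \<delta>0 where \<delta>0: "0 < \<delta>0" "\<forall>x\<in>pts A0. qnorm A0 x < \<delta>0 \<longrightarrow> x \<in> P"
    using T(2)[unfolded embedded_in_tvs_def, THEN spec, THEN mp, OF conjI, OF PQ(1,3)] by (elim exE conjE)
  obtain \<delta>1 where \<delta>1: "0 < \<delta>1" "\<forall>x\<in>pts A1. qnorm A1 x < \<delta>1 \<longrightarrow> x \<in> Q"
    using T(3)[unfolded embedded_in_tvs_def, THEN spec, THEN mp, OF conjI, OF PQ(2,4)] by (elim exE conjE)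
  define \<delta> where "\<delta> = min \<delta>0 (t * \<delta>1)"
  have \<delta>: "0 < \<delta>" using \<delta>0 \<delta>1 assms(5) by (simp add: \<delta>_def)
  have "\<delta> \<le> K_functional t f A0 A1"
  proof (rule K_functional_greatest[OF assms(4)], rule ccontr)
    fix f0 f1 assume *: "f0 \<in> pts A0" "f1 \<in> pts A1" "f = f0 + f1" and n: "\<not> \<delta> \<le> qnorm A0 f0 + t * qnorm A1 f1"
    have p: "0 \<le> qnorm A0 f0" "0 \<le> qnorm A1 f1" using assms * by (auto simp: nonneg_space_def)
    have "0 \<le> t * qnorm A1 f1" using p assms(5) by simp
    then have "qnorm A0 f0 < \<delta>0" "t * qnorm A1 f1 < t * \<delta>1" using n p by (auto simp: \<delta>_def)
    then have "f0 \<in> P" "f1 \<in> Q" using \<delta>0 \<delta>1 * assms(5) by auto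
    then have "(f0, f1) \<in> W" using PQ(5) by auto
    then have "f0 + f1 \<in> U" by (simp add: W_def)
    then show False using * UV by (auto simp: disjnt_def)
  qed
  then show False using \<delta> K by simp
qed

text \<open>The global bounds use the trivial one-term decompositions of f0 and f1. The bounds by
  K(u, f) come from f0 = f - f1 for u \<le> t and f1 = f - f0 for u \<ge> t, where the subtracted
  component is cheap.\<close>

lemma K_functional_decomposition:
  assumes "quasi_normed A0" "quasi_normed A1" "compatible_couple A0 A1"
  obtains C where "1 \<le> C" "\<forall>t f. 0 < t \<longrightarrow> f \<in> sum_pts A0 A1 \<longrightarrow> (\<exists>f0 f1. f0 \<in> pts A0 \<and> f1 \<in> pts A1 \<and> f = f0 + f1 \<and>
     (\<forall>u>0. K_functional u f0 A0 A1 \<le> C * K_functional t f A0 A1) \<and>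
     (\<forall>u>0. u \<le> t \<longrightarrow> K_functional u f0 A0 A1 \<le> C * K_functional u f A0 A1) \<and>
     (\<forall>u>0. K_functional u f1 A0 A1 \<le> C * (u / t * K_functional t f A0 A1)) \<and>
     (\<forall>u. t \<le> u \<longrightarrow> K_functional u f1 A0 A1 \<le> C * K_functional u f A0 A1))"
proof -
  note nn = quasi_normed_nonneg[OF assms(1)] quasi_normed_nonneg[OF assms(2)]
  obtain C where C: "1 \<le> C" and tri: "\<forall>t f g. 0 \<le> t \<longrightarrow> f \<in> sum_pts A0 A1 \<longrightarrow> g \<in> sum_pts A0 A1 \<longrightarrow>
    K_functional t (f + g) A0 A1 \<le> C * (K_functional t f A0 A1 + K_functional t g A0 A1)"
    by (rule K_functional_quasi_triangle[OF assms(1,2)])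
  note tri = tri[rule_format]
  have in0: "K_functional u g A0 A1 \<le> qnorm A0 g" if "g \<in> pts A0" "0 < u" for u g
    using K_functional_le[OF nn, of u g 0] that quasi_normed_simps(2,3)[OF assms(2)] by simp
  have in1: "K_functional u g A0 A1 \<le> u * qnorm A1 g" if "g \<in> pts A1" "0 < u" for u g
    using K_functional_le[OF nn, of u 0 g] that quasi_normed_simps(2,3)[OF assms(1)] by simp
  \<comment> \<open>The 3 is 1 + 2: one K(u, f) for f itself and two for the component subtracted,
    as the decomposition is optimal up to the factor 2.\<close>
  have "\<exists>f0 f1. f0 \<in> pts A0 \<and> f1 \<in> pts A1 \<and> f = f0 + f1 \<and>
     (\<forall>u>0. K_functional u f0 A0 A1 \<le> 3 * C * K_functional t f A0 A1) \<and>
     (\<forall>u>0. u \<le> t \<longrightarrow> K_functional u f0 A0 A1 \<le> 3 * C * K_functional u f A0 A1) \<and>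
     (\<forall>u>0. K_functional u f1 A0 A1 \<le> 3 * C * (u / t * K_functional t f A0 A1)) \<and>
     (\<forall>u. t \<le> u \<longrightarrow> K_functional u f1 A0 A1 \<le> 3 * C * K_functional u f A0 A1)"
    if t: "0 < t" and f: "f \<in> sum_pts A0 A1" for t f
  proof -
    let ?K = "\<lambda>u. K_functional u f A0 A1"
    have Knn: "0 \<le> ?K u" if "0 < u" for u using K_functional_nonneg[OF nn _ f, of u] that by simp
    \<comment> \<open>Where the infimum is positive, some decomposition costs at most twice as much.
      Where it is 0 this argument gives nothing, and compatibility supplies f = 0.\<close>
    have "\<exists>f0 f1. f0 \<in> pts A0 \<and> f1 \<in> pts A1 \<and> f = f0 + f1 \<and> qnorm A0 f0 + t * qnorm A1 f1 \<le> 2 * ?K t"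
    proof (cases "?K t = 0")
      case True
      then have "f = 0" using K_functional_eq_0[OF assms(3) nn f t] by simp
      then show ?thesis using True quasi_normed_simps(2,3)[OF assms(1)] quasi_normed_simps(2,3)[OF assms(2)]
        by (intro exI[of _ 0]) auto
    next
      case False
      then have pos: "0 < ?K t" using Knn[OF t] by simp
      show ?thesis
      proof (rule ccontr)
        assume "\<not> ?thesis"
        then have "2 * ?K t \<le> ?K t" by (intro K_functional_greatest[OF f]) force
        then show False using pos by simp
      qed
    qed
    then obtain f0 f1 where *: "f0 \<in> pts A0" "f1 \<in> pts A1" "f = f0 + f1" "qnorm A0 f0 + t * qnorm A1 f1 \<le> 2 * ?K t" by blast
    have p: "0 \<le> qnorm A0 f0" "0 \<le> qnorm A1 f1" using nn * by (auto simp: nonneg_space_def)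
    have q0: "qnorm A0 f0 \<le> 2 * ?K t" using * p t by (smt (verit) mult_nonneg_nonneg)
    have q1: "t * qnorm A1 f1 \<le> 2 * ?K t" using * p by simp
    have CK: "x \<le> 3 * C * y" if "x \<le> 3 * y" "0 \<le> y" for x y
      using that C mult_right_mono[of 1 C "3 * y"] by simp
    have le3: "x \<le> 3 * w" if "x \<le> y" "y \<le> 2 * w" "0 \<le> w" for x y w :: real
      using that by linarith
    have q1u: "u * qnorm A1 f1 \<le> 2 * (u / t * ?K t)" if "0 < u" for u
      using mult_left_mono[OF q1, of "u / t"] that t by (simp add: field_simps)
      have h1: "K_functional u f0 A0 A1 \<le> 3 * C * ?K t" if "0 < u" for u
        by (rule CK[OF order_trans[OF in0[OF *(1) that]] Knn[OF t]]) (use q0 Knn[OF t] in simp)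
      have h2: "K_functional u f0 A0 A1 \<le> 3 * C * ?K u" if u: "0 < u" "u \<le> t" for u
      proof -
        have "u / t * ?K t \<le> ?K u"
          using K_functional_quotient[OF nn u f] u t by (simp add: field_simps)
        then have q: "u * qnorm A1 f1 \<le> 2 * ?K u" using q1u[OF u(1)] by simp
        have "f0 = f + (- f1)" using * by simp
        then have "K_functional u f0 A0 A1 \<le> C * (?K u + K_functional u (- f1) A0 A1)"
          using tri[of u f "- f1"] u f * quasi_normed_simps(4)[OF assms(2)] sum_ptsI2[OF assms(1)] by simp
        also have "\<dots> \<le> C * (?K u + 2 * ?K u)"
          using in1[of "- f1" u] * quasi_normed_simps(4,5)[OF assms(2)] u q C
          by (intro mult_left_mono add_left_mono) auto
        finally show ?thesis by simp
      qed
      have h3: "K_functional u f1 A0 A1 \<le> 3 * C * (u / t * ?K t)" if u: "0 < u" for u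
      proof (rule CK)
        show nn': "0 \<le> u / t * ?K t" using u t Knn[OF t] by simp
        show "K_functional u f1 A0 A1 \<le> 3 * (u / t * ?K t)"
          by (rule le3[OF in1[OF *(2) u] q1u[OF u] nn'])
      qed
      have h4: "K_functional u f1 A0 A1 \<le> 3 * C * ?K u" if u: "t \<le> u" for u
      proof -
        have u0: "0 < u" using u t by simp
        have q: "qnorm A0 f0 \<le> 2 * ?K u" using q0 K_functional_mono[OF nn _ u f] t by simp
        have "f1 = f + (- f0)" using * by simp
        then have "K_functional u f1 A0 A1 \<le> C * (?K u + K_functional u (- f0) A0 A1)"
          using tri[of u f "- f0"] u0 f * quasi_normed_simps(4)[OF assms(1)] sum_ptsI1[OF assms(2)] by simp
        also have "\<dots> \<le> C * (?K u + 2 * ?K u)"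
          using in0[of "- f0" u] * quasi_normed_simps(4,5)[OF assms(1)] u0 q C
          by (intro mult_left_mono add_left_mono) auto
        finally show ?thesis by simp
      qed
    show ?thesis
      by (intro exI[of _ f0] exI[of _ f1] conjI *(1-3) allI impI h1 h2 h3 h4)
  qed
  then have "\<forall>t f. 0 < t \<longrightarrow> f \<in> sum_pts A0 A1 \<longrightarrow> (\<exists>f0 f1. f0 \<in> pts A0 \<and> f1 \<in> pts A1 \<and> f = f0 + f1 \<and>
     (\<forall>u>0. K_functional u f0 A0 A1 \<le> 3 * C * K_functional t f A0 A1) \<and>
     (\<forall>u>0. u \<le> t \<longrightarrow> K_functional u f0 A0 A1 \<le> 3 * C * K_functional u f A0 A1) \<and>
     (\<forall>u>0. K_functional u f1 A0 A1 \<le> 3 * C * (u / t * K_functional t f A0 A1)) \<and>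
     (\<forall>u. t \<le> u \<longrightarrow> K_functional u f1 A0 A1 \<le> 3 * C * K_functional u f A0 A1))"
    by (intro allI impI)
  then show ?thesis by (rule that[rotated]) (use C in simp)
qed

section \<open>The K-functional of the couple of extreme spaces\<close>

lemma grid_linear: "0 < L \<Longrightarrow> grid (\<lambda>k. L * real_of_int k) L L"
  by unfold_locales (auto simp: algebra_simps)

text \<open>Separates the factor u^(-1/q), which belongs to the measure du/u, from the genuine
  weight; the discretisation lemmas expect this shape.\<close>

lemma wt_split: "wt \<theta> q b u = ennreal (u powr (- recip q)) * ennreal (u powr (- \<theta>) * b u)"
proof -
  have "u powr (- \<theta> - recip q) = u powr (- recip q) * u powr (- \<theta>)"
    unfolding powr_add[symmetric] by (simp add: algebra_simps)
  then show ?thesis unfolding wt_def by (simp add: ennreal_mult' mult.assoc)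
qed

lemma wt_0: "wt 0 q b u = ennreal (u powr (- recip q)) * ennreal (b u)"
  unfolding wt_def by (simp add: ennreal_mult')

lemma wK_split:
  "wK X0 X1 \<theta> q b f u = ennreal (u powr (- recip q)) * (ennreal (u powr (- \<theta>) * b u) * ennreal (K_functional u f X0 X1))"
  unfolding wK_def wt_split by (simp add: mult.assoc)

lemma powr_exp_eq: "exp x powr s = exp (s * x)" for x s :: real
  by (simp add: powr_def)

context grid
begin

lemma sampled_weight_powr_mult:
  "sampled_weight a \<Longrightarrow> sampled_weight (\<lambda>u. u powr s * a u)"
  by (rule sampled_weight_mult[OF sampled_weight_powr[OF sampled_weight_id]])

lemma sampled_wK:
  assumes "nonneg_space X0" "nonneg_space X1" "sampled_weight a"
  shows "sampled (sum_pts X0 X1) (\<lambda>f u. ennreal (u powr (- \<theta>) * a u) * ennreal (K_functional u f X0 X1))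
     (\<lambda>f k. ennreal (exp (- \<theta> * z k) * a (exp (z k))) * ennreal (K_functional (exp (z k)) f X0 X1))"
proof -
  have "sampled (sum_pts X0 X1) (\<lambda>f u. ennreal (u powr (- \<theta>) * a u)) (\<lambda>f k. ennreal (exp (z k) powr (- \<theta>) * a (exp (z k))))"
    by (rule sampled_of_weight[OF sampled_weight_powr_mult[OF assms(3)]])
  from sampled_mult[OF this sampled_K_functional[OF assms(1,2)]] show ?thesis
    by (simp only: powr_exp_eq)
qed

lemma sampled_positive_finite:
  assumes s: "sampled {()} (\<lambda>_. g) (\<lambda>_. G)" and slow: "slow G" and pos: "\<And>k. 0 < G k"
    and u: "0 < u" "g u < top" and t: "0 < t"
  shows "0 < g t" "g t < top"
proof -
  obtain C where C: "C < top" "sampled_const {()} (\<lambda>_. g) (\<lambda>_. G) C" using sampledE[OF s] .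
  obtain k where k: "exp (z k) \<le> u" "u < exp (z (k + 1))" using grid_cover[OF u(1)] .
  have "G k \<le> C * g u" using sampled_constD(2)[OF C(2) singletonI k(1) less_imp_le[OF k(2)]] .
  also have "\<dots> < top" using C(1) u(2) by (simp add: ennreal_mult_less_top)
  finally have G: "G j < top" for j using slow_finite[OF slow] by blast
  obtain j where j: "exp (z j) \<le> t" "t < exp (z (j + 1))" using grid_cover[OF t] .
  note D = sampled_constD[OF C(2) singletonI j(1) less_imp_le[OF j(2)]]
  show "0 < g t"
    using D(2) pos[of j] by (metis le_zero_eq mult_zero_right not_gr_zero)
  have "C * G j < top" using C(1) G by (simp add: ennreal_mult_less_top)
  then show "g t < top" using D(1) by (rule le_less_trans[rotated])
qed

lemma sampled_dominated:
  assumes s: "sampled {()} (\<lambda>_. g) (\<lambda>_. G)"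
  shows "(\<lambda>k. g (exp (z k))) \<lessapprox> G" "G \<lessapprox> (\<lambda>k. g (exp (z k)))"
proof -
  obtain C where C: "C < top" "sampled_const {()} (\<lambda>_. g) (\<lambda>_. G) C" using sampledE[OF s] .
  have "exp (z k) \<le> exp (z (k + 1))" for k by (simp add: z_le_iff)
  note D = sampled_constD[OF C(2) singletonI order_refl this]
  show "(\<lambda>k. g (exp (z k))) \<lessapprox> G" "G \<lessapprox> (\<lambda>k. g (exp (z k)))"
    by (rule dominatedI[OF C(1) D(1)]) (rule dominatedI[OF C(1) D(2)])
qed

end

lemma lq_positive:
  assumes "0 < q" "k \<in> S" "0 < f k" shows "0 < lq q S f"
  by (rule less_le_trans[OF assms(3)]) (rule lq_point[OF assms(1,2)])

section \<open>Discretisation of \<chi>0, \<chi>1 and \<rho>\<close>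

locale weights =
  fixes q0 r0 q1 r1 :: ennreal and a a0 b0 a1 b1 \<chi>0 \<chi>1 \<rho> :: "real \<Rightarrow> real" and \<theta>0 :: real
  assumes exponents: "0 < q0" "0 < r0" "0 < q1" "0 < r1"
    and sv: "slowvar a" "slowvar a0" "slowvar b0" "slowvar a1" "slowvar b1"
    and \<theta>0: "0 < \<theta>0" "\<theta>0 < 1"
    and finite_b1: "Lq_norm r1 {1<..} (wt 0 r1 b1) < \<infinity>"
    and finite_b1a1: "Lq_norm r1 {0<..<1} (\<lambda>s. wt 0 r1 b1 s * Lq_norm q1 {0<..<s} (wt 0 q1 a1)) < \<infinity>"
    and finite_b0: "Lq_norm r0 {0<..<1} (wt 0 r0 b0) < \<infinity>"
    and \<chi>1: "\<And>t. 0 < t \<Longrightarrow> \<chi>1 t = enn2real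
           (Lq_norm r1 {0<..<t} (\<lambda>s. wt 0 r1 b1 s * Lq_norm q1 {0<..<s} (wt 0 q1 a1))
            + Lq_norm r1 {t<..} (wt 0 r1 b1) * Lq_norm q1 {0<..<t} (wt 0 q1 a1))"
    and \<chi>0: "\<And>t. 0 < t \<Longrightarrow> \<chi>0 t = a0 t * enn2real (Lq_norm r0 {0<..<t} (wt 0 r0 b0))"
    and \<rho>: "\<And>t. 0 < t \<Longrightarrow> \<rho> t = t powr (1 - \<theta>0) * (\<chi>0 t / \<chi>1 t)"
begin

text \<open>The partial norms that make up \<chi>0 and \<chi>1 are sampled by slow positive
  sequences. Finiteness at one point thus holds for every t, \<open>enn2real\<close> loses nothing,
  and slow variation passes from the discrete expressions to the sampled \<chi>0 and
  \<chi>1.\<close>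

lemma weights_discretised:
  assumes L: "0 < L"
  shows "discrete q0 r0 q1 r1 (\<lambda>k. a0 (exp (L * real_of_int k))) (\<lambda>k. b0 (exp (L * real_of_int k)))
      (\<lambda>k. a1 (exp (L * real_of_int k))) (\<lambda>k. b1 (exp (L * real_of_int k)))
      (\<lambda>k. \<chi>0 (exp (L * real_of_int k))) (\<lambda>k. \<chi>1 (exp (L * real_of_int k))) \<theta>0 L" (is ?d)
    and "grid.sampled_weight (\<lambda>k. L * real_of_int k) \<chi>0" (is ?w0)
    and "grid.sampled_weight (\<lambda>k. L * real_of_int k) \<chi>1" (is ?w1)
proof -
  interpret grid "\<lambda>k. L * real_of_int k" L L by (rule grid_linear[OF L])
  let ?x = "\<lambda>k. exp (L * real_of_int k)"
  have W: "sampled {()} (\<lambda>_ u. ennreal (b u)) (\<lambda>_ k. ennreal (b (?x k)))" if "slowvar b" for b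
    by (rule sampled_of_weight[OF sampled_weight_slowvar[OF that]])
  have sl: "slow (\<lambda>k. ennreal (b (?x k)))" if "slowvar b" for b
    by (rule slow_sv_seq[OF sv_seq_slowvar[OF that]])
  have wt0: "wt 0 q b = (\<lambda>u. ennreal (u powr (- recip q)) * ennreal (b u))" for q b
    by (rule ext) (rule wt_0)
  have pos: "0 < b (?x k)" if "slowvar b" for b k using slowvar_pos[OF that] by simp
  define B0 where "B0 t = Lq_norm r0 {0<..<t} (wt 0 r0 b0)" for t
  define G1 where "G1 t = Lq_norm q1 {0<..<t} (wt 0 q1 a1)" for t
  define B1 where "B1 t = Lq_norm r1 {t<..} (wt 0 r1 b1)" for t
  define S1 where "S1 t = Lq_norm r1 {0<..<t} (\<lambda>s. wt 0 r1 b1 s * G1 s)" for t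
  define dB0 where "dB0 n = lq r0 {..n} (\<lambda>k. ennreal (b0 (?x k)))" for n
  define dG1 where "dG1 n = lq q1 {..n} (\<lambda>k. ennreal (a1 (?x k)))" for n
  define dB1 where "dB1 n = lq r1 {n..} (\<lambda>k. ennreal (b1 (?x k)))" for n
  define dS1 where "dS1 n = lq r1 {..n} (\<lambda>k. ennreal (b1 (?x k)) * dG1 k)" for n
  have s0: "sampled {()} (\<lambda>_. B0) (\<lambda>_. dB0)"
    using sampled_left[OF W[OF sv(3)] exponents(2)] unfolding B0_def dB0_def wt0 .
  have sG: "sampled {()} (\<lambda>_. G1) (\<lambda>_. dG1)"
    using sampled_left[OF W[OF sv(4)] exponents(3)] unfolding G1_def dG1_def wt0 .
  have sB: "sampled {()} (\<lambda>_. B1) (\<lambda>_. dB1)"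
    using sampled_right[OF W[OF sv(5)] exponents(4)] unfolding B1_def dB1_def wt0 .
  have sS: "sampled {()} (\<lambda>_. S1) (\<lambda>_. dS1)"
    using sampled_left[OF sampled_mult[OF W[OF sv(5)] sG] exponents(4)] unfolding S1_def dS1_def wt0 mult.assoc .
  have sl0: "slow dB0" unfolding dB0_def by (intro slow_lq_atMost sl sv exponents)
  have slG: "slow dG1" unfolding dG1_def by (intro slow_lq_atMost sl sv exponents)
  have slB: "slow dB1" unfolding dB1_def by (intro slow_lq_atLeast sl sv exponents)
  have slS: "slow dS1" unfolding dS1_def by (intro slow_lq_atMost slow_mult sl slG sv exponents)
  have p0: "0 < dB0 k" for k unfolding dB0_def by (rule lq_positive[of _ k]) (auto simp: exponents pos sv)
  have pG: "0 < dG1 k" for k unfolding dG1_def by (rule lq_positive[of _ k]) (auto simp: exponents pos sv)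
  have pB: "0 < dB1 k" for k unfolding dB1_def by (rule lq_positive[of _ k]) (auto simp: exponents pos sv)
  have pS: "0 < dS1 k" for k unfolding dS1_def
    by (rule lq_positive[of _ k]) (auto simp: exponents pos sv pG ennreal_zero_less_mult_iff)
  have f0: "0 < B0 t" "B0 t < top" if "0 < t" for t
    using sampled_positive_finite[OF s0 sl0 p0 zero_less_one _ that] finite_b0 by (auto simp: B0_def)
  have fS: "0 < S1 t" "S1 t < top" if "0 < t" for t
    using sampled_positive_finite[OF sS slS pS zero_less_one _ that] finite_b1a1 by (auto simp: S1_def G1_def)
  have fB: "0 < B1 t" "B1 t < top" if "0 < t" for t
    using sampled_positive_finite[OF sB slB pB zero_less_one _ that] finite_b1 by (auto simp: B1_def)
  \<comment> \<open>No assumption bounds the norm of a1 by itself; it is finite because it occurs,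
    with a positive factor, as one term of the finite \<open>dS1 0\<close>.\<close>
  have dG: "dG1 0 < top"
  proof -
    have "dS1 0 < top"
    proof -
      obtain C where C: "C < top" "\<And>k. dS1 k \<le> C * S1 (?x k)" using dominatedE[OF sampled_dominated(2)[OF sS]] by metis
      have "C * S1 (?x 0) < top" using C(1) fS(2)[of "?x 0"] by (simp add: ennreal_mult_less_top)
      then show ?thesis using C(2)[of 0] by (rule le_less_trans[rotated])
    qed
    moreover have "ennreal (b1 (?x 0)) * dG1 0 \<le> dS1 0"
      unfolding dS1_def by (rule lq_point[OF exponents(4)]) simp
    ultimately have "ennreal (b1 (?x 0)) * dG1 0 < top" by (rule le_less_trans[rotated])
    then show ?thesis using pos[OF sv(5), of 0] by (auto simp: ennreal_mult_less_top)
  qed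
  have fG: "0 < G1 t" "G1 t < top" if "0 < t" for t
  proof -
    obtain C where C: "C < top" "\<And>k. G1 (?x k) \<le> C * dG1 k" using dominatedE[OF sampled_dominated(1)[OF sG]] by metis
    have "C * dG1 0 < top" using C(1) dG by (simp add: ennreal_mult_less_top)
    then have "G1 (?x 0) < top" using C(2)[of 0] by (rule le_less_trans[rotated])
    then show "0 < G1 t" "G1 t < top" by (rule sampled_positive_finite[OF sG slG pG exp_gt_zero _ that])+
  qed
  \<comment> \<open>Finiteness makes \<chi>0, and below \<chi>1, equal as extended reals to the
    expressions under \<open>enn2real\<close>.\<close>
  have e0: "ennreal (\<chi>0 t) = ennreal (a0 t) * B0 t" if "0 < t" for t
    using f0[OF that] slowvar_pos[OF sv(2) that] unfolding \<chi>0[OF that] B0_def[symmetric]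
    by (simp add: ennreal_mult less_imp_le)
  have f1: "S1 t + B1 t * G1 t < top" if "0 < t" for t
    using fS[OF that] fB[OF that] fG[OF that] by (simp add: ennreal_mult_less_top)
  have e1: "ennreal (\<chi>1 t) = S1 t + B1 t * G1 t" if "0 < t" for t
    using f1[OF that] unfolding \<chi>1[OF that] S1_def[symmetric] G1_def[symmetric] B1_def[symmetric] by simp
  have \<chi>0pos: "0 < \<chi>0 t" if "0 < t" for t
  proof -
    have "0 < ennreal (\<chi>0 t)" unfolding e0[OF that] using f0[OF that] slowvar_pos[OF sv(2) that]
      by (simp add: ennreal_zero_less_mult_iff)
    then show ?thesis by simp
  qed
  have \<chi>1pos: "0 < \<chi>1 t" if "0 < t" for t
  proof -
    have "0 < ennreal (\<chi>1 t)" unfolding e1[OF that] using fS[OF that] by (simp add: add_pos_nonneg)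
    then show ?thesis by simp
  qed
  have u0: "0 < u" if "exp (L * real_of_int k) \<le> u" for u k using less_le_trans[OF exp_gt_zero that] .
  have cong: "sampled {()} (\<lambda>_. h) H" if "sampled {()} (\<lambda>_. g) H" "\<And>t. 0 < t \<Longrightarrow> h t = g t" for g h H
    using that u0 unfolding sampled_def sampled_const_def by metis
  have c0: "sampled {()} (\<lambda>_ u. ennreal (\<chi>0 u)) (\<lambda>_ k. ennreal (a0 (?x k)) * dB0 k)"
    by (rule cong[OF sampled_mult[OF W[OF sv(2)] s0]]) (rule e0)
  have c1: "sampled {()} (\<lambda>_ u. ennreal (\<chi>1 u)) (\<lambda>_ k. dS1 k + dB1 k * dG1 k)"
    by (rule cong[OF sampled_add[OF sS sampled_mult[OF sB sG]]]) (rule e1)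
  show ?w0 by (rule sampled_weight_of_sampled[OF c0 \<chi>0pos])
  show ?w1 by (rule sampled_weight_of_sampled[OF c1 \<chi>1pos])
  note d0 = sampled_dominated[OF c0] and d1 = sampled_dominated[OF c1]
  have v0: "sv_seq (\<lambda>k. \<chi>0 (?x k))"
    by (rule sv_seq_slow[OF slow_equiv[OF _ d0]]) (intro slow_mult sl sl0 sv, simp add: \<chi>0pos)
  have v1: "sv_seq (\<lambda>k. \<chi>1 (?x k))"
    by (rule sv_seq_slow[OF slow_equiv[OF _ d1]]) (intro slow_mult slow_add slS slB slG, simp add: \<chi>1pos)
  show ?d
    by unfold_locales
      (use exponents \<theta>0 L v0 v1 sv_seq_slowvar[OF sv(2)] sv_seq_slowvar[OF sv(3)] sv_seq_slowvar[OF sv(4)] sv_seq_slowvar[OF sv(5)]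
         d0[unfolded dB0_def] d1[unfolded dS1_def dB1_def dG1_def] in simp_all)
qed

lemma \<rho>_discrete:
  assumes L: "0 < L"
  shows "\<rho> (exp (L * real_of_int k)) = discrete.rho (\<lambda>k. \<chi>0 (exp (L * real_of_int k))) (\<lambda>k. \<chi>1 (exp (L * real_of_int k))) \<theta>0 L k"
  unfolding discrete.rho_def[OF weights_discretised(1)[OF L]] \<rho>[OF exp_gt_zero] powr_exp_eq by (simp add: mult.assoc)

text \<open>With step m the power in \<rho> advances ln \<rho> by 2 \<epsilon> m, where 2 \<epsilon>
  = 1 - \<theta>0, while the slowly varying factor moves it by at most \<epsilon> m + C. The
  increments lie between \<epsilon> m - C and 3 \<epsilon> m + C, and m makes the lower bound exceed
  1.\<close>

lemma step_exists:
  obtains L l2 where "0 < L" "grid (\<lambda>k. ln (\<rho> (exp (L * real_of_int k)))) 1 l2"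
proof -
  have one: "(0::real) < 1" by simp
  interpret D: discrete q0 r0 q1 r1 "\<lambda>k. a0 (exp (1 * real_of_int k))" "\<lambda>k. b0 (exp (1 * real_of_int k))"
      "\<lambda>k. a1 (exp (1 * real_of_int k))" "\<lambda>k. b1 (exp (1 * real_of_int k))"
      "\<lambda>k. \<chi>0 (exp (1 * real_of_int k))" "\<lambda>k. \<chi>1 (exp (1 * real_of_int k))" \<theta>0 1
    by (rule weights_discretised(1)[OF one])
  define w where "w k = \<chi>0 (exp (1 * real_of_int k)) / \<chi>1 (exp (1 * real_of_int k))" for k
  have w: "sv_seq w" unfolding w_def by (rule sv_seq_divide[OF D.\<chi>0 D.\<chi>1])
  define \<epsilon> where "\<epsilon> = (1 - \<theta>0) / 2"
  have \<epsilon>: "0 < \<epsilon>" using \<theta>0 by (simp add: \<epsilon>_def)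
  obtain C where C: "\<forall>n m. ln (w n) \<le> ln (w m) + \<epsilon> * \<bar>real_of_int (n - m)\<bar> + C"
    using w \<epsilon> unfolding sv_seq_def by blast
  obtain m :: nat where m: "C + 1 < \<epsilon> * real m" using \<epsilon> by (metis mult.commute reals_Archimedean3)
  have C0: "0 \<le> C" using C[rule_format, of 0 0] by simp
  have m0: "0 < real m" using m C0 \<epsilon> by (cases "m = 0") auto
  \<comment> \<open>The grid of step m sits inside the grid of step 1, so the constant C found for
    step 1 applies at the indices m k. This breaks the circle between the step and constants
    depending on it.\<close>
  have ln\<rho>: "ln (\<rho> (exp (real m * real_of_int k))) = 2 * \<epsilon> * (real m * real_of_int k) + ln (w (int m * k))" for k
  proof -
    have "exp (real m * real_of_int k) = exp (1 * real_of_int (int m * k))" by simp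
    then have "\<rho> (exp (real m * real_of_int k)) = exp (2 * \<epsilon> * (real m * real_of_int k)) * w (int m * k)"
      unfolding \<rho>[OF exp_gt_zero] powr_exp_eq w_def by (simp add: \<epsilon>_def)
    then show ?thesis using sv_seq_pos[OF w, of "int m * k"] by (simp add: ln_mult)
  qed
  have "grid (\<lambda>k. ln (\<rho> (exp (real m * real_of_int k)))) 1 (3 * \<epsilon> * real m + C)"
  proof unfold_locales
    fix k :: int
    have d: "real_of_int (int m * (k + 1) - int m * k) = real m" "real_of_int (int m * k - int m * (k + 1)) = - real m"
      by (simp_all add: algebra_simps)
    have "ln (w (int m * (k + 1))) \<le> ln (w (int m * k)) + \<epsilon> * real m + C"
      using C[rule_format, of "int m * (k + 1)" "int m * k"] by (simp only: d abs_of_nat)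
    moreover have "ln (w (int m * k)) \<le> ln (w (int m * (k + 1))) + \<epsilon> * real m + C"
      using C[rule_format, of "int m * k" "int m * (k + 1)"] by (simp only: d abs_of_nat abs_minus_cancel)
    ultimately show "1 \<le> ln (\<rho> (exp (real m * real_of_int (k + 1)))) - ln (\<rho> (exp (real m * real_of_int k)))"
      "ln (\<rho> (exp (real m * real_of_int (k + 1)))) - ln (\<rho> (exp (real m * real_of_int k))) \<le> 3 * \<epsilon> * real m + C"
      using m unfolding ln\<rho> by (simp_all add: algebra_simps)
  qed simp
  then show ?thesis by (rule that[OF m0])
qed

end

text \<open>One L serves two grids: the points x_k, where K(u, f; A0, A1) is sampled, and the points
  \<rho>(x_k), where the K-functional of the extreme couple is sampled.\<close>

locale couple_setting = weights q0 r0 q1 r1 a a0 b0 a1 b1 \<chi>0 \<chi>1 \<rho> \<theta>0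
  for q0 r0 q1 r1 :: ennreal and a a0 b0 a1 b1 \<chi>0 \<chi>1 \<rho> :: "real \<Rightarrow> real" and \<theta>0 :: real +
  fixes A0 A1 :: "'a::real_vector qspace" and L l2 :: real
  assumes A0: "quasi_normed A0" and A1: "quasi_normed A1" and compat: "compatible_couple A0 A1"
    and L: "0 < L" and steps: "grid (\<lambda>k. ln (\<rho> (exp (L * real_of_int k)))) 1 l2"
begin

abbreviation "x k \<equiv> exp (L * real_of_int k)"

sublocale G: grid "\<lambda>k. L * real_of_int k" L L by (rule grid_linear[OF L])

sublocale R: grid "\<lambda>k. ln (\<rho> (x k))" 1 l2 by (rule steps)

sublocale D: discrete q0 r0 q1 r1 "\<lambda>k. a0 (x k)" "\<lambda>k. b0 (x k)" "\<lambda>k. a1 (x k)" "\<lambda>k. b1 (x k)"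
    "\<lambda>k. \<chi>0 (x k)" "\<lambda>k. \<chi>1 (x k)" \<theta>0 L
  by (rule weights_discretised(1)[OF L])

lemma rho_eq: "\<rho> (x k) = D.rho k"
  by (rule \<rho>_discrete[OF L])

abbreviation "X0 \<equiv> R_space A0 A1 \<theta>0 r0 b0 q0 a0"
abbreviation "X1 \<equiv> L_space A0 A1 1 r1 b1 q1 a1"
abbreviation "P \<equiv> sum_pts A0 A1"

definition NX0 :: "'a \<Rightarrow> ennreal" where
  "NX0 f = Lq_norm r0 {0<..} (\<lambda>t. wt 0 r0 b0 t * Lq_norm q0 {t<..} (wK A0 A1 \<theta>0 q0 a0 f))"
definition NX1 :: "'a \<Rightarrow> ennreal" where
  "NX1 f = Lq_norm r1 {0<..} (\<lambda>t. wt 0 r1 b1 t * Lq_norm q1 {0<..<t} (wK A0 A1 1 q1 a1 f))"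
definition \<kappa> :: "'a \<Rightarrow> int \<Rightarrow> ennreal" where
  "\<kappa> f k = ennreal (K_functional (x k) f A0 A1)"

lemmas nn = quasi_normed_nonneg[OF A0] quasi_normed_nonneg[OF A1]

lemma X_simps: "pts X0 = {f \<in> P. NX0 f < top}" "qnorm X0 f = enn2real (NX0 f)"
  "pts X1 = {f \<in> P. NX1 f < top}" "qnorm X1 f = enn2real (NX1 f)"
  by (simp_all add: R_space_def L_space_def space_of_def NX0_def NX1_def)

lemma nnX: "nonneg_space X0" "nonneg_space X1"
  by (simp_all add: nonneg_space_def X_simps)

lemma sum_pts_X: "sum_pts X0 X1 \<subseteq> P"
proof
  fix f assume "f \<in> sum_pts X0 X1"
  then obtain f0 f1 where "f = f0 + f1" "f0 \<in> P" "f1 \<in> P" by (auto simp: sum_pts_def X_simps)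
  then show "f \<in> P" using sum_pts_add[OF A0 A1] by simp
qed

lemma sampled_wK_A:
  "slowvar w \<Longrightarrow> G.sampled P (\<lambda>f u. ennreal (u powr (- \<theta>) * w u) * ennreal (K_functional u f A0 A1))
     (\<lambda>f k. ennreal (exp (- \<theta> * (L * real_of_int k)) * w (x k)) * \<kappa> f k)"
  unfolding \<kappa>_def by (rule G.sampled_wK[OF nn G.sampled_weight_slowvar])

lemma sampled_wK_al0:
  "G.sampled P (\<lambda>f u. ennreal (u powr (- \<theta>0) * a0 u) * ennreal (K_functional u f A0 A1)) (\<lambda>f k. ennreal (D.al0 k) * \<kappa> f k)"
  using sampled_wK_A[OF sv(2), of \<theta>0] unfolding D.al0_def by (simp add: mult.assoc)

lemma sampled_wK_al1:
  "G.sampled P (\<lambda>f u. ennreal (u powr (- 1) * a1 u) * ennreal (K_functional u f A0 A1)) (\<lambda>f k. ennreal (D.al1 k) * \<kappa> f k)"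
  using sampled_wK_A[OF sv(4), of 1] unfolding D.al1_def by (simp add: mult.assoc)

lemma sampled_slowvar: "slowvar w \<Longrightarrow> G.sampled Q (\<lambda>_ u. ennreal (w u)) (\<lambda>_ k. ennreal (w (x k)))"
  by (rule G.sampled_of_weight[OF G.sampled_weight_slowvar])

lemma NX0_equiv: "equiv_on P NX0 (\<lambda>f. D.N0 (\<kappa> f))"
proof -
  have s: "G.sampled P (\<lambda>f t. ennreal (b0 t) * Lq_norm q0 {t<..} (wK A0 A1 \<theta>0 q0 a0 f))
     (\<lambda>f k. ennreal (b0 (x k)) * lq q0 {k..} (\<lambda>j. ennreal (D.al0 j) * \<kappa> f j))"
    unfolding wK_split[abs_def]
    by (rule G.sampled_mult[OF sampled_slowvar[OF sv(3)] G.sampled_right[OF sampled_wK_al0 exponents(1)]])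
  show ?thesis
    using G.sampled_full[OF s exponents(2)] unfolding NX0_def[abs_def] D.N0_def wt_0 mult.assoc .
qed

lemma NX1_equiv: "equiv_on P NX1 (\<lambda>f. D.N1 (\<kappa> f))"
proof -
  have s: "G.sampled P (\<lambda>f t. ennreal (b1 t) * Lq_norm q1 {0<..<t} (wK A0 A1 1 q1 a1 f))
     (\<lambda>f k. ennreal (b1 (x k)) * lq q1 {..k} (\<lambda>j. ennreal (D.al1 j) * \<kappa> f j))"
    unfolding wK_split[abs_def]
    by (rule G.sampled_mult[OF sampled_slowvar[OF sv(5)] G.sampled_left[OF sampled_wK_al1 exponents(3)]])
  show ?thesis
    using G.sampled_full[OF s exponents(4)] unfolding NX1_def[abs_def] D.N1_def wt_0 mult.assoc .
qed

definition E :: "int \<Rightarrow> 'a \<Rightarrow> ennreal" where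
  "E n f = D.I0 n (\<kappa> f) + ennreal (D.rho n) * D.I1 n (\<kappa> f)"

text \<open>Membership in the sum is part of the conclusion: finiteness of \<open>E\<close> at a
  single n already splits f into components lying in the two extreme spaces.\<close>

lemma K_X_le:
  obtains C where "C < top" "\<forall>f\<in>P. \<forall>n. E n f < top \<longrightarrow> f \<in> sum_pts X0 X1 \<and> ennreal (K_functional (D.rho n) f X0 X1) \<le> C * E n f"
proof -
  obtain c where c: "1 \<le> c" and dec: "\<forall>t f. 0 < t \<longrightarrow> f \<in> sum_pts A0 A1 \<longrightarrow> (\<exists>f0 f1. f0 \<in> pts A0 \<and> f1 \<in> pts A1 \<and> f = f0 + f1 \<and>
     (\<forall>u>0. K_functional u f0 A0 A1 \<le> c * K_functional t f A0 A1) \<and>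
     (\<forall>u>0. u \<le> t \<longrightarrow> K_functional u f0 A0 A1 \<le> c * K_functional u f A0 A1) \<and>
     (\<forall>u>0. K_functional u f1 A0 A1 \<le> c * (u / t * K_functional t f A0 A1)) \<and>
     (\<forall>u. t \<le> u \<longrightarrow> K_functional u f1 A0 A1 \<le> c * K_functional u f A0 A1))"
    by (rule K_functional_decomposition[OF A0 A1 compat])
  obtain B0 where B0: "B0 < top" "\<forall>f\<in>P. NX0 f \<le> B0 * D.N0 (\<kappa> f)" "\<forall>f\<in>P. D.N0 (\<kappa> f) \<le> B0 * NX0 f" by (rule equiv_onE[OF NX0_equiv])
  obtain B1 where B1: "B1 < top" "\<forall>f\<in>P. NX1 f \<le> B1 * D.N1 (\<kappa> f)" "\<forall>f\<in>P. D.N1 (\<kappa> f) \<le> B1 * NX1 f" by (rule equiv_onE[OF NX1_equiv])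
  obtain S where S: "S < top" "\<forall>n \<kappa> \<kappa>0 \<kappa>1. (\<forall>j. \<kappa>0 j \<le> \<kappa> n) \<longrightarrow> (\<forall>j\<le>n. \<kappa>0 j \<le> \<kappa> j) \<longrightarrow>
     (\<forall>j\<le>n. \<kappa>1 j \<le> ennreal (exp (- L * real_of_int (n - j))) * \<kappa> n) \<longrightarrow> (\<forall>j\<ge>n. \<kappa>1 j \<le> \<kappa> j) \<longrightarrow>
     D.N0 \<kappa>0 \<le> S * D.I0 n \<kappa> \<and> D.N1 \<kappa>1 \<le> S * (D.M1 n \<kappa> + D.I1 n \<kappa>) \<and>
     D.N0 \<kappa>0 + D.rho n * D.N1 \<kappa>1 \<le> S * (D.I0 n \<kappa> + D.rho n * D.I1 n \<kappa>)"
    using D.split_upper by (elim exE conjE)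
  have c0: "0 \<le> c" using c by simp
  define B where "B = B0 + B1"
  have B: "B < top" using B0(1) B1(1) by (simp add: B_def)
  have main: "f \<in> sum_pts X0 X1 \<and> ennreal (K_functional (D.rho n) f X0 X1) \<le> B * (S * ennreal c) * E n f"
    if f: "f \<in> P" and fin: "E n f < top" for f n
  proof -
    \<comment> \<open>The splitting is made at x_n for the couple A0, A1, although the K-functional
      to be estimated is taken at rho n.\<close>
    obtain f0 f1 where d: "f0 \<in> pts A0" "f1 \<in> pts A1" "f = f0 + f1"
      "\<forall>u>0. K_functional u f0 A0 A1 \<le> c * K_functional (x n) f A0 A1"
      "\<forall>u>0. u \<le> x n \<longrightarrow> K_functional u f0 A0 A1 \<le> c * K_functional u f A0 A1"
      "\<forall>u>0. K_functional u f1 A0 A1 \<le> c * (u / x n * K_functional (x n) f A0 A1)"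
      "\<forall>u. x n \<le> u \<longrightarrow> K_functional u f1 A0 A1 \<le> c * K_functional u f A0 A1"
      using dec[rule_format, OF exp_gt_zero f, of "L * real_of_int n"] by (elim exE conjE)
    have fP: "f0 \<in> P" "f1 \<in> P" using sum_ptsI1[OF A1 d(1)] sum_ptsI2[OF A0 d(2)] .
    let ?k = "\<lambda>j. ennreal c * \<kappa> f j"
    have le: "ennreal y \<le> ennreal c * ennreal z" if "y \<le> c * z" for y z
      using that c0 by (simp flip: ennreal_mult' add: ennreal_leI)
    have xle: "x j \<le> x n" if "j \<le> n" for j n using that L by simp
    have k1: "\<forall>j. \<kappa> f0 j \<le> ?k n" unfolding \<kappa>_def using d(4) by (auto intro: le)
    have k2: "\<forall>j\<le>n. \<kappa> f0 j \<le> ?k j" unfolding \<kappa>_def using d(5) xle by (auto intro: le)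
    have k3: "\<forall>j\<le>n. \<kappa> f1 j \<le> ennreal (exp (- L * real_of_int (n - j))) * ?k n"
    proof (intro allI impI)
      fix j assume "j \<le> n"
      have "x j / x n = exp (- L * real_of_int (n - j))"
        by (simp flip: exp_diff add: algebra_simps)
      then have "K_functional (x j) f1 A0 A1 \<le> c * (exp (- L * real_of_int (n - j)) * K_functional (x n) f A0 A1)"
        using d(6)[rule_format, of "x j"] by simp
      from le[OF this] show "\<kappa> f1 j \<le> ennreal (exp (- L * real_of_int (n - j))) * ?k n"
        unfolding \<kappa>_def ennreal_mult'[OF exp_ge_zero] by (simp only: mult_ac)
    qed
    have k4: "\<forall>j\<ge>n. \<kappa> f1 j \<le> ?k j" unfolding \<kappa>_def using d(7) xle by (auto intro: le)
    note s = S(2)[rule_format, of "\<kappa> f0" ?k n "\<kappa> f1", OF k1[rule_format] k2[rule_format] k3[rule_format] k4[rule_format]]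
    have I: "D.I0 n (\<kappa> f) < top" "ennreal (D.rho n) * D.I1 n (\<kappa> f) < top" using fin by (simp_all add: E_def)
    have I1: "D.I1 n (\<kappa> f) < top" using I(2) D.rho_pos[of n] by (auto simp: ennreal_mult_less_top)
    have "S * (ennreal c * D.I0 n (\<kappa> f)) < top"
    proof -
      have "ennreal c * D.I0 n (\<kappa> f) < top" using I(1) by (simp add: ennreal_mult_less_top)
      then show ?thesis using S(1) by (simp add: ennreal_mult_less_top)
    qed
    moreover have "D.N0 (\<kappa> f0) \<le> S * (ennreal c * D.I0 n (\<kappa> f))"
      using conjunct1[OF s] unfolding D.I0_cmult .
    ultimately have N0: "D.N0 (\<kappa> f0) < top" by (rule le_less_trans[rotated])
    have "S * (ennreal c * (D.M1 n (\<kappa> f) + D.I1 n (\<kappa> f))) < top"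
    proof -
      have "D.M1 n (\<kappa> f) < top" unfolding D.M1_def \<kappa>_def by (simp add: ennreal_mult_less_top)
      then have "ennreal c * (D.M1 n (\<kappa> f) + D.I1 n (\<kappa> f)) < top" using I1 by (simp add: ennreal_mult_less_top)
      then show ?thesis using S(1) by (simp add: ennreal_mult_less_top)
    qed
    moreover have "D.N1 (\<kappa> f1) \<le> S * (ennreal c * (D.M1 n (\<kappa> f) + D.I1 n (\<kappa> f)))"
      using conjunct1[OF conjunct2[OF s]] unfolding D.I1_cmult D.M1_cmult distrib_left .
    ultimately have N1: "D.N1 (\<kappa> f1) < top" by (rule le_less_trans[rotated])
    have X0: "NX0 f0 < top" by (rule le_less_trans[OF B0(2)[rule_format, OF fP(1)]]) (use N0 B0(1) in \<open>simp add: ennreal_mult_less_top\<close>)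
    have X1: "NX1 f1 < top" by (rule le_less_trans[OF B1(2)[rule_format, OF fP(2)]]) (use N1 B1(1) in \<open>simp add: ennreal_mult_less_top\<close>)
    have pX: "f0 \<in> pts X0" "f1 \<in> pts X1" using X0 X1 fP by (simp_all add: X_simps)
    have "f \<in> sum_pts X0 X1" unfolding sum_pts_def using d(3) pX by blast
    moreover have "ennreal (K_functional (D.rho n) f X0 X1) \<le> B * (S * ennreal c) * E n f"
    proof -
      have "K_functional (D.rho n) f X0 X1 \<le> qnorm X0 f0 + D.rho n * qnorm X1 f1"
        unfolding d(3) by (rule K_functional_le[OF nnX less_imp_le[OF D.rho_pos] pX])
      then have "ennreal (K_functional (D.rho n) f X0 X1) \<le> ennreal (qnorm X0 f0 + D.rho n * qnorm X1 f1)"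
        by (rule ennreal_leI)
      also have "\<dots> = NX0 f0 + D.rho n * NX1 f1"
        using X0 X1 D.rho_pos[of n] by (simp add: X_simps ennreal_mult')
      also have "\<dots> \<le> B * D.N0 (\<kappa> f0) + D.rho n * (B * D.N1 (\<kappa> f1))"
        by (intro add_mono mult_left_mono order_trans[OF B0(2)[rule_format, OF fP(1)]] order_trans[OF B1(2)[rule_format, OF fP(2)]] mult_right_mono) (auto simp: B_def)
      also have "\<dots> = B * (D.N0 (\<kappa> f0) + D.rho n * D.N1 (\<kappa> f1))"
        by (simp only: distrib_left mult_ac)
      also have "\<dots> \<le> B * (S * (D.I0 n ?k + D.rho n * D.I1 n ?k))"
        by (intro mult_left_mono conjunct2[OF conjunct2[OF s]]) auto
      also have "\<dots> = B * (S * ennreal c) * E n f"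
        unfolding D.I0_cmult D.I1_cmult E_def by (simp only: distrib_left mult_ac)
      finally show ?thesis .
    qed
    ultimately show ?thesis by (rule conjI)
  qed
  show ?thesis
  proof (rule that[of "B * (S * ennreal c)"])
    show "B * (S * ennreal c) < top" using B S(1) by (simp add: ennreal_mult_less_top)
  qed (intro ballI allI impI main)
qed

text \<open>The bound is proved for each decomposition in the extreme couple and then passed to the
  infimum. One decomposition gives finiteness of \<open>E\<close>, so this last step takes place in
  the reals.\<close>

lemma K_X_ge:
  obtains C where "C < top" "\<forall>f\<in>sum_pts X0 X1. \<forall>n. E n f \<le> C * ennreal (K_functional (D.rho n) f X0 X1)"
proof -
  obtain c where c: "1 \<le> c" and tri: "\<forall>t f g. 0 \<le> t \<longrightarrow> f \<in> sum_pts A0 A1 \<longrightarrow> g \<in> sum_pts A0 A1 \<longrightarrow>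
    K_functional t (f + g) A0 A1 \<le> c * (K_functional t f A0 A1 + K_functional t g A0 A1)"
    by (rule K_functional_quasi_triangle[OF A0 A1])
  obtain B0 where B0: "B0 < top" "\<forall>f\<in>P. NX0 f \<le> B0 * D.N0 (\<kappa> f)" "\<forall>f\<in>P. D.N0 (\<kappa> f) \<le> B0 * NX0 f" by (rule equiv_onE[OF NX0_equiv])
  obtain B1 where B1: "B1 < top" "\<forall>f\<in>P. NX1 f \<le> B1 * D.N1 (\<kappa> f)" "\<forall>f\<in>P. D.N1 (\<kappa> f) \<le> B1 * NX1 f" by (rule equiv_onE[OF NX1_equiv])
  obtain S where S: "S < top" "\<forall>n \<kappa>0 \<kappa>1. (\<forall>j k. j \<le> k \<longrightarrow> ennreal (exp (- L * real_of_int k)) * \<kappa>1 k \<le> ennreal (exp (- L * real_of_int j)) * \<kappa>1 j) \<longrightarrow>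
     D.I0 n (\<lambda>j. \<kappa>0 j + \<kappa>1 j) + D.rho n * D.I1 n (\<lambda>j. \<kappa>0 j + \<kappa>1 j) \<le> S * (D.N0 \<kappa>0 + D.rho n * D.N1 \<kappa>1)"
    using D.split_lower by (elim exE conjE)
  have c0: "0 \<le> c" using c by simp
  define B where "B = B0 + B1"
  let ?C = "ennreal c * S * B"
  have CT: "?C < top" using B0(1) B1(1) S(1) unfolding B_def by (simp add: ennreal_mult_less_top)
  have main: "E n f \<le> ?C * ennreal (qnorm X0 f0 + D.rho n * qnorm X1 f1)"
    if p: "f0 \<in> pts X0" "f1 \<in> pts X1" and f: "f = f0 + f1" for f f0 f1 n
  proof -
    have fP: "f0 \<in> P" "f1 \<in> P" and fin: "NX0 f0 < top" "NX1 f1 < top" using p by (simp_all add: X_simps)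
    have Kn: "0 \<le> K_functional (x j) g A0 A1" if "g \<in> P" for j g
      by (rule K_functional_nonneg[OF nn exp_ge_zero that])
    have le: "\<kappa> f j \<le> ennreal c * (\<kappa> f0 j + \<kappa> f1 j)" for j
      using tri[rule_format, OF exp_ge_zero fP, of "L * real_of_int j"] Kn[OF fP(1), of j] Kn[OF fP(2), of j] c0
      unfolding \<kappa>_def f by (simp flip: ennreal_mult' ennreal_plus add: ennreal_leI)
    have q: "ennreal (exp (- L * real_of_int k)) * \<kappa> f1 k \<le> ennreal (exp (- L * real_of_int j)) * \<kappa> f1 j" if "j \<le> k" for j k
    proof -
      have "x j \<le> x k" using that L by simp
      from K_functional_quotient[OF nn exp_gt_zero this fP(2)]
      have "exp (- L * real_of_int k) * K_functional (x k) f1 A0 A1 \<le> exp (- L * real_of_int k) * (x k / x j * K_functional (x j) f1 A0 A1)"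
        by (intro mult_left_mono) auto
      also have "\<dots> = exp (- L * real_of_int j) * K_functional (x j) f1 A0 A1"
        by (simp add: exp_minus divide_inverse)
      finally show ?thesis unfolding \<kappa>_def by (simp flip: ennreal_mult' add: ennreal_leI)
    qed
    have "E n f \<le> D.I0 n (\<lambda>j. ennreal c * (\<kappa> f0 j + \<kappa> f1 j)) + D.rho n * D.I1 n (\<lambda>j. ennreal c * (\<kappa> f0 j + \<kappa> f1 j))"
      unfolding E_def by (intro add_mono mult_left_mono D.I0_mono D.I1_mono le) auto
    also have "\<dots> = ennreal c * (D.I0 n (\<lambda>j. \<kappa> f0 j + \<kappa> f1 j) + D.rho n * D.I1 n (\<lambda>j. \<kappa> f0 j + \<kappa> f1 j))"
      unfolding D.I0_cmult D.I1_cmult by (simp only: distrib_left mult_ac)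
    also have "\<dots> \<le> ennreal c * (S * (D.N0 (\<kappa> f0) + D.rho n * D.N1 (\<kappa> f1)))"
      by (intro mult_left_mono S(2)[rule_format] q) auto
    also have "\<dots> \<le> ennreal c * (S * (B * NX0 f0 + D.rho n * (B * NX1 f1)))"
      by (intro add_mono mult_left_mono order_trans[OF B0(3)[rule_format, OF fP(1)]] order_trans[OF B1(3)[rule_format, OF fP(2)]] mult_right_mono) (auto simp: B_def)
    also have "\<dots> = ?C * (NX0 f0 + D.rho n * NX1 f1)"
      by (simp only: distrib_left mult_ac)
    also have "NX0 f0 + D.rho n * NX1 f1 = ennreal (qnorm X0 f0 + D.rho n * qnorm X1 f1)"
      using fin D.rho_pos[of n] by (simp add: X_simps ennreal_mult')
    finally show ?thesis .
  qed
  have "E n f \<le> (?C + 1) * ennreal (K_functional (D.rho n) f X0 X1)" if f: "f \<in> sum_pts X0 X1" for f n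
  proof -
    \<comment> \<open>Adding 1 gives a positive real constant by which the inequality can be divided
      before the infimum is taken.\<close>
    obtain d where d: "?C + 1 = ennreal d" "0 < d"
      using that[of "enn2real ?C + 1"] CT by (metis add_nonneg_pos ennreal_1 ennreal_enn2real ennreal_plus enn2real_nonneg zero_le_one zero_less_one)
    have main': "E n f \<le> ennreal (d * (qnorm X0 f0 + D.rho n * qnorm X1 f1))"
      if p: "f0 \<in> pts X0" "f1 \<in> pts X1" "f = f0 + f1" for f0 f1
    proof -
      have "E n f \<le> (?C + 1) * ennreal (qnorm X0 f0 + D.rho n * qnorm X1 f1)"
        by (rule order_trans[OF main[OF p] mult_right_mono]) auto
      then show ?thesis using d by (simp add: ennreal_mult')
    qed
    obtain g0 g1 where g: "g0 \<in> pts X0" "g1 \<in> pts X1" "f = g0 + g1" using f by (auto simp: sum_pts_def)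
    have "E n f < top" by (rule le_less_trans[OF main'[OF g]]) simp
    then obtain e where e: "E n f = ennreal e" "0 \<le> e" by (cases "E n f") auto
    have "e / d \<le> K_functional (D.rho n) f X0 X1"
    proof (rule K_functional_greatest[OF f])
      fix f0 f1 assume p: "f0 \<in> pts X0" "f1 \<in> pts X1" "f = f0 + f1"
      have "0 \<le> qnorm X0 f0 + D.rho n * qnorm X1 f1" using nnX p D.rho_pos[of n] by (auto simp: nonneg_space_def)
      then have "e \<le> d * (qnorm X0 f0 + D.rho n * qnorm X1 f1)" using main'[OF p] d(2) unfolding e by (simp add: ennreal_le_iff)
      then show "e / d \<le> qnorm X0 f0 + D.rho n * qnorm X1 f1" using d(2) by (simp add: field_simps)
    qed
    then have "e \<le> d * K_functional (D.rho n) f X0 X1" using d(2) by (simp add: field_simps)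
    then show ?thesis unfolding e d(1) using d(2) by (simp flip: ennreal_mult' add: ennreal_leI)
  qed
  then have "\<forall>f\<in>sum_pts X0 X1. \<forall>n. E n f \<le> (?C + 1) * ennreal (K_functional (D.rho n) f X0 X1)" by (intro ballI allI)
  moreover have "?C + 1 < top" using CT by simp
  ultimately show ?thesis by (rule that[rotated])
qed

end

section \<open>The interpolation spaces\<close>

context couple_setting
begin

text \<open>The outer weight of the interpolation norm at the sampling point rho n.\<close>

definition \<omega> :: "real \<Rightarrow> int \<Rightarrow> real" where
  "\<omega> \<theta> n = D.rho n powr (- \<theta>) * a (D.rho n)"

lemma \<omega>_pos: "0 < \<omega> \<theta> n"
  using D.rho_pos[of n] slowvar_pos[OF sv(1) D.rho_pos, of n] by (simp add: \<omega>_def)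

lemma interp_norm_equiv:
  assumes r: "0 < r"
  shows "equiv_on (sum_pts X0 X1) (\<lambda>f. Lq_norm r {0<..} (wK X0 X1 \<theta> r a f))
    (\<lambda>f. lq r UNIV (\<lambda>n. ennreal (\<omega> \<theta> n) * ennreal (K_functional (D.rho n) f X0 X1)))"
proof -
  have e: "exp (ln (\<rho> (x k))) = D.rho k" for k using D.rho_pos[of k] by (simp add: rho_eq)
  have e': "exp (- \<theta> * ln (\<rho> (x k))) = D.rho k powr (- \<theta>)" for k using D.rho_pos[of k] by (simp add: rho_eq powr_def)
  have s: "R.sampled (sum_pts X0 X1) (\<lambda>f u. ennreal (u powr (- \<theta>) * a u) * ennreal (K_functional u f X0 X1))
     (\<lambda>f k. ennreal (\<omega> \<theta> k) * ennreal (K_functional (D.rho k) f X0 X1))"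
    using R.sampled_wK[OF nnX R.sampled_weight_slowvar[OF sv(1)], of \<theta>] unfolding e e' \<omega>_def .
  show ?thesis using R.sampled_full[OF s r] unfolding wK_split[abs_def] .
qed

text \<open>Each assertion of the theorem is reduced to a two-sided comparison of N with one
  sequence norm of \<open>E\<close>. In the reverse embedding a finite N f forces every E n f to be
  finite, as \<omega> is positive, and this puts f into the sum of the extreme spaces.\<close>

lemma interp_space_eq:
  assumes r: "0 < r" and B: "B < top"
    and le: "\<And>f. f \<in> P \<Longrightarrow> N f \<le> B * lq r UNIV (\<lambda>n. ennreal (\<omega> \<theta> n) * E n f)"
    and ge: "\<And>f. f \<in> P \<Longrightarrow> lq r UNIV (\<lambda>n. ennreal (\<omega> \<theta> n) * E n f) \<le> B * N f"
  shows "space_eq (interp_space X0 X1 \<theta> r a) (space_of A0 A1 N)"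
proof -
  define NI where "NI f = Lq_norm r {0<..} (wK X0 X1 \<theta> r a f)" for f
  obtain C where C: "C < top"
    "\<forall>f\<in>sum_pts X0 X1. NI f \<le> C * lq r UNIV (\<lambda>n. ennreal (\<omega> \<theta> n) * ennreal (K_functional (D.rho n) f X0 X1))"
    "\<forall>f\<in>sum_pts X0 X1. lq r UNIV (\<lambda>n. ennreal (\<omega> \<theta> n) * ennreal (K_functional (D.rho n) f X0 X1)) \<le> C * NI f"
    unfolding NI_def by (rule equiv_onE[OF interp_norm_equiv[OF r]])
  obtain U where U: "U < top" "\<forall>f\<in>P. \<forall>n. E n f < top \<longrightarrow> f \<in> sum_pts X0 X1 \<and> ennreal (K_functional (D.rho n) f X0 X1) \<le> U * E n f"
    by (rule K_X_le)
  obtain V where V: "V < top" "\<forall>f\<in>sum_pts X0 X1. \<forall>n. E n f \<le> V * ennreal (K_functional (D.rho n) f X0 X1)"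
    by (rule K_X_ge)
  have 1: "N f \<le> B * V * C * NI f" if f: "f \<in> sum_pts X0 X1" for f
  proof -
    have "N f \<le> B * lq r UNIV (\<lambda>n. ennreal (\<omega> \<theta> n) * E n f)" using le f sum_pts_X by auto
    also have "\<dots> \<le> B * lq r UNIV (\<lambda>n. V * (ennreal (\<omega> \<theta> n) * ennreal (K_functional (D.rho n) f X0 X1)))"
      unfolding mult.left_commute[of V] by (intro mult_left_mono lq_mono r V(2)[rule_format] f) auto
    also have "\<dots> \<le> B * (V * (C * NI f))"
      unfolding lq_cmult[OF r] by (intro mult_left_mono C(3)[rule_format] f) auto
    finally show ?thesis by (simp only: mult.assoc)
  qed
  have 2: "f \<in> sum_pts X0 X1 \<and> NI f \<le> C * U * B * N f" if f: "f \<in> P" and fin: "N f < top" for f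
  proof -
    have lfin: "lq r UNIV (\<lambda>n. ennreal (\<omega> \<theta> n) * E n f) < top"
      by (rule le_less_trans[OF ge[OF f]]) (use B fin in \<open>simp add: ennreal_mult_less_top\<close>)
    have Efin: "E n f < top" for n
    proof -
      have "ennreal (\<omega> \<theta> n) * E n f < top"
        by (rule le_less_trans[OF lq_point[OF r UNIV_I, of "\<lambda>n. ennreal (\<omega> \<theta> n) * E n f"] lfin])
      then show ?thesis using \<omega>_pos[of \<theta> n] by (auto simp: ennreal_mult_less_top)
    qed
    note K = U(2)[rule_format, OF f Efin]
    have fX: "f \<in> sum_pts X0 X1" by (rule conjunct1[OF K])
    have "NI f \<le> C * lq r UNIV (\<lambda>n. ennreal (\<omega> \<theta> n) * ennreal (K_functional (D.rho n) f X0 X1))"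
      by (rule C(2)[rule_format, OF fX])
    also have "\<dots> \<le> C * lq r UNIV (\<lambda>n. U * (ennreal (\<omega> \<theta> n) * E n f))"
      unfolding mult.left_commute[of U] by (intro mult_left_mono lq_mono r conjunct2[OF K]) auto
    also have "\<dots> \<le> C * (U * (B * N f))"
      unfolding lq_cmult[OF r] by (intro mult_left_mono ge f) auto
    finally show ?thesis using fX by (simp only: mult.assoc simp_thms)
  qed
  have real: "enn2real y \<le> enn2real c * enn2real w" if "y \<le> c * w" "c < top" "w < top" for y c w :: ennreal
  proof -
    have "enn2real y \<le> enn2real (c * w)" using that by (intro enn2real_mono) (simp_all add: ennreal_mult_less_top)
    then show ?thesis by (simp add: enn2real_mult)
  qed
  have cB: "B * V * C < top" "C * U * B < top" using B C(1) U(1) V(1) by (simp_all add: ennreal_mult_less_top)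
  have pts: "pts (interp_space X0 X1 \<theta> r a) = {f \<in> sum_pts X0 X1. NI f < top}" "pts (space_of A0 A1 N) = {f \<in> P. N f < top}"
    "qnorm (interp_space X0 X1 \<theta> r a) = (\<lambda>f. enn2real (NI f))" "qnorm (space_of A0 A1 N) = (\<lambda>f. enn2real (N f))"
    by (simp_all add: interp_space_def space_of_def NI_def)
  have c1: "cont_embedded (interp_space X0 X1 \<theta> r a) (space_of A0 A1 N)"
    unfolding cont_embedded_def pts
  proof (intro conjI exI ballI subsetI)
    fix f assume f: "f \<in> {f \<in> sum_pts X0 X1. NI f < top}"
    then show "enn2real (N f) \<le> enn2real (B * V * C) * enn2real (NI f)" using 1 cB by (intro real) auto
    have "B * V * C * NI f < top" using cB f by (simp add: ennreal_mult_less_top)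
    then show "f \<in> {f \<in> P. N f < top}" using 1[of f] f sum_pts_X by (auto intro: le_less_trans)
  qed
  have c2: "cont_embedded (space_of A0 A1 N) (interp_space X0 X1 \<theta> r a)"
    unfolding cont_embedded_def pts
  proof (intro conjI exI ballI subsetI)
    fix f assume f: "f \<in> {f \<in> P. N f < top}"
    then show "enn2real (NI f) \<le> enn2real (C * U * B) * enn2real (N f)" using 2 cB by (intro real) auto
    have "C * U * B * N f < top" using cB f by (simp add: ennreal_mult_less_top)
    then show "f \<in> {f \<in> sum_pts X0 X1. NI f < top}" using 2[of f] f by (auto intro: le_less_trans)
  qed
  show ?thesis unfolding space_eq_def using c1 c2 by (rule conjI)
qed

text \<open>\<open>T0\<close> and \<open>T1\<close> are the outer norms of the two parts of
  \<open>E\<close>: at \<theta> = 0 the first will be the RL norm, at \<theta> = 1 the second the LR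
  norm. \<open>TM\<close> will be the norm with weight asharp.\<close>

definition T0 :: "ennreal \<Rightarrow> real \<Rightarrow> 'a \<Rightarrow> ennreal" where
  "T0 r \<theta> f = lq r UNIV (\<lambda>n. ennreal (\<omega> \<theta> n) * D.I0 n (\<kappa> f))"
definition T1 :: "ennreal \<Rightarrow> real \<Rightarrow> 'a \<Rightarrow> ennreal" where
  "T1 r \<theta> f = lq r UNIV (\<lambda>n. ennreal (\<omega> \<theta> n * D.rho n) * D.I1 n (\<kappa> f))"
definition TM :: "ennreal \<Rightarrow> real \<Rightarrow> 'a \<Rightarrow> ennreal" where
  "TM r \<theta> f = lq r UNIV (\<lambda>n. ennreal (\<omega> \<theta> n) * D.M0 n (\<kappa> f))"

lemma E_norm_le:
  assumes r: "0 < r"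
  obtains C where "C < top" "\<forall>f. lq r UNIV (\<lambda>n. ennreal (\<omega> \<theta> n) * E n f) \<le> C * (T0 r \<theta> f + T1 r \<theta> f)"
proof -
  obtain C where C: "C < top" "\<forall>S f g. lq r S (\<lambda>k. f k + g k) \<le> C * (lq r S f + lq r S g)"
    using lq_add_le[OF r] by (elim exE conjE)
  have e: "ennreal (\<omega> \<theta> n) * E n f = ennreal (\<omega> \<theta> n) * D.I0 n (\<kappa> f) + ennreal (\<omega> \<theta> n * D.rho n) * D.I1 n (\<kappa> f)" for n f
    unfolding E_def distrib_left using \<omega>_pos[of \<theta> n] by (simp add: ennreal_mult' mult.assoc)
  have "lq r UNIV (\<lambda>n. ennreal (\<omega> \<theta> n) * E n f) \<le> C * (T0 r \<theta> f + T1 r \<theta> f)" for f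
    unfolding e T0_def T1_def by (rule C(2)[rule_format])
  then show ?thesis by (intro that[OF C(1)] allI)
qed

lemma T_le_E_norm:
  assumes r: "0 < r"
  shows "T0 r \<theta> f \<le> lq r UNIV (\<lambda>n. ennreal (\<omega> \<theta> n) * E n f)" "T1 r \<theta> f \<le> lq r UNIV (\<lambda>n. ennreal (\<omega> \<theta> n) * E n f)"
proof -
  show "T0 r \<theta> f \<le> lq r UNIV (\<lambda>n. ennreal (\<omega> \<theta> n) * E n f)"
    unfolding T0_def E_def by (intro lq_mono r mult_left_mono) auto
  have e: "ennreal (\<omega> \<theta> n * D.rho n) * D.I1 n (\<kappa> f) = ennreal (\<omega> \<theta> n) * (ennreal (D.rho n) * D.I1 n (\<kappa> f))" for n
    using \<omega>_pos[of \<theta> n] by (simp add: ennreal_mult' mult.assoc)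
  show "T1 r \<theta> f \<le> lq r UNIV (\<lambda>n. ennreal (\<omega> \<theta> n) * E n f)"
    unfolding T1_def E_def e by (intro lq_mono r mult_left_mono) auto
qed

section \<open>Exponents of the outer weights and absorption of terms\<close>

lemma sv_seq_a_rho: "sv_seq (\<lambda>n. a (D.rho n))"
proof -
  define w where "w k = \<chi>0 (x k) / \<chi>1 (x k)" for k
  have w: "sv_seq w" unfolding w_def by (rule sv_seq_divide[OF D.\<chi>0 D.\<chi>1])
  obtain C where C: "\<forall>n m. ln (w n) \<le> ln (w m) + 1 * \<bar>real_of_int (n - m)\<bar> + C"
    using conjunct2[OF w[unfolded sv_seq_def], THEN spec, THEN mp, OF zero_less_one] by (rule exE)
  define c where "c = (1 - \<theta>0) * L"
  have c: "0 \<le> c" using \<theta>0 L by (simp add: c_def)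
  have ln: "ln (D.rho k) = c * real_of_int k + ln (w k)" for k
    using sv_seq_pos[OF w, of k] unfolding D.rho_def w_def[symmetric] by (simp add: ln_mult c_def)
  show ?thesis
  proof (rule sv_seq_slowvar_comp[OF sv(1) D.rho_pos])
    fix n m
    have "c * real_of_int n - c * real_of_int m = c * real_of_int (n - m)" by (simp add: algebra_simps)
    then have "\<bar>c * real_of_int n - c * real_of_int m\<bar> = c * \<bar>real_of_int (n - m)\<bar>" using c by (simp add: abs_mult)
    moreover have "\<bar>ln (w n) - ln (w m)\<bar> \<le> \<bar>real_of_int (n - m)\<bar> + C"
      using C[rule_format, of n m] C[rule_format, of m n] by (simp add: abs_minus_commute)
    ultimately show "\<bar>ln (D.rho n) - ln (D.rho m)\<bar> \<le> (c + 1) * \<bar>real_of_int (n - m)\<bar> + C"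
      using abs_triangle_ineq[of "c * real_of_int n - c * real_of_int m" "ln (w n) - ln (w m)"]
      unfolding ln distrib_right add_diff_add mult_1 by linarith
  qed
qed

lemma rho_powr: "D.rho n powr s = exp (s * (1 - \<theta>0) * L * n) * (\<chi>0 (x n) / \<chi>1 (x n)) powr s"
  unfolding D.rho_def powr_mult powr_exp_eq by (simp only: mult.assoc)

text \<open>The exponent is - \<theta> (1 - \<theta>0). It vanishes at \<theta> = 0, and with it the
  left Hardy inequality.\<close>

lemma dec_\<omega>: "0 < \<theta> \<Longrightarrow> dec_seq (\<omega> \<theta>)"
  by (rule dec_seqI[OF sv_seq_mult[OF sv_seq_powr[OF sv_seq_divide[OF D.\<chi>0 D.\<chi>1], of "- \<theta>"] sv_seq_a_rho], of "- \<theta> * (1 - \<theta>0) * L"])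
     (use \<theta>0 L in \<open>auto simp: \<omega>_def rho_powr mult.assoc\<close>)

text \<open>The exponent is (1 - \<theta>) (1 - \<theta>0). It vanishes at \<theta> = 1, and with it
  the right Hardy inequality.\<close>

lemma inc_\<omega>_rho: "\<theta> < 1 \<Longrightarrow> inc_seq (\<lambda>n. \<omega> \<theta> n * D.rho n)"
proof (rule inc_seqI[OF sv_seq_mult[OF sv_seq_powr[OF sv_seq_divide[OF D.\<chi>0 D.\<chi>1], of "1 - \<theta>"] sv_seq_a_rho], of "(1 - \<theta>) * (1 - \<theta>0) * L"])
  fix n
  have "D.rho n powr (1 - \<theta>) = D.rho n powr (- \<theta>) * D.rho n"
    using D.rho_pos[of n] by (simp add: powr_diff powr_minus divide_inverse)
  then have "\<omega> \<theta> n * D.rho n = D.rho n powr (1 - \<theta>) * a (D.rho n)" by (simp add: \<omega>_def)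
  then show "\<omega> \<theta> n * D.rho n = exp ((1 - \<theta>) * (1 - \<theta>0) * L * n) * ((\<chi>0 (x n) / \<chi>1 (x n)) powr (1 - \<theta>) * a (D.rho n))"
    unfolding rho_powr by (simp only: mult.assoc)
qed (use \<theta>0 L in simp)

lemma T0_le_TM:
  assumes "0 < r" "0 < \<theta>" obtains C where "C < top" "\<forall>f. T0 r \<theta> f \<le> C * TM r \<theta> f"
proof -
  obtain C where C: "C < top" "\<forall>\<kappa>. lq r UNIV (\<lambda>n. \<omega> \<theta> n * D.I0 n \<kappa>) \<le> C * lq r UNIV (\<lambda>n. \<omega> \<theta> n * D.M0 n \<kappa>)"
    using D.hardy_left[OF dec_\<omega>[OF assms(2)] assms(1)] by (elim exE conjE)
  have "T0 r \<theta> f \<le> C * TM r \<theta> f" for f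
    unfolding T0_def TM_def by (rule C(2)[rule_format])
  then show ?thesis by (intro that[OF C(1)] allI)
qed

text \<open>The right Hardy inequality bounds by \<open>M1\<close> with weight \<omega> * rho, which
  \<open>rho_M1\<close> turns into \<open>M0\<close> with weight \<omega>.\<close>

lemma T1_le_TM:
  assumes "0 < r" "\<theta> < 1" obtains C where "C < top" "\<forall>f. T1 r \<theta> f \<le> C * TM r \<theta> f"
proof -
  obtain C where C: "C < top" "\<forall>\<kappa>. lq r UNIV (\<lambda>n. ennreal (\<omega> \<theta> n * D.rho n) * D.I1 n \<kappa>) \<le> C * lq r UNIV (\<lambda>n. ennreal (\<omega> \<theta> n * D.rho n) * D.M1 n \<kappa>)"
    using D.hardy_right[OF inc_\<omega>_rho[OF assms(2)] assms(1)] by (elim exE conjE)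
  have e: "ennreal (\<omega> \<theta> n * D.rho n) * D.M1 n \<kappa> = ennreal (\<omega> \<theta> n) * D.M0 n \<kappa>" for n \<kappa>
    unfolding D.rho_M1[symmetric] using \<omega>_pos[of \<theta> n] by (simp add: ennreal_mult' mult.assoc)
  have "T1 r \<theta> f \<le> C * TM r \<theta> f" for f
    unfolding T1_def TM_def by (rule C(2)[rule_format, unfolded e])
  then show ?thesis by (intro that[OF C(1)] allI)
qed

lemma TM_le_T0:
  assumes "0 < r" obtains C where "C < top" "\<forall>f. TM r \<theta> f \<le> C * T0 r \<theta> f"
proof -
  obtain C where C: "C < top" "\<forall>n \<kappa>. D.M0 n \<kappa> \<le> C * D.I0 n \<kappa>"
    using D.M0_le_I0 by (elim exE conjE)
  have "TM r \<theta> f \<le> C * T0 r \<theta> f" for f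
    unfolding TM_def T0_def lq_cmult[OF assms, symmetric] mult.left_commute[of C]
    by (intro lq_mono assms mult_left_mono C(2)[rule_format]) auto
  then show ?thesis by (intro that[OF C(1)] allI)
qed

lemma sampled_weight_\<rho>: "G.sampled_weight \<rho>"
proof (rule G.sampled_weight_cong)
  show "G.sampled_weight (\<lambda>t. t powr (1 - \<theta>0) * (\<chi>0 t * \<chi>1 t powr (- 1)))"
    by (intro G.sampled_weight_mult G.sampled_weight_powr G.sampled_weight_id weights_discretised(2,3) L)
  show "\<rho> t = t powr (1 - \<theta>0) * (\<chi>0 t * \<chi>1 t powr (- 1))" if "0 < t" for t
    using G.sampled_weight_pos[OF weights_discretised(3)[OF L] that] unfolding \<rho>[OF that]
    by (simp add: powr_minus divide_inverse)
qed

lemma sampled_weight_a_\<rho>: "G.sampled_weight (a \<circ> \<rho>)"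
  unfolding comp_def by (rule G.sampled_weight_slowvar_comp[OF sv(1) sampled_weight_\<rho>])

text \<open>Since \<eta> = \<theta>0 + \<theta> (1 - \<theta>0) and \<chi>0^(1-\<theta>)
  \<chi>1^\<theta> = \<chi>0 (\<chi>0 / \<chi>1)^(-\<theta>), the sampled weight is exactly \<omega>
  \<theta> times the weight of \<open>M0\<close>. This is the origin of \<eta> and asharp.\<close>

lemma asharp_norm_equiv:
  assumes r: "0 < r" and as: "\<And>t. 0 < t \<Longrightarrow> as t = \<chi>0 t powr (1 - \<theta>) * \<chi>1 t powr \<theta> * (a \<circ> \<rho>) t"
  shows "equiv_on P (Lq_norm r {0<..} \<circ> wK A0 A1 ((1 - \<theta>) * \<theta>0 + \<theta>) r as) (TM r \<theta>)"
proof -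
  let ?\<eta> = "(1 - \<theta>) * \<theta>0 + \<theta>"
  have w: "G.sampled_weight as"
    by (rule G.sampled_weight_cong[OF _ as])
      (intro G.sampled_weight_mult G.sampled_weight_powr sampled_weight_a_\<rho> weights_discretised(2,3) L)
  have e: "ennreal (exp (- ?\<eta> * (L * real_of_int k)) * as (x k)) * ennreal (K_functional (x k) f A0 A1) = ennreal (\<omega> \<theta> k) * D.M0 k (\<kappa> f)" for k f
  proof -
    have p: "0 < \<chi>0 (x k)" "0 < \<chi>1 (x k)" by (rule D.pos)+
    have ex: "exp (- ?\<eta> * (L * real_of_int k)) = exp (- \<theta> * (1 - \<theta>0) * L * k) * exp (- \<theta>0 * L * k)"
      by (simp flip: exp_add add: algebra_simps)
    have "\<chi>0 (x k) powr (1 - \<theta>) * \<chi>1 (x k) powr \<theta> = (\<chi>0 (x k) / \<chi>1 (x k)) powr (- \<theta>) * \<chi>0 (x k)"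
      using p by (simp add: powr_mult inverse_powr powr_diff powr_minus divide_inverse)
    then have "exp (- ?\<eta> * (L * real_of_int k)) * as (x k) = \<omega> \<theta> k * (exp (- \<theta>0 * L * k) * \<chi>0 (x k))"
      unfolding as[OF exp_gt_zero] ex \<omega>_def rho_powr comp_def rho_eq by simp
    then show ?thesis
      unfolding D.M0_def \<kappa>_def using \<omega>_pos[of \<theta> k] by (intro ennreal_split) auto
  qed
  have s: "G.sampled P (\<lambda>f u. ennreal (u powr (- ?\<eta>) * as u) * ennreal (K_functional u f A0 A1)) (\<lambda>f k. ennreal (\<omega> \<theta> k) * D.M0 k (\<kappa> f))"
    using G.sampled_wK[OF nn w, of ?\<eta>] unfolding e .
  show ?thesis using G.sampled_full[OF s r] unfolding wK_split[abs_def] TM_def[abs_def] comp_def .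
qed

definition NRL :: "ennreal \<Rightarrow> 'a \<Rightarrow> ennreal" where
  "NRL r f = Lq_norm r {0<..} (\<lambda>t. wt 0 r (a \<circ> \<rho>) t *
       Lq_norm r0 {0<..<t} (\<lambda>u. wt 0 r0 b0 u * Lq_norm q0 {u<..<t} (wK A0 A1 \<theta>0 q0 a0 f)))"

definition NLR :: "ennreal \<Rightarrow> 'a \<Rightarrow> ennreal" where
  "NLR r f = Lq_norm r {0<..} (\<lambda>t. wt 0 r (a \<circ> \<rho>) t *
       Lq_norm r1 {t<..} (\<lambda>u. wt 0 r1 b1 u * Lq_norm q1 {t<..<u} (wK A0 A1 1 q1 a1 f)))"

text \<open>At \<theta> = 0 the power of rho is absent; at \<theta> = 1 it cancels against the
  factor rho in front of \<open>I1\<close>. So the same outer weight a \<circ> \<rho> appears in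
  both limiting cases.\<close>

lemma a_\<rho>: "(a \<circ> \<rho>) (x k) = \<omega> 0 k" "(a \<circ> \<rho>) (x k) = \<omega> 1 k * D.rho k"
  using D.rho_pos[of k] by (simp_all add: \<omega>_def rho_eq powr_minus)

lemma NRL_equiv:
  assumes r: "0 < r" shows "equiv_on P (NRL r) (T0 r 0)"
proof -
  have s: "G.sampled P (\<lambda>f t. ennreal ((a \<circ> \<rho>) t) * Lq_norm r0 {0<..<t} (\<lambda>u. wt 0 r0 b0 u * Lq_norm q0 {u<..<t} (wK A0 A1 \<theta>0 q0 a0 f)))
     (\<lambda>f k. ennreal (\<omega> 0 k) * D.I0 k (\<kappa> f))"
    using G.sampled_mult[OF G.sampled_of_weight[OF sampled_weight_a_\<rho>] G.sampled_right_left[OF sampled_wK_al0 sampled_slowvar[OF sv(3)] exponents(1,2)]]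
    unfolding a_\<rho>(1) D.I0_def wK_split[abs_def] wt_0 mult.assoc .
  show ?thesis
    using G.sampled_full[OF s r] unfolding NRL_def[abs_def] T0_def[abs_def] wt_0[of r] mult.assoc .
qed

lemma NLR_equiv:
  assumes r: "0 < r" shows "equiv_on P (NLR r) (T1 r 1)"
proof -
  have s: "G.sampled P (\<lambda>f t. ennreal ((a \<circ> \<rho>) t) * Lq_norm r1 {t<..} (\<lambda>u. wt 0 r1 b1 u * Lq_norm q1 {t<..<u} (wK A0 A1 1 q1 a1 f)))
     (\<lambda>f k. ennreal (\<omega> 1 k * D.rho k) * D.I1 k (\<kappa> f))"
    using G.sampled_mult[OF G.sampled_of_weight[OF sampled_weight_a_\<rho>] G.sampled_left_right[OF sampled_wK_al1 sampled_slowvar[OF sv(5)] exponents(3,4)]]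
    unfolding a_\<rho>(2) D.I1_def wK_split[abs_def] wt_0 mult.assoc .
  show ?thesis
    using G.sampled_full[OF s r] unfolding NLR_def[abs_def] T1_def[abs_def] wt_0[of r] mult.assoc .
qed

text \<open>Both Hardy inequalities hold, and \<open>TM\<close> is bounded by \<open>T0\<close>, so
  the whole norm of \<open>E\<close> is equivalent to \<open>TM\<close>.\<close>

lemma interp_theta_interior:
  assumes r: "0 < r" and \<theta>: "0 < \<theta>" "\<theta> < 1"
    and as: "\<And>t. 0 < t \<Longrightarrow> as t = \<chi>0 t powr (1 - \<theta>) * \<chi>1 t powr \<theta> * (a \<circ> \<rho>) t"
  shows "space_eq (interp_space X0 X1 \<theta> r a) (interp_space A0 A1 ((1 - \<theta>) * \<theta>0 + \<theta>) r as)"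
proof -
  define N where "N = Lq_norm r {0<..} \<circ> wK A0 A1 ((1 - \<theta>) * \<theta>0 + \<theta>) r as"
  obtain B where B: "B < top" "\<forall>f\<in>P. N f \<le> B * TM r \<theta> f" "\<forall>f\<in>P. TM r \<theta> f \<le> B * N f"
    by (rule equiv_onE[OF asharp_norm_equiv[OF r as, folded N_def]])
  obtain C where C: "C < top" "\<forall>f. lq r UNIV (\<lambda>n. ennreal (\<omega> \<theta> n) * E n f) \<le> C * (T0 r \<theta> f + T1 r \<theta> f)" by (rule E_norm_le[OF r])
  obtain D0 where D0: "D0 < top" "\<forall>f. T0 r \<theta> f \<le> D0 * TM r \<theta> f" by (rule T0_le_TM[OF r \<theta>(1)])
  obtain D1 where D1: "D1 < top" "\<forall>f. T1 r \<theta> f \<le> D1 * TM r \<theta> f" by (rule T1_le_TM[OF r \<theta>(2)])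
  obtain D2 where D2: "D2 < top" "\<forall>f. TM r \<theta> f \<le> D2 * T0 r \<theta> f" by (rule TM_le_T0[OF r])
  define c where "c = B * D2 + C * (D0 + D1) * B"
  have c: "c < top" using B(1) C(1) D0(1) D1(1) D2(1) by (simp add: c_def ennreal_mult_less_top)
  have "space_eq (interp_space X0 X1 \<theta> r a) (space_of A0 A1 N)"
  proof (rule interp_space_eq[OF r c])
    fix f assume f: "f \<in> P"
    let ?E = "lq r UNIV (\<lambda>n. ennreal (\<omega> \<theta> n) * E n f)"
    have "N f \<le> B * (D2 * ?E)"
      by (intro order_trans[OF B(2)[rule_format, OF f]] mult_left_mono order_trans[OF D2(2)[rule_format]] T_le_E_norm r) auto
    also have "\<dots> \<le> c * ?E" unfolding c_def mult.assoc[symmetric] by (intro mult_right_mono) auto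
    finally show "N f \<le> c * ?E" .
    have "?E \<le> C * (D0 * TM r \<theta> f + D1 * TM r \<theta> f)"
      by (intro order_trans[OF C(2)[rule_format]] mult_left_mono add_mono D0(2)[rule_format] D1(2)[rule_format]) auto
    also have "\<dots> = C * (D0 + D1) * TM r \<theta> f" by (simp only: distrib_right mult.assoc)
    also have "\<dots> \<le> C * (D0 + D1) * (B * N f)" by (intro mult_left_mono B(3)[rule_format, OF f]) auto
    also have "\<dots> \<le> c * N f" unfolding c_def mult.assoc[symmetric] by (intro mult_right_mono) auto
    finally show "?E \<le> c * N f" .
  qed
  then show ?thesis unfolding N_def comp_def interp_space_def[of A0 A1] .
qed

text \<open>Only \<open>T1\<close> can be absorbed: it is bounded by \<open>TM\<close>, and
  \<open>TM\<close> by \<open>T0\<close>, which is the RL norm.\<close>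

lemma interp_theta_0:
  assumes r: "0 < r"
  shows "space_eq (interp_space X0 X1 0 r a) (RL_space A0 A1 \<theta>0 r (a \<circ> \<rho>) r0 b0 q0 a0)"
proof -
  obtain B where B: "B < top" "\<forall>f\<in>P. NRL r f \<le> B * T0 r 0 f" "\<forall>f\<in>P. T0 r 0 f \<le> B * NRL r f"
    by (rule equiv_onE[OF NRL_equiv[OF r]])
  obtain C where C: "C < top" "\<forall>f. lq r UNIV (\<lambda>n. ennreal (\<omega> 0 n) * E n f) \<le> C * (T0 r 0 f + T1 r 0 f)" by (rule E_norm_le[OF r])
  obtain D1 where D1: "D1 < top" "\<forall>f. T1 r 0 f \<le> D1 * TM r 0 f" by (rule T1_le_TM[OF r zero_less_one])
  obtain D2 where D2: "D2 < top" "\<forall>f. TM r 0 f \<le> D2 * T0 r 0 f" by (rule TM_le_T0[OF r])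
  define c where "c = B + C * (1 + D1 * D2) * B"
  have c: "c < top" using B(1) C(1) D1(1) D2(1) by (simp add: c_def ennreal_mult_less_top)
  have "space_eq (interp_space X0 X1 0 r a) (space_of A0 A1 (NRL r))"
  proof (rule interp_space_eq[OF r c])
    fix f assume f: "f \<in> P"
    let ?E = "lq r UNIV (\<lambda>n. ennreal (\<omega> 0 n) * E n f)"
    have "NRL r f \<le> B * ?E"
      by (intro order_trans[OF B(2)[rule_format, OF f]] mult_left_mono T_le_E_norm r) auto
    also have "\<dots> \<le> c * ?E" unfolding c_def by (intro mult_right_mono) auto
    finally show "NRL r f \<le> c * ?E" .
    have "?E \<le> C * (1 * T0 r 0 f + D1 * (D2 * T0 r 0 f))"
      by (intro order_trans[OF C(2)[rule_format]] mult_left_mono add_mono order_trans[OF D1(2)[rule_format]] D2(2)[rule_format]) auto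
    also have "\<dots> = C * (1 + D1 * D2) * T0 r 0 f" by (simp only: distrib_right mult.assoc)
    also have "\<dots> \<le> C * (1 + D1 * D2) * (B * NRL r f)" by (intro mult_left_mono B(3)[rule_format, OF f]) auto
    also have "\<dots> \<le> c * NRL r f" unfolding c_def mult.assoc[symmetric] by (intro mult_right_mono) auto
    finally show "?E \<le> c * NRL r f" .
  qed
  then show ?thesis unfolding NRL_def[abs_def] RL_space_def .
qed

text \<open>\<open>interp_space_eq\<close> compares with a single [0,\<infinity>]-valued norm, so
  the intersection is first written with the maximum of two such norms. On its points both are
  finite, and \<open>enn2real\<close> commutes with the maximum.\<close>

lemma inter_space_of:
  "space_eq X (space_of A0 A1 (\<lambda>f. max (N f) (N' f))) \<longleftrightarrow> space_eq X (inter_space (space_of A0 A1 N) (space_of A0 A1 N'))"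
proof -
  have pts: "pts (inter_space (space_of A0 A1 N) (space_of A0 A1 N')) = pts (space_of A0 A1 (\<lambda>f. max (N f) (N' f)))"
    by (auto simp: inter_space_def space_of_def)
  have "enn2real (max y z) = max (enn2real y) (enn2real z)" if "y < top" "z < top" for y z :: ennreal
    using that by (auto simp: max_def enn2real_mono intro!: antisym)
  then have q: "qnorm (inter_space (space_of A0 A1 N) (space_of A0 A1 N')) f = qnorm (space_of A0 A1 (\<lambda>f. max (N f) (N' f))) f"
    if "f \<in> pts (space_of A0 A1 (\<lambda>f. max (N f) (N' f)))" for f
    using that by (simp add: inter_space_def space_of_def)
  have "cont_embedded X (inter_space (space_of A0 A1 N) (space_of A0 A1 N')) \<longleftrightarrow> cont_embedded X (space_of A0 A1 (\<lambda>f. max (N f) (N' f)))"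
    unfolding cont_embedded_def pts
  proof (rule conj_cong[OF refl])
    assume "pts X \<subseteq> pts (space_of A0 A1 (\<lambda>f. max (N f) (N' f)))"
    then have "qnorm (inter_space (space_of A0 A1 N) (space_of A0 A1 N')) f = qnorm (space_of A0 A1 (\<lambda>f. max (N f) (N' f))) f"
      if "f \<in> pts X" for f using q that by blast
    then show "(\<exists>C. \<forall>f\<in>pts X. qnorm (inter_space (space_of A0 A1 N) (space_of A0 A1 N')) f \<le> C * qnorm X f)
      \<longleftrightarrow> (\<exists>C. \<forall>f\<in>pts X. qnorm (space_of A0 A1 (\<lambda>f. max (N f) (N' f))) f \<le> C * qnorm X f)" by simp
  qed
  moreover have "cont_embedded (inter_space (space_of A0 A1 N) (space_of A0 A1 N')) X \<longleftrightarrow> cont_embedded (space_of A0 A1 (\<lambda>f. max (N f) (N' f))) X"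
    unfolding cont_embedded_def pts using q by simp
  ultimately show ?thesis by (simp add: space_eq_def)
qed

text \<open>\<open>T0\<close> is equivalent to \<open>TM\<close>, the norm with weight asharp.
  \<open>T1\<close> is not absorbed and remains as the LR norm; hence the intersection.\<close>

lemma interp_theta_1:
  assumes r: "0 < r"
    and as: "\<And>t. 0 < t \<Longrightarrow> as t = \<chi>0 t powr (1 - 1) * \<chi>1 t powr 1 * (a \<circ> \<rho>) t"
  shows "space_eq (interp_space X0 X1 1 r a)
     (inter_space (interp_space A0 A1 1 r as) (LR_space A0 A1 1 r (a \<circ> \<rho>) r1 b1 q1 a1))"
proof -
  define N where "N = Lq_norm r {0<..} \<circ> wK A0 A1 1 r as"
  \<comment> \<open>The index (1 - \<theta>) \<theta>0 + \<theta> equals 1 at \<theta> = 1; the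
    unfolding makes this syntactic.\<close>
  obtain B where B: "B < top" "\<forall>f\<in>P. N f \<le> B * TM r 1 f" "\<forall>f\<in>P. TM r 1 f \<le> B * N f"
    by (rule equiv_onE[OF asharp_norm_equiv[OF r as, unfolded diff_self mult_zero_left add_0, folded N_def]])
  obtain B' where B': "B' < top" "\<forall>f\<in>P. NLR r f \<le> B' * T1 r 1 f" "\<forall>f\<in>P. T1 r 1 f \<le> B' * NLR r f"
    by (rule equiv_onE[OF NLR_equiv[OF r]])
  obtain C where C: "C < top" "\<forall>f. lq r UNIV (\<lambda>n. ennreal (\<omega> 1 n) * E n f) \<le> C * (T0 r 1 f + T1 r 1 f)" by (rule E_norm_le[OF r])
  obtain D0 where D0: "D0 < top" "\<forall>f. T0 r 1 f \<le> D0 * TM r 1 f" by (rule T0_le_TM[OF r zero_less_one])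
  obtain D2 where D2: "D2 < top" "\<forall>f. TM r 1 f \<le> D2 * T0 r 1 f" by (rule TM_le_T0[OF r])
  define c where "c = B * D2 + B' + C * (D0 * B + B')"
  have c: "c < top" using B(1) B'(1) C(1) D0(1) D2(1) by (simp add: c_def ennreal_mult_less_top)
  have "space_eq (interp_space X0 X1 1 r a) (space_of A0 A1 (\<lambda>f. max (N f) (NLR r f)))"
  proof (rule interp_space_eq[OF r c])
    fix f assume f: "f \<in> P"
    let ?E = "lq r UNIV (\<lambda>n. ennreal (\<omega> 1 n) * E n f)"
    let ?M = "max (N f) (NLR r f)"
    have "N f \<le> B * (D2 * ?E)"
      by (intro order_trans[OF B(2)[rule_format, OF f]] mult_left_mono order_trans[OF D2(2)[rule_format]] T_le_E_norm r) auto
    also have "\<dots> \<le> c * ?E" unfolding c_def mult.assoc[symmetric] by (intro mult_right_mono) (auto simp: add.assoc)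
    finally have 1: "N f \<le> c * ?E" .
    have "NLR r f \<le> B' * ?E"
      by (intro order_trans[OF B'(2)[rule_format, OF f]] mult_left_mono T_le_E_norm r) auto
    also have "\<dots> \<le> c * ?E" unfolding c_def by (intro mult_right_mono) (auto simp: add_increasing add_increasing2)
    finally show "?M \<le> c * ?E" using 1 by simp
    have "?E \<le> C * (D0 * (B * N f) + B' * NLR r f)"
      by (intro order_trans[OF C(2)[rule_format]] mult_left_mono add_mono order_trans[OF D0(2)[rule_format]] B(3)[rule_format, OF f] B'(3)[rule_format, OF f]) auto
    also have "\<dots> \<le> C * (D0 * (B * ?M) + B' * ?M)"
      by (intro mult_left_mono add_mono) auto
    also have "\<dots> = C * (D0 * B + B') * ?M" by (simp only: distrib_right mult.assoc)
    also have "\<dots> \<le> c * ?M" unfolding c_def by (intro mult_right_mono) auto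
    finally show "?E \<le> c * ?M" .
  qed
  then show ?thesis unfolding inter_space_of N_def comp_def NLR_def[abs_def] LR_space_def interp_space_def[of A0 A1] .
qed

end

theorem theorem38:
  fixes A0 A1 :: "'a::real_vector qspace"
    and q1 r1 r r0 q0 :: ennreal
    and a1 b1 a a0 b0 \<chi>0 \<chi>1 \<rho> :: "real \<Rightarrow> real"
    and asharp :: "real \<Rightarrow> real \<Rightarrow> real"
    and \<theta>0 :: real
  assumes "quasi_banach A0" "quasi_banach A1" "compatible_couple A0 A1"
    and "pts A0 \<inter> pts A1 \<noteq> {0}"
    and "0 < q1" "0 < r1" "a1 \<in> SV" "b1 \<in> SV"
    and "Lq_norm r1 {1<..} (wt 0 r1 b1) < \<infinity>"
    and "Lq_norm r1 {0<..<1} (\<lambda>s. wt 0 r1 b1 s * Lq_norm q1 {0<..<s} (wt 0 q1 a1)) < \<infinity>"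
    and "\<And>t. 0 < t \<Longrightarrow> \<chi>1 t = enn2real
           (Lq_norm r1 {0<..<t} (\<lambda>s. wt 0 r1 b1 s * Lq_norm q1 {0<..<s} (wt 0 q1 a1))
            + Lq_norm r1 {t<..} (wt 0 r1 b1) * Lq_norm q1 {0<..<t} (wt 0 q1 a1))"
    and "0 < \<theta>0" "\<theta>0 < 1" "0 < r" "0 < r0" "0 < q0" "a \<in> SV" "a0 \<in> SV" "b0 \<in> SV"
    and "Lq_norm r0 {0<..<1} (wt 0 r0 b0) < \<infinity>"
    and "\<And>t. 0 < t \<Longrightarrow> \<chi>0 t = a0 t * enn2real (Lq_norm r0 {0<..<t} (wt 0 r0 b0))"
    and "\<And>t. 0 < t \<Longrightarrow> \<rho> t = t powr (1 - \<theta>0) * (\<chi>0 t / \<chi>1 t)"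
    and "\<And>\<theta> t. 0 \<le> \<theta> \<Longrightarrow> \<theta> \<le> 1 \<Longrightarrow> 0 < t \<Longrightarrow>
           asharp \<theta> t = \<chi>0 t powr (1 - \<theta>) * \<chi>1 t powr \<theta> * (a \<circ> \<rho>) t"
  shows "(\<forall>\<theta>. 0 < \<theta> \<and> \<theta> < 1 \<longrightarrow>
            space_eq
              (interp_space (R_space A0 A1 \<theta>0 r0 b0 q0 a0) (L_space A0 A1 1 r1 b1 q1 a1) \<theta> r a)
              (interp_space A0 A1 ((1 - \<theta>) * \<theta>0 + \<theta>) r (asharp \<theta>)))
       \<and> (Lq_norm r {1<..} (wt 0 r a) < \<infinity> \<longrightarrow>
            space_eq
              (interp_space (R_space A0 A1 \<theta>0 r0 b0 q0 a0) (L_space A0 A1 1 r1 b1 q1 a1) 0 r a)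
              (RL_space A0 A1 \<theta>0 r (a \<circ> \<rho>) r0 b0 q0 a0))
       \<and> (Lq_norm r {0<..<1} (wt 0 r a) < \<infinity> \<longrightarrow>
            space_eq
              (interp_space (R_space A0 A1 \<theta>0 r0 b0 q0 a0) (L_space A0 A1 1 r1 b1 q1 a1) 1 r a)
              (inter_space
                 (interp_space A0 A1 1 r (asharp 1))
                 (LR_space A0 A1 1 r (a \<circ> \<rho>) r1 b1 q1 a1)))"
proof -
  note as = assms(23)
  interpret W: weights q0 r0 q1 r1 a a0 b0 a1 b1 \<chi>0 \<chi>1 \<rho> \<theta>0
    by (unfold_locales; (rule assms SV_imp_slowvar)+)
  obtain L l2 where L: "0 < L" "grid (\<lambda>k. ln (\<rho> (exp (L * real_of_int k)))) 1 l2"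
    by (rule W.step_exists)
  interpret couple_setting q0 r0 q1 r1 a a0 b0 a1 b1 \<chi>0 \<chi>1 \<rho> \<theta>0 A0 A1 L l2
    by (intro couple_setting.intro couple_setting_axioms.intro W.weights_axioms L assms(3))
      (use assms(1,2) in \<open>simp_all add: quasi_banach_def\<close>)
  have 0: "space_eq (interp_space X0 X1 \<theta> r a) (interp_space A0 A1 ((1 - \<theta>) * \<theta>0 + \<theta>) r (asharp \<theta>))"
    if "0 < \<theta>" "\<theta> < 1" for \<theta>
    by (rule interp_theta_interior[OF assms(14) that]) (rule as; use that in simp)
  have 1: "space_eq (interp_space X0 X1 1 r a)
     (inter_space (interp_space A0 A1 1 r (asharp 1)) (LR_space A0 A1 1 r (a \<circ> \<rho>) r1 b1 q1 a1))"
    by (rule interp_theta_1[OF assms(14)]) (rule as; simp)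
  show ?thesis using 0 1 interp_theta_0[OF assms(14)] by blast
qed

end
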